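(* Let $m \ge n\ge 1$ be integers. The classification, up to isomorphism of $K$-algebras, of Artinian Gorenstein local $K$-algebras $A$ with Hilbert function $HF_A=\{1,m,n,1\}$ is equivalent to the projective classification of the cubic hypersurfaces $V(F)\subset \mathbb P^{n-1}_K$, where $F$ is a degree three non degenerate form in $n$ variables. That is, the assignment $F \mapsto A_{F+y_{n+1}^2+\dots+y_m^2}$ (which is $F\mapsto A_F$ when $m=n$) induces a bijection from the set of projective equivalence classes of hypersurfaces $V(F)$, with $F\in K[y_1,\dots,y_n]$ a non degenerate form of degree three, onto the set of $K$-algebra isomorphism classes of Artinian Gorenstein local $K$-algebras with Hilbert function $\{1,m,n,1\}$.
   Context: $K$ is an algebraically closed field of characteristic zero. All local algebras $(A,\mathfrak m)$ are finite length quotients of formal power series rings over $K$ in finitely many variables. The Hilbert function is $HF_A(i)=\dim_K(\mathfrak m^i/\mathfrak m^{i+1})$; $HF_A=\{1,m,n,1\}$ lists its values for $i=0,1,2,3$, with value $0$ for $i\ge4$. $A$ is Gorenstein if $\dim_K(0:\mathfrak m)=1$. Let $R=K[[x_1,\dots,x_m]]$ and $P=K[y_1,\dots,y_m]$. $P$ is an $R$-module via $f\circ g = f(\partial_{y_1},\dots,\partial_{y_m})(g)$. For $G\in P$, $\mathrm{Ann}_R(G)=\{f\in R: f\circ G=0\}$ and $A_G=R/\mathrm{Ann}_R(G)$. A form $F\in K[y_1,\dots,y_n]$ of degree three is non degenerate if the $K$-vector space spanned by its partial derivatives of order two has dimension $n$. Hypersurfaces $V(F)$ are considered as subschemes (so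 $F$ is determined up to a nonzero scalar), and $V(F)$, $V(G)$ in $\mathbb P^{n-1}_K$ are projectively equivalent if $G$ is obtained from $F$ by an invertible linear change of variables, up to a nonzero scalar. *)

theory Defs
  imports
    "HOL-Computational_Algebra.Polynomial"
    "HOL-Library.Poly_Mapping"
    "HOL-Algebra.Algebra"
    "Jordan_Normal_Form.Matrix"
begin

section \<open>Polynomials, power series and the action by differentiation\<close>

text \<open>
  Variables are indexed from \<open>0\<close>: the variables \<open>x\<^sub>1, \<dots>, x\<^sub>m\<close> (or \<open>y\<^sub>1, \<dots>, y\<^sub>m\<close>)
  are the indices \<open>i < m\<close>. An exponent vector is a finitely supported function; the number
  of variables is controlled by restricting the support.
\<close>

type_synonym expo = "nat \<Rightarrow>\<^sub>0 nat"
type_synonym 'k mpoly = "expo \<Rightarrow>\<^sub>0 'k"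
type_synonym 'k mpser = "expo \<Rightarrow> 'k"

definition pconst :: "'k::comm_ring_1 \<Rightarrow> 'k mpoly" where
  "pconst c = Poly_Mapping.single 0 c"

definition pvar :: "nat \<Rightarrow> 'k::comm_ring_1 mpoly" where
  "pvar i = Poly_Mapping.single (Poly_Mapping.single i 1) 1"

definition pscale :: "'k::comm_ring_1 \<Rightarrow> 'k mpoly \<Rightarrow> 'k mpoly" where
  "pscale c p = pconst c * p"

interpretation mpoly: vector_space "pscale :: 'k::field \<Rightarrow> 'k mpoly \<Rightarrow> 'k mpoly"
  by unfold_locales
    (simp_all add: pscale_def pconst_def algebra_simps single_add mult_single flip: mult.assoc)

definition mpolys :: "nat \<Rightarrow> 'k::comm_ring_1 mpoly set" where
  "mpolys n = {p. \<forall>a\<in>Poly_Mapping.keys p. Poly_Mapping.keys a \<subseteq> {..<n}}"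

definition total_degree :: "expo \<Rightarrow> nat" where
  "total_degree a = (\<Sum>i\<in>Poly_Mapping.keys a. Poly_Mapping.lookup a i)"

text \<open>\<open>forms n d\<close> contains the zero polynomial.\<close>

definition forms :: "nat \<Rightarrow> nat \<Rightarrow> 'k::comm_ring_1 mpoly set" where
  "forms n d = {p \<in> mpolys n. \<forall>a\<in>Poly_Mapping.keys p. total_degree a = d}"

text \<open>
  The partial derivative with respect to the variable \<open>i\<close>. The exponent subtraction
  truncates, but only in terms whose coefficient is \<open>0\<close>.
\<close>

definition pd :: "nat \<Rightarrow> 'k::comm_ring_1 mpoly \<Rightarrow> 'k mpoly" where
  "pd i p = (\<Sum>a\<in>Poly_Mapping.keys p. Poly_Mapping.single (a - Poly_Mapping.single i 1)
     (of_nat (Poly_Mapping.lookup a i) * Poly_Mapping.lookup p a))"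

text \<open>\<open>pds a\<close> is the iterated derivative \<open>\<partial>\<^sup>a\<close>.\<close>

definition pds :: "expo \<Rightarrow> 'k::comm_ring_1 mpoly \<Rightarrow> 'k mpoly" where
  "pds a = fold (\<lambda>i. pd i ^^ Poly_Mapping.lookup a i) (sorted_list_of_set (Poly_Mapping.keys a))"

lemma finite_expo_antidiagonal: "finite {(b :: expo, c). b + c = a}"
proof -
  let ?L = "Poly_Mapping.lookup"
  have "finite {f :: nat \<Rightarrow> nat. \<forall>i. (i \<in> Poly_Mapping.keys a \<longrightarrow> f i \<in> {..Max (?L a ` Poly_Mapping.keys a)}) \<and>
      (i \<notin> Poly_Mapping.keys a \<longrightarrow> f i = 0)}" (is "finite ?S")
    by (rule finite_set_of_finite_funs) auto
  moreover have "?L ` {b. \<exists>c. b + c = a} \<subseteq> ?S"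
  proof clarsimp
    fix b c :: expo and i
    show "(i \<in> Poly_Mapping.keys (b + c) \<longrightarrow> ?L b i \<le> Max (?L (b + c) ` Poly_Mapping.keys (b + c))) \<and>
      (i \<notin> Poly_Mapping.keys (b + c) \<longrightarrow> ?L b i = 0)"
    proof (intro conjI impI)
      assume "i \<in> Poly_Mapping.keys (b + c)"
      then have "?L (b + c) i \<le> Max (?L (b + c) ` Poly_Mapping.keys (b + c))"
        by (intro Max_ge) auto
      then show "?L b i \<le> Max (?L (b + c) ` Poly_Mapping.keys (b + c))"
        by (simp add: lookup_add)
    qed (simp add: in_keys_iff lookup_add)
  qed
  ultimately have "finite (?L ` {b. \<exists>c. b + c = a})" by (rule finite_subset[rotated])
  moreover have "inj_on ?L {b. \<exists>c. b + c = a}"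
    by (rule inj_onI) (simp only: lookup_inject)
  ultimately have "finite {b. \<exists>c. b + c = a}" by (rule finite_imageD)
  then have "finite ((\<lambda>b. (b, a - b)) ` {b. \<exists>c. b + c = a})" by simp
  moreover have "{(b, c). b + c = a} \<subseteq> (\<lambda>b. (b, a - b)) ` {b. \<exists>c. b + c = a}" by auto
  ultimately show ?thesis by (rule finite_subset[rotated])
qed

lemma lookup_pd: "Poly_Mapping.lookup (pd i p) a =
    of_nat (Suc (Poly_Mapping.lookup a i)) * Poly_Mapping.lookup p (a + Poly_Mapping.single i 1)"
proof -
  let ?L = "Poly_Mapping.lookup" and ?e = "Poly_Mapping.single i 1 :: expo"
  have *: "?L (Poly_Mapping.single (b - ?e) (of_nat (?L b i) * ?L p b)) a =
      (if b = a + ?e then of_nat (Suc (?L a i)) * ?L p b else 0)" for b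
  proof (cases "?L b i = 0")
    case True
    then have "b \<noteq> a + ?e" by (auto simp: lookup_add)
    with True show ?thesis by simp
  next
    case False
    then have "b - ?e + ?e = b"
      by (intro poly_mapping_eqI) (auto simp: lookup_add lookup_minus lookup_single when_def)
    then have "b - ?e = a \<longleftrightarrow> b = a + ?e" by (metis add_diff_cancel_right')
    then show ?thesis by (auto simp: lookup_single when_def lookup_add)
  qed
  have "?L (pd i p) a = (\<Sum>b\<in>Poly_Mapping.keys p. if b = a + ?e then of_nat (Suc (?L a i)) * ?L p b else 0)"
    by (simp only: pd_def lookup_sum *)
  also have "\<dots> = of_nat (Suc (?L a i)) * ?L p (a + ?e)"
    by (cases "a + ?e \<in> Poly_Mapping.keys p") (simp_all add: sum.delta' in_keys_iff del: One_nat_def)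
  finally show ?thesis .
qed

lemma keys_pds:
  assumes "b \<in> Poly_Mapping.keys (pds a g)"
  shows "b + a \<in> Poly_Mapping.keys g"
proof -
  let ?L = "Poly_Mapping.lookup" and ?K = "Poly_Mapping.keys"
  have 1: "b + Poly_Mapping.single i k \<in> ?K p" if "b \<in> ?K ((pd i ^^ k) p)" for b i k and p :: "'a mpoly"
    using that
  proof (induction k arbitrary: b)
    case (Suc k)
    then have "b + Poly_Mapping.single i 1 \<in> ?K ((pd i ^^ k) p)"
      by (auto simp: in_keys_iff lookup_pd)
    from Suc.IH[OF this] show ?case by (simp add: add.assoc flip: single_add)
  qed simp
  have 2: "b + (\<Sum>i\<in>set xs. Poly_Mapping.single i (?L a i)) \<in> ?K p"
    if "distinct xs" "b \<in> ?K (fold (\<lambda>i. pd i ^^ ?L a i) xs p)" for xs b and p :: "'a mpoly"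
    using that
  proof (induction xs arbitrary: p)
    case (Cons i xs)
    then have "b + (\<Sum>i\<in>set xs. Poly_Mapping.single i (?L a i)) \<in> ?K ((pd i ^^ ?L a i) p)" by simp
    from 1[OF this] Cons.prems show ?case by (simp add: ac_simps)
  qed simp
  have "(\<Sum>i\<in>?K a. Poly_Mapping.single i (?L a i)) = a"
    by (intro poly_mapping_eqI) (simp add: lookup_sum lookup_single when_def in_keys_iff)
  with 2[of "sorted_list_of_set (?K a)" b g] assms show ?thesis by (simp add: pds_def)
qed

lemma finite_pds_support: "finite {a. pds a g \<noteq> 0}"
proof (rule finite_subset)
  show "{a. pds a g \<noteq> 0} \<subseteq> (\<Union>d\<in>Poly_Mapping.keys g. snd ` {(b, a). b + a = d})"
  proof
    fix a assume "a \<in> {a. pds a g \<noteq> 0}"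
    then obtain b where "b \<in> Poly_Mapping.keys (pds a g)" by (auto simp flip: keys_eq_empty)
    from keys_pds[OF this] show "a \<in> (\<Union>d\<in>Poly_Mapping.keys g. snd ` {(b, a). b + a = d})" by force
  qed
qed (auto simp: finite_expo_antidiagonal)

text \<open>
  The action of a power series \<open>f\<close> on a polynomial \<open>g\<close>. All but finitely many
  \<open>\<partial>\<^sup>a g\<close> vanish (lemma \<open>finite_pds_support\<close>), so \<open>Sum_any\<close> is a genuine sum.
\<close>

definition act :: "'k::comm_ring_1 mpser \<Rightarrow> 'k mpoly \<Rightarrow> 'k mpoly" where
  "act f g = Sum_any (\<lambda>a. pscale (f a) (pds a g))"

text \<open>
  The ring \<open>K[[x\<^sub>1, \<dots>, x\<^sub>m]]\<close> with its \<open>K\<close>-algebra structure. The sum in the product is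
  finite (lemma \<open>finite_expo_antidiagonal\<close>).
\<close>

definition pser_alg :: "nat \<Rightarrow> ('k::comm_ring_1, 'k mpser) module" where
  "pser_alg m = \<lparr>
     carrier = {f. \<forall>a. f a \<noteq> 0 \<longrightarrow> Poly_Mapping.keys a \<subseteq> {..<m}},
     mult = (\<lambda>f g a. \<Sum>(b, c) | b + c = a. f b * g c),
     one = (\<lambda>a. if a = 0 then 1 else 0),
     ring.zero = (\<lambda>a. 0),
     add = (\<lambda>f g a. f a + g a),
     module.smult = (\<lambda>c f a. c * f a)\<rparr>"

lemma pser_mult_assoc:
  fixes f g h :: "'k::comm_ring_1 mpser"
  shows "(\<Sum>(p, d) | p + d = a. (\<Sum>(b, c) | b + c = p. f b * g c) * h d) =
    (\<Sum>(b, q) | b + q = a. f b * (\<Sum>(c, d) | c + d = q. g c * h d))"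
proof -
  note fin = finite_expo_antidiagonal
  have "(\<Sum>(p, d) | p + d = a. (\<Sum>(b, c) | b + c = p. f b * g c) * h d) =
     (\<Sum>x\<in>{(p,d). p + d = a}. \<Sum>y\<in>{(b,c). b + c = fst x}. f (fst y) * g (snd y) * h (snd x))"
    by (simp add: sum_distrib_right case_prod_unfold)
  also have "\<dots> = (\<Sum>(x, y)\<in>(SIGMA x:{(p,d). p + d = a}. {(b,c). b + c = fst x}).
      f (fst y) * g (snd y) * h (snd x))"
    by (rule sum.Sigma) (auto simp: fin)
  also have "\<dots> = (\<Sum>(x, y)\<in>(SIGMA x:{(b,q). b + q = a}. {(c,d). c + d = snd x}).
      f (fst x) * (g (fst y) * h (snd y)))"
    by (rule sum.reindex_bij_witness[where
       i = "\<lambda>x. ((fst (fst x) + fst (snd x), snd (snd x)), (fst (fst x), fst (snd x)))"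
       and j = "\<lambda>x. ((fst (snd x), snd (snd x) + snd (fst x)), (snd (snd x), snd (fst x)))"])
      (auto simp: ac_simps)
  also have "\<dots> = (\<Sum>x\<in>{(b,q). b + q = a}. \<Sum>y\<in>{(c,d). c + d = snd x}. f (fst x) * (g (fst y) * h (snd y)))"
    by (rule sum.Sigma[symmetric]) (auto simp: fin)
  also have "\<dots> = (\<Sum>(b, q) | b + q = a. f b * (\<Sum>(c, d) | c + d = q. g c * h d))"
    by (simp add: sum_distrib_left case_prod_unfold)
  finally show ?thesis .
qed

lemma keys_expo_add: "Poly_Mapping.keys (b + c :: expo) = Poly_Mapping.keys b \<union> Poly_Mapping.keys c"
  by (auto simp: in_keys_iff lookup_add)

lemma cring_pser_alg: "cring (pser_alg m :: ('k::comm_ring_1, 'k mpser) module)"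
proof (rule cringI)
  show "abelian_group (pser_alg m :: ('k, 'k mpser) module)"
  proof (rule abelian_groupI)
    fix f :: "'k mpser" assume "f \<in> carrier (pser_alg m :: ('k, 'k mpser) module)"
    then show "\<exists>g\<in>carrier (pser_alg m). g \<oplus>\<^bsub>pser_alg m\<^esub> f = \<zero>\<^bsub>pser_alg m\<^esub>"
      by (intro bexI[of _ "\<lambda>a. - f a"]) (auto simp: pser_alg_def)
  next
    fix f g :: "'k mpser" assume *: "f \<in> carrier (pser_alg m :: ('k, 'k mpser) module)" "g \<in> carrier (pser_alg m)"
    have "Poly_Mapping.keys a \<subseteq> {..<m}" if "f a + g a \<noteq> 0" for a
    proof -
      from that have "f a \<noteq> 0 \<or> g a \<noteq> 0" by auto
      with * show ?thesis by (auto simp: pser_alg_def)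
    qed
    then show "f \<oplus>\<^bsub>pser_alg m\<^esub> g \<in> carrier (pser_alg m)"
      by (simp add: pser_alg_def)
  qed (simp_all add: pser_alg_def fun_eq_iff ac_simps)
  show "comm_monoid (pser_alg m :: ('k, 'k mpser) module)"
  proof (rule comm_monoidI)
    fix f g :: "'k mpser" assume *: "f \<in> carrier (pser_alg m :: ('k, 'k mpser) module)" "g \<in> carrier (pser_alg m)"
    have "Poly_Mapping.keys a \<subseteq> {..<m}" if nz: "(\<Sum>(b, c) | b + c = a. f b * g c) \<noteq> 0" for a
    proof -
      from nz obtain b c where "b + c = a" "f b * g c \<noteq> 0"
        by (rule sum.not_neutral_contains_not_neutral) auto
      then have "f b \<noteq> 0" "g c \<noteq> 0" by auto
      with * have "Poly_Mapping.keys b \<subseteq> {..<m}" "Poly_Mapping.keys c \<subseteq> {..<m}"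
        by (simp_all add: pser_alg_def)
      with \<open>b + c = a\<close> show ?thesis by (auto simp: keys_expo_add)
    qed
    then show "f \<otimes>\<^bsub>pser_alg m\<^esub> g \<in> carrier (pser_alg m)"
      by (simp add: pser_alg_def)
    show "f \<otimes>\<^bsub>pser_alg m\<^esub> g = g \<otimes>\<^bsub>pser_alg m\<^esub> f"
      unfolding pser_alg_def
      by (auto intro!: ext sum.reindex_bij_witness[where i = prod.swap and j = prod.swap] simp: ac_simps)
  next
    fix f :: "'k mpser" assume "f \<in> carrier (pser_alg m :: ('k, 'k mpser) module)"
    have "(\<Sum>(b, c) | b + c = a. (if b = 0 then 1 else 0) * f c) = f a" for a
    proof -
      have "(\<Sum>(b, c) | b + c = a. (if b = 0 then 1 else 0) * f c) =
          (\<Sum>(b, c) \<in> {(0 :: expo, a)}. (if b = 0 then 1 else 0) * f c)"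
        by (rule sum.mono_neutral_right) (auto simp: finite_expo_antidiagonal split: if_splits)
      then show ?thesis by simp
    qed
    then show "\<one>\<^bsub>pser_alg m\<^esub> \<otimes>\<^bsub>pser_alg m\<^esub> f = f"
      by (simp add: pser_alg_def)
  qed (auto simp: pser_alg_def pser_mult_assoc)
  fix f g h :: "'k mpser"
  show "(f \<oplus>\<^bsub>pser_alg m\<^esub> g) \<otimes>\<^bsub>pser_alg m\<^esub> h = f \<otimes>\<^bsub>pser_alg m\<^esub> h \<oplus>\<^bsub>pser_alg m\<^esub> g \<otimes>\<^bsub>pser_alg m\<^esub> h"
    by (simp add: pser_alg_def distrib_right case_prod_unfold sum.distrib)
qed


section \<open>Algebras over a field\<close>

text \<open>
  The base field is a type \<open>'k\<close>; a \<open>'k\<close>-algebra is a ring record together with a scalar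
  multiplication by \<open>'k\<close>.
\<close>

definition quot_alg :: "('k, 'a) module \<Rightarrow> 'a set \<Rightarrow> ('k, 'a set) module" where
  "quot_alg A I = ring.extend (A Quot I)
     (module.fields (\<lambda>c S. \<Union>x\<in>S. I +>\<^bsub>A\<^esub> (c \<odot>\<^bsub>A\<^esub> x)))"

definition alg_iso :: "('k, 'a) module \<Rightarrow> ('k, 'b) module \<Rightarrow> bool" where
  "alg_iso A B \<longleftrightarrow> (\<exists>\<phi>\<in>ring_iso A B. \<forall>c. \<forall>a\<in>carrier A. \<phi> (c \<odot>\<^bsub>A\<^esub> a) = c \<odot>\<^bsub>B\<^esub> \<phi> a)"

text \<open>
  The image of the base field in \<open>A\<close>. Dimensions are taken over this subfield, using
  \<open>ring.dimension\<close>: \<open>ring.dimension A d (scalars A) V\<close> says that \<open>V\<close> has finite dimension \<open>d\<close>.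
\<close>

definition scalars :: "('k, 'a) module \<Rightarrow> 'a set" where
  "scalars A = range (\<lambda>c. c \<odot>\<^bsub>A\<^esub> \<one>\<^bsub>A\<^esub>)"

definition max_ideal :: "('k, 'a) module \<Rightarrow> 'a set" where
  "max_ideal A = (THE M. maximalideal M A)"

definition ideal_power :: "('k, 'a) module \<Rightarrow> 'a set \<Rightarrow> nat \<Rightarrow> 'a set" where
  "ideal_power A I i = (ideal_prod A I ^^ i) (carrier A)"

text \<open>
  Finite length of \<open>A\<close> as a module over itself, whose submodules are the ideals.
\<close>

definition finite_length :: "('k, 'a) module \<Rightarrow> bool" where
  "finite_length A \<longleftrightarrow> (\<exists>N. \<forall>k. \<forall>J :: nat \<Rightarrow> 'a set.
     (\<forall>i\<le>k. ideal (J i) A) \<and> (\<forall>i<k. J i \<subset> J (Suc i)) \<longrightarrow> k \<le> N)"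

text \<open>
  Finite length quotients of formal power series rings. The proper ideal makes the
  quotient a nonzero ring, hence local, so \<open>max_ideal\<close> is well defined on it.
\<close>

definition artin_local_algs :: "('k::field, 'k mpser set) module set" where
  "artin_local_algs = {quot_alg (pser_alg r) I | r I.
     ideal I (pser_alg r :: ('k, 'k mpser) module) \<and> I \<noteq> carrier (pser_alg r) \<and>
     finite_length (quot_alg (pser_alg r) I)}"

text \<open>
  \<open>HF\<^sub>A(i) = h i\<close> for all \<open>i\<close>. The quotient \<open>\<mm>\<^sup>i/\<mm>\<^sup>i\<^sup>+\<^sup>1\<close> is realised
  as the set of cosets of \<open>\<mm>\<^sup>i\<^sup>+\<^sup>1\<close> represented by \<open>\<mm>\<^sup>i\<close> inside \<open>A/\<mm>\<^sup>i\<^sup>+\<^sup>1\<close>.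
\<close>

definition has_hilbert_function :: "('k, 'a) module \<Rightarrow> (nat \<Rightarrow> nat) \<Rightarrow> bool" where
  "has_hilbert_function A h \<longleftrightarrow> (\<forall>i.
     let P = ideal_power A (max_ideal A);
         B = quot_alg A (P (Suc i))
     in ring.dimension B (h i) (scalars B) ((\<lambda>x. P (Suc i) +>\<^bsub>A\<^esub> x) ` P i))"

definition socle :: "('k, 'a) module \<Rightarrow> 'a set" where
  "socle A = {a \<in> carrier A. \<forall>x\<in>max_ideal A. a \<otimes>\<^bsub>A\<^esub> x = \<zero>\<^bsub>A\<^esub>}"

definition gorenstein :: "('k, 'a) module \<Rightarrow> bool" where
  "gorenstein A \<longleftrightarrow> ring.dimension A 1 (scalars A) (socle A)"

definition gor_algs :: "nat \<Rightarrow> nat \<Rightarrow> ('k::field, 'k mpser set) module set" where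
  "gor_algs m n = {A \<in> artin_local_algs. gorenstein A \<and>
     has_hilbert_function A (\<lambda>i. if i < 4 then [1, m, n, 1] ! i else 0)}"

definition gor_iso :: "nat \<Rightarrow> nat \<Rightarrow>
    (('k::field, 'k mpser set) module \<times> ('k, 'k mpser set) module) set" where
  "gor_iso m n = {(A, B). A \<in> gor_algs m n \<and> B \<in> gor_algs m n \<and> alg_iso A B}"


section \<open>Inverse systems\<close>

definition annihilator :: "nat \<Rightarrow> 'k::comm_ring_1 mpoly \<Rightarrow> 'k mpser set" where
  "annihilator m G = {f \<in> carrier (pser_alg m). act f G = 0}"

definition inv_sys_alg :: "nat \<Rightarrow> 'k::comm_ring_1 mpoly \<Rightarrow> ('k, 'k mpser set) module" where
  "inv_sys_alg m G = quot_alg (pser_alg m) (annihilator m G)"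

definition cubic_alg :: "nat \<Rightarrow> nat \<Rightarrow> 'k::comm_ring_1 mpoly \<Rightarrow> ('k, 'k mpser set) module" where
  "cubic_alg m n F = inv_sys_alg m (F + (\<Sum>i = n..<m. pvar i ^ 2))"


section \<open>Non degenerate cubics and projective equivalence\<close>

definition nondeg_cubics :: "nat \<Rightarrow> 'k::field mpoly set" where
  "nondeg_cubics n = {F \<in> forms n 3.
     mpoly.dim (mpoly.span {pd i (pd j F) | i j. i < n \<and> j < n}) = n}"

text \<open>The substitution \<open>y\<^sub>i \<mapsto> \<Sum>\<^sub>j M\<^sub>i\<^sub>j y\<^sub>j\<close> in a polynomial in \<open>n\<close> variables.\<close>

definition lin_subst :: "nat \<Rightarrow> 'k::comm_ring_1 mat \<Rightarrow> 'k mpoly \<Rightarrow> 'k mpoly" where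
  "lin_subst n M F = (\<Sum>a\<in>Poly_Mapping.keys F. pscale (Poly_Mapping.lookup F a)
     (\<Prod>i\<in>Poly_Mapping.keys a. (\<Sum>j<n. pscale (M $$ (i, j)) (pvar j)) ^ Poly_Mapping.lookup a i))"

text \<open>
  A hypersurface \<open>V(F)\<close> is represented by any of its equations, which differ by nonzero
  scalars; these are identified by the relation. Its classes are thus the projective
  equivalence classes of the hypersurfaces \<open>V(F)\<close>.
\<close>

definition proj_equiv :: "nat \<Rightarrow> ('k::field mpoly \<times> 'k mpoly) set" where
  "proj_equiv n = {(F, G). F \<in> nondeg_cubics n \<and> G \<in> nondeg_cubics n \<and>
     (\<exists>M c. M \<in> carrier_mat n n \<and> invertible_mat M \<and> c \<noteq> 0 \<and> G = pscale c (lin_subst n M F))}"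

end

theory Submission
  imports Defs "Jordan_Normal_Form.Determinant"
begin

text \<open>
  Let \<open>A\<close> be Gorenstein with Hilbert function \<open>{1, m, n, 1}\<close> and maximal ideal \<open>\<mm>\<close>, and let \<open>\<phi>\<close> be a
  functional on \<open>A\<close> that does not vanish on the socle \<open>\<mm>\<^sup>3\<close>, so that \<open>(a, b) \<mapsto> \<phi>(ab)\<close> is non degenerate.
  It pairs \<open>\<mm>/N\<close> with \<open>\<mm>\<^sup>2/\<mm>\<^sup>3\<close> perfectly, where \<open>N = \<mm> \<inter> (0 : \<mm>\<^sup>2)\<close>, and it is non degenerate on
  \<open>N/\<mm>\<^sup>2\<close>. Take an orthogonal basis of \<open>N/\<mm>\<^sup>2\<close> and \<open>n\<close> elements of \<open>\<mm>\<close> that form a basis modulo \<open>N\<close>;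
  correcting the latter by elements of \<open>N\<close> and \<open>\<mm>\<^sup>2\<close> removes all their quadratic products under \<open>\<phi>\<close>.
  For the resulting generators \<open>z\<^sub>i\<close> the values \<open>\<phi>(z\<^sup>a)\<close> are \<open>a!\<close> times the coefficients of
  \<open>F + y\<^sub>n\<^sub>+\<^sub>1\<^sup>2 + \<dots> + y\<^sub>m\<^sup>2\<close> for a cubic form \<open>F\<close> in \<open>n\<close> variables, and by duality the kernel of \<open>x\<^sub>i \<mapsto> z\<^sub>i\<close> is the
  annihilator of this polynomial. Conversely, the trilinear form \<open>\<phi>(abc)\<close> on \<open>\<mm>/N\<close> depends only on \<open>A\<close>,
  up to a scalar, and it is the polarisation of \<open>F\<close>.
\<close>

section \<open>Linear algebra modulo a subspace\<close>

text \<open>Algebraic closure supplies two square roots: one rescales an orthogonal basis of N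
  modulo the square of the maximal ideal, the other absorbs the scalar by which an equation of V(F)
  may be multiplied. Characteristic zero makes the factorials a! invertible, so third derivatives
  recover F. The Hilbert function alone says only that the fourth and fifth powers of the maximal
  ideal agree; finite length and Nakayama make the fourth power zero. Non-degeneracy of the
  functional depends only on its restriction to the socle, so it may be altered outside the square
  of the maximal ideal; this removes the constant and linear terms. One criterion serves twice:
  generators and a non-degenerate functional with prescribed values on monomials determine the
  algebra. It gives surjectivity, and also well-definedness, because a projectively equivalent cubic
  arises from other generators of the same algebra. The algebras are records of cosets, so the
  computations take place in a ring type mapped onto them: ideals become preimages, zero becomes the
  kernel, and dimensions of quotients become independence and spanning modulo a subspace.\<close>

lemma homogeneous_system:
  fixes M :: "'i \<Rightarrow> 'j \<Rightarrow> 'k::field"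
  assumes "finite I" "finite J" "card I < card J"
  shows "\<exists>c. (\<exists>j\<in>J. c j \<noteq> 0) \<and> (\<forall>i\<in>I. (\<Sum>j\<in>J. M i j * c j) = 0)"
  using assms
proof (induction I arbitrary: J M rule: finite_induct)
  case empty
  then have "J \<noteq> {}" by auto
  then show ?case by (intro exI[of _ "\<lambda>_. 1"]) auto
next
  case (insert i I)
  show ?case
  proof (cases "\<forall>j\<in>J. M i j = 0")
    case True
    obtain c where "\<exists>j\<in>J. c j \<noteq> 0" "\<forall>i\<in>I. (\<Sum>j\<in>J. M i j * c j) = 0"
      using insert.IH[of J M] insert.prems insert.hyps by auto
    with True show ?thesis by (intro exI[of _ c]) auto
  next
    case False
    then obtain p where p: "p \<in> J" "M i p \<noteq> 0" by auto
    define J' where "J' = J - {p}"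
    \<comment> \<open>Gaussian elimination: equation \<open>i\<close> is solved for the unknown
      \<open>p\<close>, and a multiple of it is subtracted from every other equation so that
      \<open>p\<close> disappears there.\<close>
    define M' where "M' = (\<lambda>i' j. M i' j - M i' p / M i p * M i j)"
    have J: "J = insert p J'" "p \<notin> J'" "finite J'" using p insert.prems by (auto simp: J'_def)
    have "card I < card J'" using insert.prems insert.hyps J by simp
    then obtain c where c: "\<exists>j\<in>J'. c j \<noteq> 0" "\<forall>i\<in>I. (\<Sum>j\<in>J'. M' i j * c j) = 0"
      using insert.IH[of J' M'] J by auto
    define t where "t = - (\<Sum>j\<in>J'. M i j * c j) / M i p"
    define c' where "c' = c(p := t)"
    have c'J: "(\<Sum>j\<in>J. M i' j * c' j) = M i' p * t + (\<Sum>j\<in>J'. M i' j * c j)" for i'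
    proof -
      have "(\<Sum>j\<in>J'. M i' j * c' j) = (\<Sum>j\<in>J'. M i' j * c j)"
        using J by (intro sum.cong) (auto simp: c'_def)
      then show ?thesis using J by (simp add: c'_def)
    qed
    have "(\<Sum>j\<in>J. M i' j * c' j) = 0" if "i' \<in> I" for i'
    proof -
      have "0 = (\<Sum>j\<in>J'. M' i' j * c j)" using c that by simp
      also have "\<dots> = (\<Sum>j\<in>J'. M i' j * c j) - M i' p / M i p * (\<Sum>j\<in>J'. M i j * c j)"
        by (simp add: M'_def left_diff_distrib sum_subtractf sum_distrib_left mult.assoc)
      finally show ?thesis using p by (simp add: c'J t_def)
    qed
    moreover have "(\<Sum>j\<in>J. M i j * c' j) = 0" using p by (simp add: c'J t_def)
    moreover have "\<exists>j\<in>J. c' j \<noteq> 0"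
    proof -
      from c obtain j where "j \<in> J'" "c j \<noteq> 0" by auto
      with J have "c' j \<noteq> 0" "j \<in> J" by (auto simp: c'_def)
      then show ?thesis by auto
    qed
    ultimately show ?thesis by (intro exI[of _ c']) auto
  qed
qed

lemma vector_space_mult: "vector_space ((*) :: 'k::field \<Rightarrow> 'k \<Rightarrow> 'k)"
  by (rule vector_space.intro) (simp_all add: distrib_left distrib_right)

text \<open>A commutative algebra over the field \<open>'k\<close>, encoded as a ring type with a
  ring homomorphism from the field. Ring arithmetic is then available without carrier sets, and
  scalar multiples are the products \<open>s c * x\<close>.\<close>

locale scalar_hom =
  fixes s :: "'k::field \<Rightarrow> 'r::comm_ring_1"
  assumes s_add: "s (a + b) = s a + s b"
    and s_mult: "s (a * b) = s a * s b"
    and s_1 [simp]: "s 1 = 1"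
begin

sublocale vs: vector_space "\<lambda>c x. s c * x"
  by unfold_locales (simp_all add: s_add s_mult algebra_simps)

lemma s_0 [simp]: "s 0 = 0" using s_add[of 0 0] by simp

lemma s_minus: "s (- a) = - s a"
  using s_add[of a "- a"] by (simp add: eq_neg_iff_add_eq_0 add.commute)

definition linfun :: "('r \<Rightarrow> 'k) \<Rightarrow> bool" where
  "linfun f \<longleftrightarrow> (\<forall>x y. f (x + y) = f x + f y) \<and> (\<forall>c x. f (s c * x) = c * f x)"

lemma linfun_add: "linfun f \<Longrightarrow> f (x + y) = f x + f y"
  and linfun_scale: "linfun f \<Longrightarrow> f (s c * x) = c * f x"
  by (auto simp: linfun_def)

lemma linfun_0: "linfun f \<Longrightarrow> f 0 = 0"
  using linfun_scale[of f 0 0] by simp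

lemma linfun_minus: "linfun f \<Longrightarrow> f (- x) = - f x"
  using linfun_add[of f x "- x"] linfun_0[of f] by (simp add: eq_neg_iff_add_eq_0 add.commute)

lemma linfun_diff: "linfun f \<Longrightarrow> f (x - y) = f x - f y"
  using linfun_add[of f x "- y"] linfun_minus[of f y] by simp

lemma linfun_sum: "linfun f \<Longrightarrow> f (\<Sum>i\<in>I. g i) = (\<Sum>i\<in>I. f (g i))"
  by (induction I rule: infinite_finite_induct) (auto simp: linfun_0 linfun_add)

lemmas linfun_simps = linfun_add linfun_scale linfun_0 linfun_minus linfun_diff linfun_sum

lemma linfun_times: "linfun f \<Longrightarrow> linfun (\<lambda>x. f (x * y))"
  unfolding linfun_def by (simp add: distrib_right mult.assoc)

text \<open>A basis of \<open>W\<close> stays independent when \<open>x\<close> is added, so the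
  values 0 on the basis and 1 at \<open>x\<close> may be prescribed.\<close>

lemma linfun_separate:
  assumes "vs.subspace W" "x \<notin> W"
  shows "\<exists>f. linfun f \<and> (\<forall>w\<in>W. f w = 0) \<and> f x = 1"
proof -
  obtain B where B: "B \<subseteq> W" "vs.independent B" "W \<subseteq> vs.span B" "card B = vs.dim W"
    by (rule vs.basis_exists)
  have sB: "vs.span B = W" using B assms(1) by (simp add: vs.span_minimal subset_antisym)
  have "vs.independent (insert x B)" using B sB assms(2) by (simp add: vs.independent_insertI)
  from vector_space_pair.linear_independent_extend[OF
      vector_space_pair.intro[OF vs.vector_space_axioms vector_space_mult] this,
      of "\<lambda>b. if b = x then 1 else 0"]
  obtain f where f: "Vector_Spaces.linear (\<lambda>c x. s c * x) (*) f"
    "\<forall>b\<in>insert x B. f b = (if b = x then 1 else 0)" by blast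
  interpret f: Vector_Spaces.linear "\<lambda>c x. s c * x" "(*) :: 'k \<Rightarrow> 'k \<Rightarrow> 'k" f by (rule f)
  have lf: "linfun f" by (auto simp: linfun_def f.add f.scale)
  have 0: "f w = 0" if "w \<in> W" for w
    using that unfolding sB[symmetric]
  proof (induction rule: vs.span_induct_alt)
    case (step c b y)
    then have "b \<noteq> x" using B assms(2) by auto
    with step f(2) lf show ?case by (auto simp: linfun_simps)
  qed (simp add: linfun_simps lf)
  show ?thesis using f(2) 0 lf by (intro exI[of _ f]) auto
qed

text \<open>Independence of the images in the quotient by \<open>W\<close>. Together with
  \<open>spans_mod\<close> it handles subquotients through representatives, without forming quotient
  spaces.\<close>

definition indep_mod :: "'r set \<Rightarrow> nat \<Rightarrow> (nat \<Rightarrow> 'r) \<Rightarrow> bool" where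
  "indep_mod W d u \<longleftrightarrow> (\<forall>c. (\<Sum>j<d. s (c j) * u j) \<in> W \<longrightarrow> (\<forall>j<d. c j = 0))"

definition spans_mod :: "'r set \<Rightarrow> nat \<Rightarrow> (nat \<Rightarrow> 'r) \<Rightarrow> 'r set \<Rightarrow> bool" where
  "spans_mod W d u U \<longleftrightarrow> (\<forall>x\<in>U. \<exists>c. x - (\<Sum>j<d. s (c j) * u j) \<in> W)"

lemma spans_modE:
  assumes "spans_mod W d u U" "x \<in> U"
  obtains c where "x - (\<Sum>j<d. s (c j) * u j) \<in> W"
  using assms by (auto simp: spans_mod_def)

text \<open>For subspaces this is the dimension of the image of \<open>U\<close> in the quotient by
  \<open>W\<close>; it does not presuppose that \<open>W\<close> is contained in
  \<open>U\<close>.\<close>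

definition reldim :: "nat \<Rightarrow> 'r set \<Rightarrow> 'r set \<Rightarrow> bool" where
  "reldim d U W \<longleftrightarrow> (\<exists>u. (\<forall>j<d. u j \<in> U) \<and> spans_mod W d u U \<and> indep_mod W d u)"

text \<open>If \<open>k\<close> exceeded \<open>d\<close>, the coefficients of the
  \<open>u j\<close> over the \<open>t i\<close> would form a homogeneous system with more unknowns
  than equations; a nontrivial solution is a relation among the \<open>u j\<close> modulo
  \<open>W\<close>.\<close>

lemma steinitz_mod:
  assumes W: "vs.subspace W" and span: "spans_mod W d t U"
    and u: "\<And>j. j < k \<Longrightarrow> u j \<in> U" and ind: "indep_mod W k u"
  shows "k \<le> d"
proof (rule ccontr)
  assume "\<not> k \<le> d"
  have "\<forall>j. \<exists>c. j < k \<longrightarrow> u j - (\<Sum>i<d. s (c i) * t i) \<in> W"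
    using span u by (auto simp: spans_mod_def)
  then obtain M where M: "\<And>j. j < k \<Longrightarrow> u j - (\<Sum>i<d. s (M j i) * t i) \<in> W" by metis
  from homogeneous_system[of "{..<d}" "{..<k}" "\<lambda>i j. M j i"] \<open>\<not> k \<le> d\<close>
  obtain c where c: "\<exists>j\<in>{..<k}. c j \<noteq> 0" "\<And>i. i < d \<Longrightarrow> (\<Sum>j<k. M j i * c j) = 0" by auto
  have "(\<Sum>j<k. s (c j) * (u j - (\<Sum>i<d. s (M j i) * t i))) \<in> W"
    using W M by (intro vs.subspace_sum) (auto intro: vs.subspace_scale)
  also have "(\<Sum>j<k. s (c j) * (u j - (\<Sum>i<d. s (M j i) * t i))) =
      (\<Sum>j<k. s (c j) * u j) - (\<Sum>j<k. \<Sum>i<d. s (M j i * c j) * t i)"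
    by (simp add: right_diff_distrib sum_subtractf sum_distrib_left s_mult ac_simps)
  also have "(\<Sum>j<k. \<Sum>i<d. s (M j i * c j) * t i) = (\<Sum>i<d. \<Sum>j<k. s (M j i * c j) * t i)"
    by (rule sum.swap)
  also have "\<dots> = (\<Sum>i<d. s (\<Sum>j<k. M j i * c j) * t i)"
  proof -
    have "s (\<Sum>j\<in>A. f j) = (\<Sum>j\<in>A. s (f j))" for f and A :: "nat set"
      by (induction A rule: infinite_finite_induct) (auto simp: s_add)
    then show ?thesis by (simp add: sum_distrib_right)
  qed
  also have "\<dots> = 0" using c by simp
  finally show False using ind c by (auto simp: indep_mod_def)
qed

text \<open>The induction corrects one value at a time: a functional that vanishes on
  \<open>W\<close> and on the earlier vectors and is 1 on the new one changes the value there and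
  nothing else. Later this alters a functional outside the square of the maximal ideal.\<close>

lemma linfun_extend:
  assumes W: "vs.subspace W" and f: "linfun f" and ind: "indep_mod W k u"
  shows "\<exists>g. linfun g \<and> (\<forall>w\<in>W. g w = f w) \<and> (\<forall>j<k. g (u j) = v j)"
  using ind
proof (induction k)
  case 0
  then show ?case using f by auto
next
  case (Suc k)
  have "indep_mod W k u" unfolding indep_mod_def
  proof (intro allI impI)
    fix c j assume c: "(\<Sum>j<k. s (c j) * u j) \<in> W" "j < k"
    have "(\<Sum>j<Suc k. s ((c(k := 0)) j) * u j) \<in> W" using c by simp
    with Suc.prems have "\<forall>j<Suc k. (c(k := 0)) j = 0" unfolding indep_mod_def by blast
    with c show "c j = 0" by (metis fun_upd_other less_Suc_eq order_less_irrefl)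
  qed
  from Suc.IH[OF this] obtain g where g: "linfun g" "\<forall>w\<in>W. g w = f w" "\<forall>j<k. g (u j) = v j" by blast
  define W' where "W' = {x + y | x y. x \<in> W \<and> y \<in> vs.span (u ` {..<k})}"
  have W': "vs.subspace W'" unfolding W'_def by (intro vs.subspace_sums W vs.subspace_span)
  have "u k \<notin> W'"
  proof
    assume "u k \<in> W'"
    then obtain x y where xy: "u k = x + y" "x \<in> W" "y \<in> vs.span (u ` {..<k})" by (auto simp: W'_def)
    have "\<exists>c. y = (\<Sum>j<k. s (c j) * u j)" using xy(3)
    proof (induction rule: vs.span_induct_alt)
      case base
      then show ?case by (intro exI[of _ "\<lambda>_. 0"]) simp
    next
      case (step a b y)
      then obtain c i where ci: "y = (\<Sum>j<k. s (c j) * u j)" "i < k" "b = u i" by auto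
      have "s a * b + y = (\<Sum>j<k. s ((if j = i then a else 0) + c j) * u j)"
      proof -
        have "(\<Sum>j<k. s (if j = i then a else 0) * u j) = (\<Sum>j<k. if j = i then s a * u i else 0)"
          by (intro sum.cong) auto
        also have "\<dots> = s a * b" using ci by simp
        finally show ?thesis by (simp add: s_add distrib_right sum.distrib ci(1))
      qed
      then show ?case by (rule exI[of _ "\<lambda>j. (if j = i then a else 0) + c j"])
    qed
    then obtain c where c: "y = (\<Sum>j<k. s (c j) * u j)" by blast
    define c' where "c' = (\<lambda>j. if j = k then 1 else - c j)"
    have "(\<Sum>j<Suc k. s (c' j) * u j) = x"
      using xy(1) c by (simp add: c'_def s_minus sum_negf)
    with xy(2) Suc.prems have "c' k = 0" unfolding indep_mod_def by (metis lessI)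
    then show False by (simp add: c'_def)
  qed
  from linfun_separate[OF W' this] obtain h where h: "linfun h" "\<forall>w\<in>W'. h w = 0" "h (u k) = 1" by blast
  have "w \<in> W'" if "w \<in> W" for w
    unfolding W'_def using that vs.span_zero by (intro CollectI exI[of _ w] exI[of _ 0]) auto
  then have hW: "h w = 0" if "w \<in> W" for w using h that by auto
  have "u j \<in> W'" if "j < k" for j
    unfolding W'_def using that W vs.subspace_0
    by (intro CollectI exI[of _ 0] exI[of _ "u j"]) (auto intro: vs.span_base)
  then have hu: "h (u j) = 0" if "j < k" for j using h that by auto
  let ?g = "\<lambda>x. g x + (v k - g (u k)) * h x"
  have "linfun ?g" using g(1) h(1) by (simp add: linfun_def algebra_simps)
  moreover have "\<forall>j<Suc k. ?g (u j) = v j" using g hu h by (auto simp: less_Suc_eq)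
  ultimately show ?case using g hW by (intro exI[of _ ?g]) auto
qed

text \<open>Induction in the manner of Gram-Schmidt: the new vector is made orthogonal to the old
  functionals, then the old vectors are made orthogonal to the new functional.\<close>

lemma dual_vectors:
  fixes n :: nat
  assumes U: "vs.subspace U" and f: "\<And>j. j < n \<Longrightarrow> linfun (f j)"
    and ind: "\<And>c. (\<And>z. z \<in> U \<Longrightarrow> (\<Sum>j<n. c j * f j z) = 0) \<Longrightarrow> \<forall>j<n. c j = 0"
  shows "\<exists>z. \<forall>i<n. z i \<in> U \<and> (\<forall>j<n. f j (z i) = (if i = j then 1 else 0))"
  using f ind
proof (induction n)
  case (Suc n)
  have "\<forall>j<n. c j = 0" if c: "\<And>z. z \<in> U \<Longrightarrow> (\<Sum>j<n. c j * f j z) = 0" for c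
  proof -
    have "\<forall>j<Suc n. (c(n := 0)) j = 0" using c by (intro Suc.prems(2)) simp
    then show ?thesis by (metis fun_upd_other less_Suc_eq order_less_irrefl)
  qed
  then have "\<exists>z. \<forall>i<n. z i \<in> U \<and> (\<forall>j<n. f j (z i) = (if i = j then 1 else 0))"
    using Suc.prems(1) by (intro Suc.IH) auto
  then obtain z where "\<forall>i<n. z i \<in> U \<and> (\<forall>j<n. f j (z i) = (if i = j then 1 else 0))" by blast
  then have z: "\<And>i. i < n \<Longrightarrow> z i \<in> U"
    "\<And>i j. i < n \<Longrightarrow> j < n \<Longrightarrow> f j (z i) = (if i = j then 1 else 0)" by auto
  have lf: "linfun (f j)" if "j \<le> n" for j using Suc.prems(1) that by simp
  \<comment> \<open>\<open>g\<close> is \<open>f n\<close> minus the combination of the earlier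
    functionals with the same values at the \<open>z i\<close>. If it vanished on \<open>U\<close>,
    this would be a relation with coefficient 1 at \<open>f n\<close>.\<close>
  define g where "g = (\<lambda>x. f n x - (\<Sum>i<n. f n (z i) * f i x))"
  have "\<exists>x\<in>U. g x \<noteq> 0"
  proof (rule ccontr)
    assume "\<not> ?thesis"
    then have 0: "g x = 0" if "x \<in> U" for x using that by auto
    define c where "c = (\<lambda>j. if j = n then 1 else - f n (z j))"
    have "\<forall>j<Suc n. c j = 0"
      by (rule Suc.prems(2)) (use 0 in \<open>simp add: c_def g_def sum_negf\<close>)
    then have "c n = 0" by simp
    then show False by (simp add: c_def)
  qed
  then obtain x where x: "x \<in> U" "g x \<noteq> 0" by auto
  define y where "y = s (1 / g x) * (x - (\<Sum>i<n. s (f i x) * z i))"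
  have yU: "y \<in> U" unfolding y_def using x z U
    by (auto intro!: vs.subspace_scale vs.subspace_diff vs.subspace_sum)
  have fy: "f j y = 0" if "j < n" for j
  proof -
    have "(\<Sum>i<n. f i x * f j (z i)) = (\<Sum>i<n. if i = j then f j x else 0)"
      using z that by (intro sum.cong) auto
    then show ?thesis using that lf[of j] by (simp add: y_def linfun_simps)
  qed
  have fny: "f n y = 1"
  proof -
    have "f n (x - (\<Sum>i<n. s (f i x) * z i)) = g x"
      using lf[of n] by (simp add: linfun_simps g_def) (simp add: mult.commute)
    then show ?thesis using x lf[of n] by (simp add: y_def linfun_simps)
  qed
  define z' where "z' = (\<lambda>i. if i = n then y else z i - s (f n (z i)) * y)"
  have "z' i \<in> U \<and> (\<forall>j<Suc n. f j (z' i) = (if i = j then 1 else 0))" if "i < Suc n" for i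
  proof (cases "i = n")
    case True
    then show ?thesis using yU fy fny by (auto simp: z'_def less_Suc_eq)
  next
    case False
    with that have i: "i < n" by simp
    then have "z' i \<in> U" using z yU U by (auto simp: z'_def intro!: vs.subspace_scale vs.subspace_diff)
    moreover have "f j (z' i) = (if i = j then 1 else 0)" if "j < Suc n" for j
      using i that lf[of j] z fy[of j] fny by (cases "j = n") (auto simp: z'_def linfun_simps)
    ultimately show ?thesis by auto
  qed
  then show ?case by blast
qed simp

text \<open>The \<open>f k\<close> act as coordinates on \<open>U\<close> modulo \<open>W\<close>.
  Duality with the \<open>u j\<close> gives independence; an element minus the combination formed
  with its coordinates has all coordinates zero and therefore lies in \<open>W\<close>.\<close>

lemma reldimI:
  fixes d :: nat
  assumes "\<And>k. k < d \<Longrightarrow> u k \<in> U" "\<And>k. k < d \<Longrightarrow> linfun (f k)"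
    and "\<And>j k. j < d \<Longrightarrow> k < d \<Longrightarrow> f k (u j) = (if j = k then 1 else 0)"
    and "\<And>x k. x \<in> W \<Longrightarrow> k < d \<Longrightarrow> f k x = 0"
    and "\<And>x. x \<in> U \<Longrightarrow> (\<And>k. k < d \<Longrightarrow> f k x = 0) \<Longrightarrow> x \<in> W" and "vs.subspace U"
  shows "reldim d U W"
proof -
  have fs: "f k (\<Sum>j<d. s (c j) * u j) = c k" if "k < d" for c k
  proof -
    have "(\<Sum>j<d. c j * f k (u j)) = (\<Sum>j<d. if j = k then c k else 0)"
      using assms(3) that by (intro sum.cong) auto
    then show ?thesis using assms(2)[OF that] that by (simp add: linfun_simps)
  qed
  have "spans_mod W d u U" unfolding spans_mod_def
  proof
    fix x assume "x \<in> U"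
    have "x - (\<Sum>j<d. s (f j x) * u j) \<in> W"
      by (rule assms(5)) (use \<open>x \<in> U\<close> assms(1,2,6) fs in
        \<open>auto intro!: vs.subspace_diff vs.subspace_scale vs.subspace_sum simp: linfun_diff\<close>)
    then show "\<exists>c. x - (\<Sum>j<d. s (c j) * u j) \<in> W" by (rule exI[of _ "\<lambda>j. f j x"])
  qed
  moreover have "indep_mod W d u" unfolding indep_mod_def
  proof (intro allI impI)
    fix c j assume "(\<Sum>j<d. s (c j) * u j) \<in> W" "j < d"
    then show "c j = 0" using assms(4)[of _ j] fs[of j c] by simp
  qed
  ultimately show ?thesis using assms(1) by (auto simp: reldim_def)
qed

end

section \<open>Algebras presented by a commutative ring\<close>

text \<open>A surjective algebra homomorphism from a ring type onto a record \<open>A\<close>. No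
  ring axioms are assumed for \<open>A\<close>; they are transported along \<open>e\<close>, and
  \<open>A\<close> is then studied through the ring type modulo \<open>ker\<close>.\<close>

locale presentation = scalar_hom s
  for s :: "'k::field \<Rightarrow> 'r::comm_ring_1" +
  fixes A :: "('k, 'a) module" and e :: "'r \<Rightarrow> 'a"
  assumes e_surj: "carrier A = range e"
    and e_add: "e (x + y) = e x \<oplus>\<^bsub>A\<^esub> e y"
    and e_mult: "e (x * y) = e x \<otimes>\<^bsub>A\<^esub> e y"
    and e_1: "e 1 = \<one>\<^bsub>A\<^esub>"
    and e_0: "e 0 = \<zero>\<^bsub>A\<^esub>"
    and e_scale: "e (s c * x) = c \<odot>\<^bsub>A\<^esub> e x"
begin

lemma e_carrier [simp]: "e x \<in> carrier A" by (simp add: e_surj)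

lemma cring_A: "cring A"
proof (rule cringI)
  show "abelian_group A"
  proof (rule abelian_groupI)
    fix a assume "a \<in> carrier A"
    then obtain x where "a = e x" by (auto simp: e_surj)
    then show "\<exists>b\<in>carrier A. b \<oplus>\<^bsub>A\<^esub> a = \<zero>\<^bsub>A\<^esub>"
      by (intro bexI[of _ "e (- x)"]) (simp_all flip: e_add e_0)
  qed (auto simp: e_surj simp flip: e_add e_0 simp: ac_simps)
  show "comm_monoid A"
    by (rule comm_monoidI) (auto simp: e_surj simp flip: e_mult e_1 simp: ac_simps)
qed (auto simp: e_surj simp flip: e_add e_mult simp: distrib_right)

sublocale A: cring A by (rule cring_A)

definition ker :: "'r set" where "ker = {x. e x = \<zero>\<^bsub>A\<^esub>}"

lemma e_minus: "e (- x) = \<ominus>\<^bsub>A\<^esub> e x"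
  by (rule A.minus_equality[symmetric]) (simp_all flip: e_add e_0)

lemma e_eq_iff: "e x = e y \<longleftrightarrow> x - y \<in> ker"
proof -
  have "e (x - y) = e x \<ominus>\<^bsub>A\<^esub> e y" using e_add[of x "- y"] by (simp add: e_minus a_minus_def)
  then show ?thesis by (simp add: ker_def A.r_right_minus_eq)
qed

lemma ker_subspace: "vs.subspace ker"
  unfolding vs.subspace_def
  by (auto simp: ker_def e_add e_0 e_mult)

lemma ker_times: "x \<in> ker \<Longrightarrow> y * x \<in> ker"
  by (simp add: ker_def e_mult)

lemma ker_times': "x \<in> ker \<Longrightarrow> x * y \<in> ker"
  by (simp add: ker_def e_mult)

lemma line_extension_eq:
  "A.line_extension (scalars A) (e v) E = {e (s c * v) \<oplus>\<^bsub>A\<^esub> b | c b. b \<in> E}"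
proof -
  have 1: "scalars A = range (\<lambda>c. e (s c))"
    using e_scale[of _ 1] by (auto simp: scalars_def e_1)
  show ?thesis
    unfolding A.line_extension_def r_coset_def set_add_def set_mult_def 1
    by (auto simp: e_mult)
qed

lemma preimage_line_extension:
  assumes "E \<subseteq> carrier A"
  shows "e x \<in> A.line_extension (scalars A) (e w) E \<longleftrightarrow> (\<exists>c. e (x - s c * w) \<in> E)"
proof
  assume "e x \<in> A.line_extension (scalars A) (e w) E"
  then obtain c b where cb: "e x = e (s c * w) \<oplus>\<^bsub>A\<^esub> b" "b \<in> E" by (auto simp: line_extension_eq)
  then obtain y where y: "b = e y" using assms by (auto simp: e_surj)
  with cb have "e x = e (s c * w + y)" by (simp add: e_add)
  then have "e (x - s c * w) = e y" by (simp add: e_eq_iff algebra_simps)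
  with y cb show "\<exists>c. e (x - s c * w) \<in> E" by (intro exI[of _ c]) simp
next
  assume "\<exists>c. e (x - s c * w) \<in> E"
  then obtain c where c: "e (x - s c * w) \<in> E" by auto
  have "e x = e (s c * w) \<oplus>\<^bsub>A\<^esub> e (x - s c * w)" by (simp flip: e_add)
  with c show "e x \<in> A.line_extension (scalars A) (e w) E" by (auto simp: line_extension_eq)
qed

text \<open>The inductive predicate \<open>ring.dimension\<close> adjoins one line at a time. A
  preimage of each new generator extends a spanning family that is independent modulo
  \<open>ker\<close>; independence survives because the generator lies outside the previous
  space.\<close>

lemma dimension_imp:
  assumes "A.dimension d (scalars A) E"
  shows "vs.subspace {x. e x \<in> E} \<and> E \<subseteq> carrier A \<and> reldim d {x. e x \<in> E} ker"
  using assms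
proof (induction d "scalars A" E rule: A.dimension.induct)
  case zero_dim
  have "{x. e x \<in> {\<zero>\<^bsub>A\<^esub>}} = ker" by (auto simp: ker_def)
  then show ?case using ker_subspace by (auto simp: reldim_def spans_mod_def indep_mod_def)
next
  case (Suc_dim v E n)
  obtain w where w: "v = e w" using Suc_dim(1) by (auto simp: e_surj)
  define E' where "E' = A.line_extension (scalars A) v E"
  have E: "vs.subspace {x. e x \<in> E}" "E \<subseteq> carrier A" using Suc_dim by auto
  have E': "e x \<in> E' \<longleftrightarrow> (\<exists>c. e (x - s c * w) \<in> E)" for x
    unfolding E'_def w by (rule preimage_line_extension[OF E(2)])
  obtain u where u: "\<And>j. j < n \<Longrightarrow> e (u j) \<in> E" "spans_mod ker n u {x. e x \<in> E}" "indep_mod ker n u"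
    using Suc_dim by (auto simp: reldim_def)
  have sub: "vs.subspace {x. e x \<in> E'}" unfolding vs.subspace_def
  proof (intro conjI ballI allI)
    show "0 \<in> {x. e x \<in> E'}" using vs.subspace_0[OF E(1)] by (auto simp: E' intro: exI[of _ 0])
  next
    fix x y assume "x \<in> {x. e x \<in> E'}" "y \<in> {x. e x \<in> E'}"
    then obtain a b where "e (x - s a * w) \<in> E" "e (y - s b * w) \<in> E" by (auto simp: E')
    with vs.subspace_add[OF E(1), of "x - s a * w" "y - s b * w"] have "e (x + y - s (a + b) * w) \<in> E"
      by (simp add: s_add algebra_simps)
    then show "x + y \<in> {x. e x \<in> E'}" by (auto simp: E')
  next
    fix c x assume "x \<in> {x. e x \<in> E'}"
    then obtain a where "e (x - s a * w) \<in> E" by (auto simp: E')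
    with vs.subspace_scale[OF E(1), of "x - s a * w" c] have "e (s c * x - s (c * a) * w) \<in> E"
      by (simp add: s_mult algebra_simps)
    then show "s c * x \<in> {x. e x \<in> E'}" by (auto simp: E')
  qed
  let ?u = "u(n := w)"
  have sum: "(\<Sum>j<Suc n. s (c j) * ?u j) = (\<Sum>j<n. s (c j) * u j) + s (c n) * w" for c
    by simp
  have car: "E' \<subseteq> carrier A" unfolding E'_def w line_extension_eq using E(2) by auto
  have mem: "e (?u j) \<in> E'" if "j < Suc n" for j
  proof (cases "j = n")
    case True
    then show ?thesis using vs.subspace_0[OF E(1)] by (auto simp: E' intro: exI[of _ 1])
  next
    case False
    then show ?thesis using u(1)[of j] that by (auto simp: E' intro: exI[of _ 0])
  qed
  have sp: "spans_mod ker (Suc n) ?u {x. e x \<in> E'}" unfolding spans_mod_def sum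
  proof
    fix x assume "x \<in> {x. e x \<in> E'}"
    then obtain a where "e (x - s a * w) \<in> E" by (auto simp: E')
    then obtain c where "x - s a * w - (\<Sum>j<n. s (c j) * u j) \<in> ker"
      using u(2) by (auto simp: spans_mod_def)
    then show "\<exists>c. x - ((\<Sum>j<n. s (c j) * u j) + s (c n) * w) \<in> ker"
      by (intro exI[of _ "c(n := a)"]) (simp add: algebra_simps)
  qed
  have ind: "indep_mod ker (Suc n) ?u" unfolding indep_mod_def sum
  proof (intro allI impI)
    fix c j assume k: "(\<Sum>j<n. s (c j) * u j) + s (c n) * w \<in> ker" and j: "j < Suc n"
    have S: "(\<Sum>j<n. s (a j) * u j) \<in> {x. e x \<in> E}" for a
      using u(1) by (intro vs.subspace_sum[OF E(1)] vs.subspace_scale[OF E(1)]) auto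
    have cn: "c n = 0"
    proof (rule ccontr)
      assume nz: "c n \<noteq> 0"
      have "s (inverse (c n)) * ((\<Sum>j<n. s (c j) * u j) + s (c n) * w) \<in> ker"
        using k by (rule ker_times)
      also have "s (inverse (c n)) * ((\<Sum>j<n. s (c j) * u j) + s (c n) * w) =
          w - (- (s (inverse (c n)) * (\<Sum>j<n. s (c j) * u j)))"
        using nz by (simp add: distrib_left mult.assoc[symmetric] flip: s_mult)
      finally have "e w = e (- (s (inverse (c n)) * (\<Sum>j<n. s (c j) * u j)))" by (simp only: e_eq_iff)
      moreover have "e (- (s (inverse (c n)) * (\<Sum>j<n. s (c j) * u j))) \<in> E"
        using vs.subspace_neg[OF E(1) vs.subspace_scale[OF E(1) S[of c]]] by simp
      ultimately show False using Suc_dim(2) w by simp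
    qed
    with k u(3) have "\<forall>j<n. c j = 0" by (simp add: indep_mod_def)
    with cn j show "c j = 0" by (auto simp: less_Suc_eq)
  qed
  show ?case using sub car mem sp ind unfolding E'_def[symmetric] reldim_def by blast
qed

lemma dimension_span:
  assumes "indep_mod ker d u"
  shows "A.dimension d (scalars A) {e (\<Sum>j<d. s (c j) * u j) | c. True}"
  using assms
proof (induction d)
  case 0
  have "A.dimension 0 (scalars A) {\<zero>\<^bsub>A\<^esub>}" by (rule A.zero_dim)
  then show ?case by (simp add: e_0)
next
  case (Suc d)
  let ?E = "{e (\<Sum>j<d. s (c j) * u j) | c. True}"
  have "indep_mod ker d u" unfolding indep_mod_def
  proof (intro allI impI)
    fix c j assume c: "(\<Sum>j<d. s (c j) * u j) \<in> ker" "j < d"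
    have "(\<Sum>j<Suc d. s ((c(d := 0)) j) * u j) \<in> ker" using c by simp
    with Suc.prems have "\<forall>j<Suc d. (c(d := 0)) j = 0" unfolding indep_mod_def by blast
    with c show "c j = 0" by (metis fun_upd_other less_Suc_eq order_less_irrefl)
  qed
  then have dim: "A.dimension d (scalars A) ?E" by (rule Suc.IH)
  have "e (u d) \<notin> ?E"
  proof
    assume "e (u d) \<in> ?E"
    then obtain c where "e (u d) = e (\<Sum>j<d. s (c j) * u j)" by auto
    then have "u d - (\<Sum>j<d. s (c j) * u j) \<in> ker" by (simp add: e_eq_iff)
    then have "(\<Sum>j<Suc d. s (if j = d then 1 else - c j) * u j) \<in> ker"
      by (simp add: s_minus sum_negf)
    with Suc.prems[unfolded indep_mod_def, THEN spec, of "\<lambda>j. if j = d then 1 else - c j"]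
    show False by auto
  qed
  with dim have "A.dimension (Suc d) (scalars A) (A.line_extension (scalars A) (e (u d)) ?E)"
    by (intro A.Suc_dim) auto
  also have "A.line_extension (scalars A) (e (u d)) ?E = {e (\<Sum>j<Suc d. s (c j) * u j) | c. True}"
  proof (intro subset_antisym subsetI)
    fix y assume "y \<in> A.line_extension (scalars A) (e (u d)) ?E"
    then obtain a c where "y = e (s a * u d) \<oplus>\<^bsub>A\<^esub> e (\<Sum>j<d. s (c j) * u j)"
      by (auto simp: line_extension_eq)
    then have "y = e (\<Sum>j<Suc d. s ((c(d := a)) j) * u j)" by (simp add: add.commute flip: e_add)
    then show "y \<in> {e (\<Sum>j<Suc d. s (c j) * u j) | c. True}" by blast
  next
    fix y assume "y \<in> {e (\<Sum>j<Suc d. s (c j) * u j) | c. True}"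
    then obtain c where "y = e (\<Sum>j<Suc d. s (c j) * u j)" by blast
    then have "y = e (s (c d) * u d) \<oplus>\<^bsub>A\<^esub> e (\<Sum>j<d. s (c j) * u j)"
      by (simp add: add.commute flip: e_add)
    then show "y \<in> A.line_extension (scalars A) (e (u d)) ?E" unfolding line_extension_eq by blast
  qed
  finally show ?case .
qed

text \<open>Bridge from dimensions in the record to representatives in the ring type. The condition
  \<open>ker \<subseteq> U\<close> makes \<open>U\<close> the full preimage of its image.\<close>

lemma dimension_iff:
  assumes U: "vs.subspace U" "ker \<subseteq> U"
  shows "A.dimension d (scalars A) (e ` U) \<longleftrightarrow> reldim d U ker"
proof
  have pre: "{x. e x \<in> e ` U} = U"
  proof (intro subset_antisym subsetI)
    fix x assume "x \<in> {x. e x \<in> e ` U}"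
    then obtain y where "y \<in> U" "x - y \<in> ker" by (auto simp: e_eq_iff)
    with U vs.subspace_add[OF U(1), of y "x - y"] show "x \<in> U" by auto
  qed auto
  show "reldim d U ker" if "A.dimension d (scalars A) (e ` U)"
    using dimension_imp[OF that] by (simp add: pre)
  assume "reldim d U ker"
  then obtain u where u: "\<And>j. j < d \<Longrightarrow> u j \<in> U" "spans_mod ker d u U" "indep_mod ker d u"
    by (auto simp: reldim_def)
  have "e ` U = {e (\<Sum>j<d. s (c j) * u j) | c. True}"
  proof (intro subset_antisym subsetI)
    fix y assume "y \<in> e ` U"
    then obtain x c where "y = e x" "x - (\<Sum>j<d. s (c j) * u j) \<in> ker"
      using u(2) by (auto simp: spans_mod_def)
    then show "y \<in> {e (\<Sum>j<d. s (c j) * u j) | c. True}" by (auto simp flip: e_eq_iff)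
  next
    fix y assume "y \<in> {e (\<Sum>j<d. s (c j) * u j) | c. True}"
    then obtain c where "y = e (\<Sum>j<d. s (c j) * u j)" by auto
    moreover have "(\<Sum>j<d. s (c j) * u j) \<in> U"
      using u(1) by (intro vs.subspace_sum[OF U(1)] vs.subspace_scale[OF U(1)]) auto
    ultimately show "y \<in> e ` U" by auto
  qed
  with dimension_span[OF u(3)] show "A.dimension d (scalars A) (e ` U)" by simp
qed

lemma ideal_preimage:
  assumes "ideal J A"
  shows "vs.subspace {x. e x \<in> J}" "\<And>x y. e x \<in> J \<Longrightarrow> e (x * y) \<in> J" "ker \<subseteq> {x. e x \<in> J}"
proof -
  interpret J: ideal J A by fact
  show 1: "e (x * y) \<in> J" if "e x \<in> J" for x y using that by (simp add: e_mult J.I_r_closed)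
  show "vs.subspace {x. e x \<in> J}" unfolding vs.subspace_def
    by (auto simp: e_0 e_add e_mult J.I_l_closed)
  show "ker \<subseteq> {x. e x \<in> J}" by (auto simp: ker_def)
qed

lemma ideal_image:
  assumes "vs.subspace U" "\<And>x y. x \<in> U \<Longrightarrow> x * y \<in> U"
  shows "ideal (e ` U) A"
proof (rule idealI)
  show "subgroup (e ` U) (add_monoid A)"
  proof (rule A.add.subgroupI, goal_cases)
    case 3
    then show ?case using vs.subspace_neg[OF assms(1)]
      by (auto simp flip: a_inv_def e_minus)
  next
    case (4 a b)
    then show ?case using vs.subspace_add[OF assms(1)] by (auto simp flip: e_add)
  qed (use vs.subspace_0[OF assms(1)] in auto)
next
  fix a x assume "a \<in> e ` U" "x \<in> carrier A"
  then obtain y z where *: "a = e y" "y \<in> U" "x = e z" by (auto simp: e_surj)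
  with assms(2)[of y z] show "x \<otimes>\<^bsub>A\<^esub> a \<in> e ` U" "a \<otimes>\<^bsub>A\<^esub> x \<in> e ` U"
    by (auto simp flip: e_mult simp: mult.commute)
qed (rule A.ring_axioms)

lemma presentation_quot:
  assumes "ideal J A"
  shows "presentation s (quot_alg A J) (\<lambda>x. J +>\<^bsub>A\<^esub> e x)"
proof -
  interpret J: ideal J A by fact
  have sm: "c \<odot>\<^bsub>A\<^esub> (a \<oplus>\<^bsub>A\<^esub> b) = c \<odot>\<^bsub>A\<^esub> a \<oplus>\<^bsub>A\<^esub> c \<odot>\<^bsub>A\<^esub> b"
    "c \<odot>\<^bsub>A\<^esub> a = e (s c) \<otimes>\<^bsub>A\<^esub> a"
    if "a \<in> carrier A" "b \<in> carrier A" for c a b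
    using that by (auto simp: e_surj distrib_left simp flip: e_scale e_add e_mult)
  \<comment> \<open>The scalar multiple in \<open>quot_alg\<close> is a union over all
    representatives of a coset; it is a single coset because every representative yields the same
    one.\<close>
  have sc: "(\<Union>x\<in>J +>\<^bsub>A\<^esub> e y. J +>\<^bsub>A\<^esub> (c \<odot>\<^bsub>A\<^esub> x)) = J +>\<^bsub>A\<^esub> (c \<odot>\<^bsub>A\<^esub> e y)" for c y
  proof -
    have "J +>\<^bsub>A\<^esub> (c \<odot>\<^bsub>A\<^esub> x) = J +>\<^bsub>A\<^esub> (c \<odot>\<^bsub>A\<^esub> e y)" if "x \<in> J +>\<^bsub>A\<^esub> e y" for x
    proof -
      from that obtain j where j: "j \<in> J" "x = j \<oplus>\<^bsub>A\<^esub> e y" by (auto simp: a_r_coset_def r_coset_def)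
      have jc: "j \<in> carrier A" using j by (auto intro: J.a_Hcarr)
      have "c \<odot>\<^bsub>A\<^esub> x = c \<odot>\<^bsub>A\<^esub> j \<oplus>\<^bsub>A\<^esub> c \<odot>\<^bsub>A\<^esub> e y" using j jc by (simp add: sm(1))
      moreover have "c \<odot>\<^bsub>A\<^esub> j \<in> J" using j jc by (simp add: sm(2)[OF jc jc] J.I_l_closed)
      ultimately have "c \<odot>\<^bsub>A\<^esub> x \<in> J +>\<^bsub>A\<^esub> (c \<odot>\<^bsub>A\<^esub> e y)"
        by (auto simp: a_r_coset_def r_coset_def)
      then show ?thesis
        using J.a_repr_independence'[of "c \<odot>\<^bsub>A\<^esub> x" "c \<odot>\<^bsub>A\<^esub> e y"] by (simp flip: e_scale)
    qed
    moreover have "e y \<in> J +>\<^bsub>A\<^esub> e y" using J.a_rcos_self by simp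
    ultimately show ?thesis by blast
  qed
  show ?thesis
  proof
    show "carrier (quot_alg A J) = range (\<lambda>x. J +>\<^bsub>A\<^esub> e x)"
      by (auto simp: quot_alg_def ring.extend_def module.fields_def FactRing_def A_RCOSETS_def'
        e_surj)
    show "J +>\<^bsub>A\<^esub> e (x + y) = (J +>\<^bsub>A\<^esub> e x) \<oplus>\<^bsub>quot_alg A J\<^esub> (J +>\<^bsub>A\<^esub> e y)" for x y
      by (simp add: quot_alg_def ring.extend_def module.fields_def FactRing_def e_add J.a_rcos_sum)
    show "J +>\<^bsub>A\<^esub> e (x * y) = (J +>\<^bsub>A\<^esub> e x) \<otimes>\<^bsub>quot_alg A J\<^esub> (J +>\<^bsub>A\<^esub> e y)" for x y
      by (simp add: quot_alg_def ring.extend_def module.fields_def FactRing_def e_mult J.rcoset_mult_add)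
    show "J +>\<^bsub>A\<^esub> e 1 = \<one>\<^bsub>quot_alg A J\<^esub>"
      by (simp add: quot_alg_def ring.extend_def module.fields_def FactRing_def e_1)
    show "J +>\<^bsub>A\<^esub> e 0 = \<zero>\<^bsub>quot_alg A J\<^esub>"
      by (simp add: quot_alg_def ring.extend_def module.fields_def FactRing_def e_0 J.a_rcos_const)
    show "J +>\<^bsub>A\<^esub> e (s c * x) = c \<odot>\<^bsub>quot_alg A J\<^esub> (J +>\<^bsub>A\<^esub> e x)" for c x
      by (simp add: quot_alg_def ring.extend_def module.fields_def e_scale sc)
  qed
qed

lemma ker_quot:
  assumes "ideal J A"
  shows "presentation.ker (quot_alg A J) (\<lambda>x. J +>\<^bsub>A\<^esub> e x) = {x. e x \<in> J}"
proof -
  interpret J: ideal J A by fact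
  interpret q: presentation s "quot_alg A J" "\<lambda>x. J +>\<^bsub>A\<^esub> e x" by (rule presentation_quot[OF assms])
  have "J +>\<^bsub>A\<^esub> e x = J \<longleftrightarrow> e x \<in> J" for x
    using J.a_rcos_self[of "e x"] J.a_rcos_const[of "e x"] by auto
  then show ?thesis
    by (simp add: q.ker_def) (simp add: quot_alg_def ring.extend_def module.fields_def FactRing_def)
qed

end

text \<open>Both algebras are quotients of one ring by one ideal, so sending \<open>e x\<close> to
  \<open>f x\<close> is well defined and bijective.\<close>

lemma presentation_iso:
  assumes "presentation s A e" "presentation s B f"
    and ker: "presentation.ker A e = presentation.ker B f"
  shows "alg_iso A B"
proof -
  interpret A: presentation s A e by fact
  interpret B: presentation s B f by fact
  have eq: "e x = e y \<longleftrightarrow> f x = f y" for x y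
    using ker by (simp add: A.e_eq_iff B.e_eq_iff)
  define h where "h = (\<lambda>a. f (SOME x. e x = a))"
  have h: "h (e x) = f x" for x
    unfolding h_def by (metis (mono_tags, lifting) eq someI)
  have "h \<in> ring_iso A B"
  proof (rule ring_iso_memI)
    show "bij_betw h (carrier A) (carrier B)"
      by (auto simp: A.e_surj B.e_surj h bij_betw_def inj_on_def eq image_image)
  qed (auto simp: A.e_surj h simp flip: A.e_add A.e_mult A.e_1 simp: B.e_add B.e_mult B.e_1)
  then show ?thesis
    unfolding alg_iso_def by (intro bexI[of _ h]) (auto simp: A.e_surj h simp flip: A.e_scale B.e_scale)
qed

section \<open>Generators adapted to the filtration by powers of the maximal ideal\<close>

text \<open>\<open>Q i\<close> models the preimage of the \<open>i\<close>-th power of the maximal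
  ideal, and \<open>Q 4\<close> the kernel of the map onto the algebra. \<open>Q_gen\<close>
  expresses that \<open>Q (Suc i)\<close> is spanned modulo \<open>Q 4\<close> by the products of
  \<open>Q 1\<close> and \<open>Q i\<close>. The other assumptions encode locality, the Hilbert
  function and the Gorenstein property.\<close>

locale gor_filtration = scalar_hom s
  for s :: "'k::{alg_closed_field, field_char_0} \<Rightarrow> 'r::comm_ring_1" +
  fixes Q :: "nat \<Rightarrow> 'r set" and m n :: nat
  assumes Q_sub: "vs.subspace (Q i)"
    and Q_antimono: "Q (Suc i) \<subseteq> Q i"
    and Q_0: "Q 0 = UNIV"
    and Q_prod: "x \<in> Q i \<Longrightarrow> y \<in> Q j \<Longrightarrow> x * y \<in> Q (i + j)"
    and Q_gen: "vs.subspace T \<Longrightarrow> (\<And>x y. x \<in> Q 1 \<Longrightarrow> y \<in> Q i \<Longrightarrow> x * y \<in> T) \<Longrightarrow> Q 4 \<subseteq> T \<Longrightarrow> Q (Suc i) \<subseteq> T"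
    and Q_local: "\<exists>c. x - s c \<in> Q 1"
    and Q_proper: "s c \<in> Q 1 \<Longrightarrow> c = 0"
    and dim_1: "reldim m (Q 1) (Q 2)"
    and dim_2: "reldim n (Q 2) (Q 3)"
    and dim_3: "reldim 1 (Q 3) (Q 4)"
    and dim_socle: "reldim 1 {x. \<forall>y\<in>Q 1. x * y \<in> Q 4} (Q 4)"
begin

lemma Q_le: "i \<le> j \<Longrightarrow> Q j \<subseteq> Q i"
  by (induction rule: dec_induct) (use Q_antimono in auto)

lemma Q_mult: "x \<in> Q i \<Longrightarrow> x * y \<in> Q i"
  using Q_prod[of x i y 0] by (simp add: Q_0)

lemma Q_mult': "x \<in> Q i \<Longrightarrow> y * x \<in> Q i"
  using Q_mult[of x i y] by (simp add: mult.commute)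

lemma Q_prod_le: "x \<in> Q i \<Longrightarrow> y \<in> Q j \<Longrightarrow> k \<le> i + j \<Longrightarrow> x * y \<in> Q k"
  using Q_prod Q_le by blast

text \<open>\<open>Q 3\<close> is contained in the preimage of the socle because \<open>Q 3\<close>
  times \<open>Q 1\<close> lies in \<open>Q 4\<close>. Both are one-dimensional modulo
  \<open>Q 4\<close>, so they coincide.\<close>

lemma socle_eq: "{x. \<forall>y\<in>Q 1. x * y \<in> Q 4} = Q 3"
proof -
  let ?S = "{x. \<forall>y\<in>Q 1. x * y \<in> Q 4}"
  have 1: "Q 3 \<subseteq> ?S" using Q_prod_le[of _ 3 _ 1 4] by auto
  obtain u where u: "u 0 \<in> ?S" "spans_mod (Q 4) 1 u ?S"
    using dim_socle by (auto simp: reldim_def)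
  obtain v where v: "v 0 \<in> Q 3" "indep_mod (Q 4) 1 v"
    using dim_3 by (auto simp: reldim_def)
  have "v 0 \<notin> Q 4" using v(2)[unfolded indep_mod_def, rule_format, of "\<lambda>_. 1" 0] by auto
  have v0: "v 0 \<in> ?S" using 1 v(1) by blast
  obtain c where c: "v 0 - s c * u 0 \<in> Q 4" using spans_modE[OF u(2) v0] by auto
  have "c \<noteq> 0" using c \<open>v 0 \<notin> Q 4\<close> by auto
  have "s c * u 0 \<in> Q 3"
    using vs.subspace_diff[OF Q_sub, of "v 0" 3 "v 0 - s c * u 0"] c v Q_le[of 3 4] by auto
  from vs.subspace_scale[OF Q_sub this, of "inverse c"] have "u 0 \<in> Q 3"
    using \<open>c \<noteq> 0\<close> by (simp add: mult.assoc[symmetric] flip: s_mult)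
  have "x \<in> Q 3" if x: "x \<in> ?S" for x
  proof -
    obtain d where d: "x - s d * u 0 \<in> Q 4" using spans_modE[OF u(2) x] by auto
    with vs.subspace_add[OF Q_sub, of "x - s d * u 0" 3 "s d * u 0"] Q_le[of 3 4]
      vs.subspace_scale[OF Q_sub \<open>u 0 \<in> Q 3\<close>, of d] show ?thesis by auto
  qed
  with 1 show ?thesis by auto
qed

lemma in_socle: "(\<And>y. y \<in> Q 1 \<Longrightarrow> x * y \<in> Q 4) \<Longrightarrow> x \<in> Q 3"
  using socle_eq by blast

text \<open>A functional on the algebra, hence zero on \<open>Q 4\<close>, that does not vanish on
  the socle. Such a functional generates the dual space of the algebra as a module;
  \<open>dual_gen_nondeg\<close> is the form in which this is used.\<close>

definition dual_gen :: "('r \<Rightarrow> 'k) \<Rightarrow> bool" where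
  "dual_gen f \<longleftrightarrow> linfun f \<and> (\<forall>x\<in>Q 4. f x = 0) \<and> (\<exists>x\<in>Q 3. f x \<noteq> 0)"

lemma dual_gen_exists: "\<exists>f. dual_gen f"
proof -
  obtain v where v: "v 0 \<in> Q 3" "indep_mod (Q 4) 1 v"
    using dim_3 by (auto simp: reldim_def)
  have "v 0 \<notin> Q 4" using v(2)[unfolded indep_mod_def, rule_format, of "\<lambda>_. 1" 0] by auto
  from linfun_separate[OF Q_sub this] v(1) show ?thesis
    unfolding dual_gen_def by (metis zero_neq_one)
qed

lemma dual_gen_top:
  assumes f: "dual_gen f" and x: "x \<in> Q 3" "f x = 0"
  shows "x \<in> Q 4"
proof -
  have lf: "linfun f" and f4: "\<And>x. x \<in> Q 4 \<Longrightarrow> f x = 0" using f by (auto simp: dual_gen_def)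
  obtain t where t: "t \<in> Q 3" "f t \<noteq> 0" using f by (auto simp: dual_gen_def)
  obtain u where u: "spans_mod (Q 4) 1 u (Q 3)" using dim_3 by (auto simp: reldim_def)
  obtain c where c: "x - s c * u 0 \<in> Q 4" using spans_modE[OF u x(1)] by auto
  obtain d where d: "t - s d * u 0 \<in> Q 4" using spans_modE[OF u t(1)] by auto
  have "f t = d * f (u 0)" "f x = c * f (u 0)"
    using f4[OF c] f4[OF d] lf by (simp_all add: linfun_simps)
  with t x have "c = 0" by auto
  with c show ?thesis by simp
qed

text \<open>Elements orthogonal to everything form an ideal. The induction runs from
  \<open>Q 3\<close> up to \<open>Q 0\<close>: the products of such an \<open>x\<close> with
  \<open>Q 1\<close> lie one level deeper and are in \<open>Q 4\<close> by induction, so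
  \<open>x\<close> lies in the socle, on which the functional is injective.\<close>

lemma dual_gen_nondeg:
  assumes f: "dual_gen f" and x: "\<And>y. f (x * y) = 0"
  shows "x \<in> Q 4"
proof -
  have "\<forall>x\<in>Q (3 - j). (\<forall>y. f (x * y) = 0) \<longrightarrow> x \<in> Q 4" if "j \<le> 3" for j
    using that
  proof (induction j)
    case 0
    then show ?case using dual_gen_top[OF f] by (metis diff_zero mult.right_neutral)
  next
    case (Suc j)
    show ?case
    proof (intro ballI impI)
      fix x assume x: "x \<in> Q (3 - Suc j)" "\<forall>y. f (x * y) = 0"
      have "x * t \<in> Q 4" if "t \<in> Q 1" for t
      proof -
        have "x * t \<in> Q (3 - j)" using Q_prod_le[OF x(1) that] Suc.prems by simp
        moreover have "\<forall>y. f (x * t * y) = 0" using x(2) by (simp add: mult.assoc)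
        ultimately show ?thesis using Suc by auto
      qed
      then have "x \<in> Q 3" by (rule in_socle)
      then show "x \<in> Q 4" using x(2) dual_gen_top[OF f] by (metis mult.right_neutral)
    qed
  qed
  from this[of 3] x show ?thesis by (simp add: Q_0)
qed

text \<open>For \<open>t\<close> in \<open>Q 1\<close> the product \<open>x * t\<close> is
  orthogonal to everything, because \<open>Q 1\<close> is an ideal; so it lies in
  \<open>Q 4\<close>.\<close>

lemma dual_gen_socle:
  assumes "dual_gen f" "\<And>y. y \<in> Q 1 \<Longrightarrow> f (x * y) = 0"
  shows "x \<in> Q 3"
proof (rule in_socle)
  fix t assume t: "t \<in> Q 1"
  show "x * t \<in> Q 4"
    by (rule dual_gen_nondeg[OF assms(1)]) (use assms(2)[OF Q_mult[OF t]] in \<open>simp add: mult.assoc\<close>)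
qed

definition N :: "'r set" where "N = {x \<in> Q 1. \<forall>w\<in>Q 2. x * w \<in> Q 4}"

lemma N_subspace: "vs.subspace N"
  using vs.subspace_0[OF Q_sub] vs.subspace_add[OF Q_sub] vs.subspace_scale[OF Q_sub]
  unfolding vs.subspace_def N_def by (auto simp: distrib_right mult.assoc)

end

text \<open>The perfect pairing of \<open>Q 1\<close> modulo \<open>N\<close> with
  \<open>Q 2\<close> modulo \<open>Q 3\<close>, written in dual bases \<open>z\<close> and
  \<open>w\<close>.\<close>

locale gor_dual_basis = gor_filtration s Q m n
  for s :: "'k::{alg_closed_field, field_char_0} \<Rightarrow> 'r::comm_ring_1" and Q m n +
  fixes f :: "'r \<Rightarrow> 'k" and w z :: "nat \<Rightarrow> 'r"
  assumes f: "dual_gen f"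
    and w_in: "\<And>j. j < n \<Longrightarrow> w j \<in> Q 2"
    and w_span: "spans_mod (Q 3) n w (Q 2)"
    and z_in: "\<And>i. i < n \<Longrightarrow> z i \<in> Q 1"
    and z_w: "\<And>i j. i < n \<Longrightarrow> j < n \<Longrightarrow> f (z i * w j) = (if i = j then 1 else 0)"
begin

lemma lf: "linfun f" and f4: "x \<in> Q 4 \<Longrightarrow> f x = 0"
  using f by (auto simp: dual_gen_def)

lemmas lfs = linfun_simps[OF lf]

lemma f_N_Q2: "x \<in> N \<Longrightarrow> y \<in> Q 2 \<Longrightarrow> f (x * y) = 0"
  by (rule f4) (auto simp: N_def)

lemma f_Q2_N: "y \<in> Q 2 \<Longrightarrow> x \<in> N \<Longrightarrow> f (y * x) = 0"
  using f_N_Q2[of x y] by (simp add: mult.commute)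

text \<open>\<open>Q 1\<close> times \<open>Q 3\<close> is in \<open>Q 4\<close>, so orthogonality
  to the \<open>w j\<close> already gives orthogonality to \<open>Q 2\<close>. Since
  \<open>Q 2\<close> is an ideal, each product of \<open>a\<close> with an element of
  \<open>Q 2\<close> is then orthogonal to everything.\<close>

lemma in_N:
  assumes a: "a \<in> Q 1" "\<And>j. j < n \<Longrightarrow> f (a * w j) = 0"
  shows "a \<in> N"
proof -
  have 0: "f (a * x) = 0" if x: "x \<in> Q 2" for x
  proof -
    obtain c where c: "x - (\<Sum>j<n. s (c j) * w j) \<in> Q 3" using spans_modE[OF w_span x] by auto
    have "f (a * (x - (\<Sum>j<n. s (c j) * w j))) = 0"
      by (rule f4, rule Q_prod_le[OF a(1) c]) simp
    moreover have "f (a * (\<Sum>j<n. s (c j) * w j)) = (\<Sum>j<n. c j * f (a * w j))"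
    proof -
      have "a * (\<Sum>j<n. s (c j) * w j) = (\<Sum>j<n. s (c j) * (a * w j))"
        by (simp add: sum_distrib_left ac_simps)
      then show ?thesis by (simp only: lfs)
    qed
    ultimately show ?thesis using a(2) by (simp add: right_diff_distrib lfs)
  qed
  have "a * x \<in> Q 4" if "x \<in> Q 2" for x
    by (rule dual_gen_nondeg[OF f]) (use 0[OF Q_mult[OF that]] in \<open>simp add: mult.assoc\<close>)
  with a(1) show ?thesis by (simp add: N_def)
qed

lemma sum_z_w: "j < n \<Longrightarrow> f ((\<Sum>i<n. s (c i) * z i) * w j) = c j"
proof -
  assume j: "j < n"
  have "(\<Sum>i<n. s (c i) * z i) * w j = (\<Sum>i<n. s (c i) * (z i * w j))"
    by (simp add: sum_distrib_right mult.assoc)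
  then have "f ((\<Sum>i<n. s (c i) * z i) * w j) = (\<Sum>i<n. c i * f (z i * w j))" by (simp only: lfs)
  also have "\<dots> = (\<Sum>i<n. if i = j then c j else 0)" using j z_w by (intro sum.cong) auto
  finally show ?thesis using j by simp
qed

lemma sum_w_z: "i < n \<Longrightarrow> f (z i * (\<Sum>j<n. s (c j) * w j)) = c i"
proof -
  assume i: "i < n"
  have "z i * (\<Sum>j<n. s (c j) * w j) = (\<Sum>j<n. s (c j) * (z i * w j))"
    by (simp add: sum_distrib_left ac_simps)
  then have "f (z i * (\<Sum>j<n. s (c j) * w j)) = (\<Sum>j<n. c j * f (z i * w j))" by (simp only: lfs)
  also have "\<dots> = (\<Sum>j<n. if j = i then c i else 0)" using i z_w by (intro sum.cong) auto
  finally show ?thesis using i by simp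
qed

lemma z_span_N:
  assumes "a \<in> Q 1"
  shows "a - (\<Sum>i<n. s (f (a * w i)) * z i) \<in> N"
proof (rule in_N)
  show "a - (\<Sum>i<n. s (f (a * w i)) * z i) \<in> Q 1"
    using assms z_in by (auto intro!: vs.subspace_diff vs.subspace_sum vs.subspace_scale Q_sub)
  show "f ((a - (\<Sum>i<n. s (f (a * w i)) * z i)) * w j) = 0" if "j < n" for j
    using sum_z_w[OF that] by (simp add: left_diff_distrib lfs)
qed

text \<open>Any functional on \<open>Q 1\<close> vanishing on \<open>N\<close> is given by multiplication with an element of \<open>Q 2\<close>;
  hence \<open>N\<^sup>\<bottom> = Q 2\<close>.\<close>

lemma N_radical:
  assumes a: "a \<in> N" "\<And>b. b \<in> N \<Longrightarrow> f (a * b) = 0"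
  shows "a \<in> Q 2"
proof -
  define v where "v = (\<Sum>i<n. s (f (a * z i)) * w i)"
  have v: "v \<in> Q 2" unfolding v_def using w_in
    by (auto intro!: vs.subspace_sum vs.subspace_scale Q_sub)
  have "f ((a - v) * b) = 0" if b: "b \<in> Q 1" for b
  proof -
    define b' where "b' = b - (\<Sum>i<n. s (f (b * w i)) * z i)"
    have b': "b' \<in> N" unfolding b'_def by (rule z_span_N[OF b])
    have "f (a * b) = f (a * b') + f (a * (\<Sum>i<n. s (f (b * w i)) * z i))"
      by (simp add: b'_def right_diff_distrib lfs)
    also have "a * (\<Sum>i<n. s (f (b * w i)) * z i) = (\<Sum>i<n. s (f (b * w i)) * (a * z i))"
      by (simp add: sum_distrib_left ac_simps)
    also have "f \<dots> = (\<Sum>i<n. f (b * w i) * f (a * z i))" by (simp only: lfs)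
    finally have 1: "f (a * b) = (\<Sum>i<n. f (b * w i) * f (a * z i))" using a(2)[OF b'] by simp
    have "v * b = (\<Sum>i<n. s (f (a * z i)) * (b * w i))"
      by (simp add: v_def sum_distrib_left sum_distrib_right ac_simps)
    then have "f (v * b) = (\<Sum>i<n. f (a * z i) * f (b * w i))" by (simp only: lfs)
    with 1 show ?thesis by (simp add: left_diff_distrib lfs) (simp add: mult.commute)
  qed
  then have "a - v \<in> Q 3" by (rule dual_gen_socle[OF f])
  then have "a - v \<in> Q 2" using Q_le[of 2 3] by auto
  from vs.subspace_add[OF Q_sub this v] show ?thesis by simp
qed

text \<open>The norm is 2 rather than 1 because the second derivative of \<open>y ^ 2\<close> is 2:
  a generator of norm 2 contributes the square of its variable with coefficient 1.\<close>

definition orthonormal :: "nat \<Rightarrow> (nat \<Rightarrow> 'r) \<Rightarrow> bool" where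
  "orthonormal k e \<longleftrightarrow> (\<forall>i<k. e i \<in> N) \<and> (\<forall>i<k. \<forall>j<k. f (e i * e j) = (if i = j then 2 else 0))"

lemma orthonormal_coeff:
  assumes "orthonormal k e" "j < k"
  shows "f ((\<Sum>i<k. s (c i) * e i) * e j) = 2 * c j"
proof -
  have "(\<Sum>i<k. s (c i) * e i) * e j = (\<Sum>i<k. s (c i) * (e i * e j))"
    by (simp add: sum_distrib_right mult.assoc)
  then have "f ((\<Sum>i<k. s (c i) * e i) * e j) = (\<Sum>i<k. c i * f (e i * e j))" by (simp only: lfs)
  also have "\<dots> = (\<Sum>i<k. if i = j then 2 * c j else 0)"
    using assms by (intro sum.cong) (auto simp: orthonormal_def)
  finally show ?thesis using assms by simp
qed

text \<open>\<open>N\<close> is orthogonal to \<open>Q 2\<close>, so pairing with \<open>e j\<close>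
  reads off coefficients modulo \<open>Q 2\<close>. The resulting bound on the length makes a
  maximal family exist.\<close>

lemma orthonormal_indep:
  assumes "orthonormal k e"
  shows "indep_mod (Q 2) k e"
  unfolding indep_mod_def
proof (intro allI impI)
  fix c j assume c: "(\<Sum>j<k. s (c j) * e j) \<in> Q 2" "j < k"
  then have "f ((\<Sum>i<k. s (c i) * e i) * e j) = 0"
    using assms by (intro f_Q2_N) (auto simp: orthonormal_def)
  with orthonormal_coeff[OF assms c(2)] show "c j = 0" by simp
qed

lemma orthonormal_bound:
  assumes "orthonormal k e"
  shows "k \<le> m"
proof -
  obtain t where t: "spans_mod (Q 2) m t (Q 1)" using dim_1 by (auto simp: reldim_def)
  from assms have "e j \<in> Q 1" if "j < k" for j using that by (auto simp: orthonormal_def N_def)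
  from steinitz_mod[OF Q_sub t this orthonormal_indep[OF assms]] show ?thesis .
qed

lemma orthonormal_exists: "\<exists>k e. orthonormal k e \<and> (\<nexists>e'. orthonormal (Suc k) e')"
proof (rule ccontr)
  assume *: "\<nexists>k e. orthonormal k e \<and> (\<nexists>e'. orthonormal (Suc k) e')"
  have "\<exists>e. orthonormal k e" for k
  proof (induction k)
    case 0
    then show ?case by (simp add: orthonormal_def)
  qed (use * in blast)
  then obtain e where "orthonormal (Suc m) e" by blast
  from orthonormal_bound[OF this] show False by simp
qed

text \<open>Let \<open>p\<close> be the projection to the orthogonal complement of the family inside
  \<open>N\<close>. Every vector of the complement has norm 0, since otherwise it could be rescaled
  and added to the family. Polarisation makes the whole form vanish on the complement, so
  \<open>p a\<close> is orthogonal to \<open>N\<close>, and \<open>N_radical\<close> places it in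
  \<open>Q 2\<close>.\<close>

lemma orthonormal_max_span:
  assumes e: "orthonormal k e" and max: "\<nexists>e'. orthonormal (Suc k) e'" and a: "a \<in> N"
  shows "a - (\<Sum>i<k. s (f (a * e i) / 2) * e i) \<in> Q 2"
proof -
  define p where "p = (\<lambda>a. a - (\<Sum>i<k. s (f (a * e i) / 2) * e i))"
  have eN: "e i \<in> N" if "i < k" for i using e that by (auto simp: orthonormal_def)
  have pN: "p b \<in> N" if "b \<in> N" for b
    unfolding p_def using that eN
    by (auto intro!: vs.subspace_diff vs.subspace_sum vs.subspace_scale N_subspace)
  have pe: "f (p b * e j) = 0" if "j < k" for b j
    using orthonormal_coeff[OF e that] by (simp add: p_def left_diff_distrib lfs)
  have iso: "f (b * b) = 0" if b: "b \<in> N" "\<And>j. j < k \<Longrightarrow> f (b * e j) = 0" for b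
  proof (rule ccontr)
    assume nz: "f (b * b) \<noteq> 0"
    \<comment> \<open>The square root exists over an algebraically closed field; it scales
      \<open>b\<close> to norm 2.\<close>
    obtain r where r: "r ^ 2 = 2 / f (b * b)" using nth_root_exists[of 2 "2 / f (b * b)"] by auto
    define e' where "e' = e(k := s r * b)"
    have "f (s r * b * (s r * b)) = r ^ 2 * f (b * b)"
    proof -
      have "s r * b * (s r * b) = s r * (s r * (b * b))" by (simp add: ac_simps)
      then show ?thesis by (simp only: lfs) (simp add: power2_eq_square)
    qed
    then have bb: "f (s r * b * (s r * b)) = 2" using r nz by simp
    have be: "f (s r * b * e j) = 0" "f (e j * (s r * b)) = 0" if "j < k" for j
    proof -
      have "e j * (s r * b) = s r * (b * e j)" by (simp add: ac_simps)
      then show "f (s r * b * e j) = 0" "f (e j * (s r * b)) = 0"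
        using b(2)[OF that] by (simp_all only: lfs mult.assoc)  simp_all
    qed
    have "orthonormal (Suc k) e'" unfolding orthonormal_def
      using e b(1) N_subspace bb be
      by (auto simp: e'_def less_Suc_eq orthonormal_def intro!: vs.subspace_scale)
    with max show False by blast
  qed
  have "f (p a * b) = 0" if b: "b \<in> N" for b
  proof -
    have 1: "f (p a * p b) = 0"
    proof -
      have 0: "f ((p a + p b) * (p a + p b)) = 0"
        by (rule iso) (auto intro!: vs.subspace_add N_subspace pN a b simp: distrib_right lfs pe)
      have *: "(p a + p b) * (p a + p b) = p a * p a + (p b * p b + (p a * p b + p a * p b))"
        by (simp add: algebra_simps)
      have "f (p a * p a) + (f (p b * p b) + (f (p a * p b) + f (p a * p b))) = 0"
        using 0 unfolding * lfs(1) .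
      then have "2 * f (p a * p b) = 0"
        using iso[OF pN[OF a] pe] iso[OF pN[OF b] pe] by (simp only: mult_2 add_0_left)
      then show ?thesis by simp
    qed
    have "p a * (\<Sum>i<k. s (f (b * e i) / 2) * e i) = (\<Sum>i<k. s (f (b * e i) / 2) * (p a * e i))"
      by (simp add: sum_distrib_left ac_simps)
    then have "f (p a * (\<Sum>i<k. s (f (b * e i) / 2) * e i)) = 0" using pe by (simp only: lfs) simp
    moreover have "p b = b - (\<Sum>i<k. s (f (b * e i) / 2) * e i)" by (simp only: p_def)
    ultimately show ?thesis using 1 by (simp add: right_diff_distrib lfs)
  qed
  from N_radical[OF pN[OF a] this] show ?thesis by (simp add: p_def)
qed

text \<open>\<open>Q 2\<close> is generated by products of two elements of \<open>Q 1\<close>, and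
  each factor may be replaced by its linear part in the \<open>Z i\<close>, because the errors lie
  in \<open>Q 3\<close>.\<close>

lemma Q2_in_span_products:
  assumes T: "vs.subspace T" "Q 3 \<subseteq> T" and Z: "spans_mod (Q 2) m Z (Q 1)" "\<And>i. i < m \<Longrightarrow> Z i \<in> Q 1"
    and ZZ: "\<And>i j. i < m \<Longrightarrow> j < m \<Longrightarrow> Z i * Z j \<in> T"
  shows "Q 2 \<subseteq> T"
proof -
  have "Q (Suc 1) \<subseteq> T"
  proof (rule Q_gen[OF T(1)])
    show "Q 4 \<subseteq> T" using T(2) Q_le[of 3 4] by auto
    fix x y assume x: "x \<in> Q 1" and y: "y \<in> Q 1"
    from Z(1) x obtain a where a: "x - (\<Sum>i<m. s (a i) * Z i) \<in> Q 2" by (rule spans_modE)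
    from Z(1) y obtain b where b: "y - (\<Sum>i<m. s (b i) * Z i) \<in> Q 2" by (rule spans_modE)
    define x' where "x' = (\<Sum>i<m. s (a i) * Z i)"
    define y' where "y' = (\<Sum>i<m. s (b i) * Z i)"
    have "x' * y' = (\<Sum>i<m. \<Sum>j<m. s (a i) * (s (b j) * (Z i * Z j)))"
      unfolding x'_def y'_def sum_product by (simp add: ac_simps)
    also have "\<dots> \<in> T" using ZZ by (auto intro!: vs.subspace_sum vs.subspace_scale T(1))
    finally have 1: "x' * y' \<in> T" .
    have "x' \<in> Q 1" unfolding x'_def using Z(2) by (auto intro!: vs.subspace_sum vs.subspace_scale Q_sub)
    then have 2: "x' * (y - y') \<in> T" using T(2) b Q_prod_le[of x' 1 "y - y'" 2 3] by (auto simp: y'_def)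
    have 3: "(x - x') * y \<in> T" using T(2) a y Q_prod_le[of "x - x'" 2 y 1 3] by (auto simp: x'_def)
    have "x * y = x' * y' + x' * (y - y') + (x - x') * y" by (simp add: algebra_simps)
    with 1 2 3 show "x * y \<in> T" by (auto intro!: vs.subspace_add T(1))
  qed
  then show ?thesis by (simp add: numeral_2_eq_2)
qed

text \<open>The \<open>Z i\<close> with \<open>i < n\<close> are the corrected dual vectors, the
  remaining ones the orthonormal family in \<open>N\<close>. The last conclusion is the
  non-degeneracy of the cubic form in the dual shape of \<open>nondeg_cubics_iff\<close>.\<close>

theorem adapted_generators:
  obtains Z g where "linfun g" "\<And>x. x \<in> Q 4 \<Longrightarrow> g x = 0" "\<And>x. (\<And>y. g (x * y) = 0) \<Longrightarrow> x \<in> Q 4"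
    "n \<le> m" "g 1 = 0" "\<And>i. i < m \<Longrightarrow> Z i \<in> Q 1" "spans_mod (Q 2) m Z (Q 1)"
    "\<And>i. i < m \<Longrightarrow> g (Z i) = 0"
    "\<And>i j. i < m \<Longrightarrow> j < m \<Longrightarrow> g (Z i * Z j) = (if i = j \<and> n \<le> i then 2 else 0)"
    "\<And>i j k. i < m \<Longrightarrow> j < m \<Longrightarrow> k < m \<Longrightarrow> n \<le> i \<Longrightarrow> g (Z i * (Z j * Z k)) = 0"
    "\<And>c. (\<And>i j. i < n \<Longrightarrow> j < n \<Longrightarrow> (\<Sum>k<n. c k * g (Z k * (Z i * Z j))) = 0) \<Longrightarrow> \<forall>k<n. c k = 0"
proof -
  obtain k e where e: "orthonormal k e" and max: "\<nexists>e'. orthonormal (Suc k) e'"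
    using orthonormal_exists by blast
  have eN: "e i \<in> N" and eQ: "e i \<in> Q 1" if "i < k" for i
    using e that by (auto simp: orthonormal_def N_def)
  have ee: "f (e i * e j) = (if i = j then 2 else 0)" if "i < k" "j < k" for i j
    using e that by (auto simp: orthonormal_def)
  \<comment> \<open>first make the dual vectors orthogonal to the \<open>e j\<close> and then, using the pairing with \<open>Q 2\<close>,
    to each other\<close>
  define z1 where "z1 = (\<lambda>i. z i - (\<Sum>j<k. s (f (z i * e j) / 2) * e j))"
  have z1Q: "z1 i \<in> Q 1" if "i < n" for i
    unfolding z1_def using that z_in eQ
    by (auto intro!: vs.subspace_diff vs.subspace_sum vs.subspace_scale Q_sub)
  have z1e: "f (z1 i * e j) = 0" if "i < n" "j < k" for i j
    using orthonormal_coeff[OF e that(2)] by (simp add: z1_def left_diff_distrib lfs)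
  have z1w: "f (z1 i * x) = f (z i * x)" if "i < n" "x \<in> Q 2" for i x
  proof -
    have "(\<Sum>j<k. s (f (z i * e j) / 2) * e j) \<in> N"
      using eN by (auto intro!: vs.subspace_sum vs.subspace_scale N_subspace)
    from f_N_Q2[OF this that(2)] show ?thesis by (simp add: z1_def left_diff_distrib lfs)
  qed
  \<comment> \<open>By duality \<open>w1 i\<close> pairs with \<open>z1 j\<close> to half of the
    product of \<open>z1 i\<close> and \<open>z1 j\<close> under \<open>f\<close>. After subtraction
    the two cross terms contribute one half each and cancel the product, while
    \<open>w1 i * w1 j\<close> is in \<open>Q 4\<close>.\<close>
  define w1 where "w1 = (\<lambda>i. \<Sum>j<n. s (f (z1 i * z1 j) / 2) * w j)"
  have w1Q: "w1 i \<in> Q 2" for i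
    unfolding w1_def using w_in by (auto intro!: vs.subspace_sum vs.subspace_scale Q_sub)
  have z1w1: "f (z1 i * w1 j) = f (z1 j * z1 i) / 2" if "i < n" for i j
    using that sum_w_z[OF that] by (simp add: z1w w1Q) (simp add: w1_def)
  define z2 where "z2 = (\<lambda>i. z1 i - w1 i)"
  have z2Q: "z2 i \<in> Q 1" if "i < n" for i
    unfolding z2_def using z1Q[OF that] w1Q[of i] Q_le[of 1 2] by (auto intro!: vs.subspace_diff Q_sub)
  have z2w: "f (z2 i * x) = f (z i * x)" if "i < n" "x \<in> Q 2" for i x
    using z1w[OF that] f4[OF Q_prod_le[OF w1Q that(2), of 4 i]] by (simp add: z2_def left_diff_distrib lfs)
  have z2e: "f (z2 i * e j) = 0" if "i < n" "j < k" for i j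
    using z1e[OF that] f_Q2_N[OF w1Q eN[OF that(2)], of i] by (simp add: z2_def left_diff_distrib lfs)
  have z2z2: "f (z2 i * z2 j) = 0" if "i < n" "j < n" for i j
  proof -
    have "z2 i * z2 j = z1 i * z1 j - z1 i * w1 j - z1 j * w1 i + w1 i * w1 j"
      by (simp add: z2_def algebra_simps)
    then have "f (z2 i * z2 j) = f (z1 i * z1 j) - f (z1 j * z1 i) / 2 - f (z1 i * z1 j) / 2"
      using f4[OF Q_prod_le[OF w1Q w1Q, of 4 i j]] that by (simp add: lfs z1w1)
    then show ?thesis by (simp add: mult.commute)
  qed
  define Z where "Z = (\<lambda>i. if i < n then z2 i else e (i - n))"
  have split: "(\<Sum>j<n + k. s (c j) * Z j) = (\<Sum>j<n. s (c j) * z2 j) + (\<Sum>j<k. s (c (n + j)) * e j)" for c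
  proof -
    have "(\<Sum>j<n + k. s (c j) * Z j) = (\<Sum>j<n. s (c j) * Z j) + (\<Sum>j = n..<n + k. s (c j) * Z j)"
      by (simp add: lessThan_atLeast0 sum.atLeastLessThan_concat)
    also have "(\<Sum>j = n..<n + k. s (c j) * Z j) = (\<Sum>j<k. s (c (n + j)) * Z (n + j))"
      by (simp add: lessThan_atLeast0 sum.shift_bounds_nat_ivl[of _ 0 n k, simplified] add.commute)
    also have "\<dots> = (\<Sum>j<k. s (c (n + j)) * e j)" by (simp add: Z_def)
    also have "(\<Sum>j<n. s (c j) * Z j) = (\<Sum>j<n. s (c j) * z2 j)" by (simp add: Z_def)
    finally show ?thesis .
  qed
  have z2c: "f ((\<Sum>i<n. s (c i) * z2 i) * w j) = c j" if "j < n" for c j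
  proof -
    have "f ((\<Sum>i<n. s (c i) * z2 i) * w j) = (\<Sum>i<n. c i * f (z2 i * w j))"
      by (simp add: sum_distrib_right mult.assoc lfs)
    also have "\<dots> = (\<Sum>i<n. c i * f (z i * w j))" using that by (intro sum.cong) (auto simp: z2w w_in)
    also have "\<dots> = f ((\<Sum>i<n. s (c i) * z i) * w j)" by (simp add: sum_distrib_right mult.assoc lfs)
    finally show ?thesis using sum_z_w[OF that] by simp
  qed
  have span: "spans_mod (Q 2) (n + k) Z (Q 1)" unfolding spans_mod_def
  proof
    fix x assume x: "x \<in> Q 1"
    define y where "y = x - (\<Sum>i<n. s (f (x * w i)) * z2 i)"
    have "y \<in> N"
    proof (rule in_N)
      show "y \<in> Q 1" unfolding y_def using x z2Q
        by (auto intro!: vs.subspace_diff vs.subspace_sum vs.subspace_scale Q_sub)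
      show "f (y * w j) = 0" if "j < n" for j
        using z2c[OF that] by (simp add: y_def left_diff_distrib lfs)
    qed
    from orthonormal_max_span[OF e max this]
    have "x - (\<Sum>j<n + k. s (if j < n then f (x * w j) else f (y * e (j - n)) / 2) * Z j) \<in> Q 2"
      unfolding split by (simp add: y_def diff_diff_eq)
    then show "\<exists>c. x - (\<Sum>j<n + k. s (c j) * Z j) \<in> Q 2"
      by (rule exI[of _ "\<lambda>j. if j < n then f (x * w j) else f (y * e (j - n)) / 2"])
  qed
  have ind: "indep_mod (Q 2) (n + k) Z" unfolding indep_mod_def split
  proof (intro allI impI)
    fix c i assume c: "(\<Sum>j<n. s (c j) * z2 j) + (\<Sum>j<k. s (c (n + j)) * e j) \<in> Q 2" and i: "i < n + k"
    have E: "(\<Sum>j<k. s (c (n + j)) * e j) \<in> N"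
      using eN by (auto intro!: vs.subspace_sum vs.subspace_scale N_subspace)
    have cn: "c j = 0" if "j < n" for j
    proof -
      have "f (((\<Sum>j<n. s (c j) * z2 j) + (\<Sum>j<k. s (c (n + j)) * e j)) * w j) = 0"
        by (rule f4, rule Q_prod_le[OF c w_in[OF that]]) simp
      then show ?thesis using z2c[OF that] f_N_Q2[OF E w_in[OF that]] by (simp add: distrib_right lfs)
    qed
    have "c (n + j) = 0" if "j < k" for j
      using c cn orthonormal_indep[OF e, unfolded indep_mod_def, THEN spec, of "\<lambda>j. c (n + j)"] that by simp
    with cn i show "c i = 0" by (metis le_add_diff_inverse linorder_not_le nat_add_left_cancel_less)
  qed
  have ZQ: "Z i \<in> Q 1" if "i < n + k" for i using that z2Q eQ by (auto simp: Z_def)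
  \<comment> \<open>Two families that are independent and spanning for \<open>Q 1\<close> modulo
    \<open>Q 2\<close> have the same length. This also yields \<open>n \<le> m\<close>.\<close>
  have m: "n + k = m"
  proof -
    obtain t where t: "\<And>i. i < m \<Longrightarrow> t i \<in> Q 1" "spans_mod (Q 2) m t (Q 1)" "indep_mod (Q 2) m t"
      using dim_1 by (auto simp: reldim_def)
    show ?thesis
      using steinitz_mod[OF Q_sub t(2) ZQ ind] steinitz_mod[OF Q_sub span t(1) t(3)] by simp
  qed
  \<comment> \<open>The unit and the \<open>Z i\<close> are independent modulo \<open>Q 2\<close>,
    so \<open>f\<close> can be altered outside \<open>Q 2\<close> to vanish on all of them. Products
    of two or more generators lie in \<open>Q 2\<close>, as does the socle, so the earlier values
    and the non-degeneracy survive.\<close>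
  define Z' where "Z' = (\<lambda>j. if j = m then 1 else Z j)"
  have "indep_mod (Q 2) (Suc m) Z'" unfolding indep_mod_def
  proof (intro allI impI)
    fix c j assume c: "(\<Sum>j<Suc m. s (c j) * Z' j) \<in> Q 2" and j: "j < Suc m"
    have S: "(\<Sum>j<Suc m. s (c j) * Z' j) = (\<Sum>j<m. s (c j) * Z j) + s (c m)" by (simp add: Z'_def)
    have "(\<Sum>j<m. s (c j) * Z j) \<in> Q 1" using ZQ m
      by (auto intro!: vs.subspace_sum vs.subspace_scale Q_sub)
    with c have "s (c m) \<in> Q 1" unfolding S
      using vs.subspace_diff[OF Q_sub, of _ 1 "(\<Sum>j<m. s (c j) * Z j)"] Q_le[of 1 2]
      by (metis add_diff_cancel_left' one_le_numeral subsetD)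
    then have cm: "c m = 0" by (rule Q_proper)
    with c ind m have "\<forall>j<m. c j = 0" unfolding S by (simp add: indep_mod_def)
    with cm j show "c j = 0" by (auto simp: less_Suc_eq)
  qed
  from linfun_extend[OF Q_sub lf this, of "\<lambda>_. 0"]
  obtain g where g: "linfun g" "\<forall>x\<in>Q 2. g x = f x" "\<forall>j<Suc m. g (Z' j) = 0" by blast
  have gf: "g x = f x" if "x \<in> Q 2" for x using g that by simp
  have dg: "dual_gen g" using f g(1) gf Q_le[of 2 3] Q_le[of 2 4] by (auto simp: dual_gen_def subset_eq)
  have ZZ2: "Z i * Z j \<in> Q 2" if "i < m" "j < m" for i j
    using Q_prod_le[of "Z i" 1 "Z j" 1 2] ZQ that m by auto
  have ZZ: "f (Z i * Z j) = (if i = j \<and> n \<le> i then 2 else 0)" if "i < m" "j < m" for i j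
    using that m z2z2[of i j] z2e[of i "j - n"] z2e[of j "i - n"] ee[of "i - n" "j - n"]
    by (auto simp: Z_def mult.commute[of "e _" "z2 _"])
  have ZZZ: "g (Z i * (Z j * Z l)) = f (Z i * (Z j * Z l))" if "i < m" "j < m" "l < m" for i j l
    using that ZZ2 Q_mult' by (intro gf) auto
  show thesis
  proof (rule that[of g Z])
    show "linfun g" by (rule g)
    show "g x = 0" if "x \<in> Q 4" for x using dg that by (auto simp: dual_gen_def)
    show "x \<in> Q 4" if "\<And>y. g (x * y) = 0" for x using dual_gen_nondeg[OF dg that] .
    show "n \<le> m" using m by simp
    show "g 1 = 0" using g(3)[rule_format, of m] by (simp add: Z'_def)
    show "Z i \<in> Q 1" if "i < m" for i using ZQ m that by simp
    show "spans_mod (Q 2) m Z (Q 1)" using span m by simp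
    show "g (Z i) = 0" if "i < m" for i using g(3)[rule_format, of i] that by (simp add: Z'_def)
    show "g (Z i * Z j) = (if i = j \<and> n \<le> i then 2 else 0)" if "i < m" "j < m" for i j
      using ZZ[OF that] gf[OF ZZ2[OF that]] by simp
    show "g (Z i * (Z j * Z l)) = 0" if "i < m" "j < m" "l < m" "n \<le> i" for i j l
      using that m ZZ2[OF that(2,3)] eN[of "i - n"] by (simp add: ZZZ) (simp add: Z_def f_N_Q2)
    show "\<forall>l<n. c l = 0"
      if c: "\<And>i j. i < n \<Longrightarrow> j < n \<Longrightarrow> (\<Sum>l<n. c l * g (Z l * (Z i * Z j))) = 0" for c
    proof (intro allI impI)
      fix l assume l: "l < n"
      \<comment> \<open>If \<open>x\<close> pairs to zero with all products of two generators, it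
        pairs to zero with \<open>Q 2\<close>, in particular with the \<open>w l\<close>, which read
        off the coefficients of \<open>x\<close>.\<close>
      define x where "x = (\<Sum>l<n. s (c l) * z2 l)"
      let ?T = "{y. f (x * y) = 0}"
      have xQ: "x \<in> Q 1" unfolding x_def using z2Q
        by (auto intro!: vs.subspace_sum vs.subspace_scale Q_sub)
      have "Q 2 \<subseteq> ?T"
      proof (rule Q2_in_span_products)
        have "f (x * (s c * y)) = c * f (x * y)" for c y
          using lfs(2)[of c "x * y"] by (simp add: mult.left_commute)
        then show "vs.subspace ?T" unfolding vs.subspace_def by (simp add: distrib_left lfs)
        show "Q 3 \<subseteq> ?T" using f4 Q_prod_le[OF xQ, of _ 3 4] by auto
        show "spans_mod (Q 2) m Z (Q 1)" using span m by simp
        show "Z i \<in> Q 1" if "i < m" for i using ZQ m that by simp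
        show "Z i * Z j \<in> ?T" if ij: "i < m" "j < m" for i j
        proof -
          have *: "f (z2 l * (Z i * Z j)) = g (Z l * (Z i * Z j))" if "l < n" for l
            using ZZZ[of l i j] ij that m by (simp add: Z_def)
          have "f (x * (Z i * Z j)) = (\<Sum>l<n. c l * f (z2 l * (Z i * Z j)))"
            unfolding x_def sum_distrib_right mult.assoc by (simp only: lfs)
          also have "\<dots> = 0"
          proof (cases "i < n \<and> j < n")
            case True
            then show ?thesis using c[of i j] * by simp
          next
            case False
            have "Z i * Z j \<in> N"
            proof -
              have N1: "a * b \<in> N" if "a \<in> N" for a b
                using that Q_mult[of a 1 b] Q_mult'[of _ 2 b] by (auto simp: N_def mult.assoc)
              have "Z i \<in> N \<or> Z j \<in> N" using False ij m eN[of "i - n"] eN[of "j - n"]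
                by (auto simp: Z_def)
              with N1[of "Z i" "Z j"] N1[of "Z j" "Z i"] show ?thesis by (auto simp: mult.commute)
            qed
            \<comment> \<open>One of the two generators lies in \<open>N\<close>, which is
              orthogonal to \<open>Q 2\<close>, and the other one times \<open>z2 l\<close> lies in
              \<open>Q 2\<close>.\<close>
            have "f (z2 l * (Z i * Z j)) = 0" if l: "l < n" for l
            proof -
              have "Z i \<in> N \<or> Z j \<in> N" using False ij m eN[of "i - n"] eN[of "j - n"]
                by (auto simp: Z_def)
              moreover have "z2 l * (Z i * Z j) = Z i * (z2 l * Z j)" "z2 l * (Z i * Z j) = Z j * (z2 l * Z i)"
                by (simp_all add: ac_simps)
              moreover have "z2 l * Z i \<in> Q 2" "z2 l * Z j \<in> Q 2"
                using Q_prod_le[OF z2Q[OF l], of _ 1 2] ZQ ij m by auto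
              ultimately show ?thesis using f_N_Q2 by metis
            qed
            then show ?thesis by simp
          qed
          finally show ?thesis by simp
        qed
      qed
      then have "f (x * w l) = 0" using w_in[OF l] by auto
      then show "c l = 0" using z2c[OF l] by (simp add: x_def)
    qed
  qed
qed

end

text \<open>The functionals given by the \<open>w j\<close> are independent on \<open>Q 1\<close>: a
  combination of the \<open>w j\<close> orthogonal to \<open>Q 1\<close> lies in \<open>Q 3\<close>
  by \<open>dual_gen_socle\<close>, and the \<open>w j\<close> are independent modulo
  \<open>Q 3\<close>.\<close>

lemma (in gor_filtration) gor_dual_basis_exists:
  obtains f w z where "gor_dual_basis s Q m n f w z"
proof -
  obtain f where f: "dual_gen f" using dual_gen_exists by blast
  then have lf: "linfun f" by (simp add: dual_gen_def)
  obtain w where w: "\<And>j. j < n \<Longrightarrow> w j \<in> Q 2" "spans_mod (Q 3) n w (Q 2)" "indep_mod (Q 3) n w"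
    using dim_2 by (auto simp: reldim_def)
  have "\<exists>z. \<forall>i<n. z i \<in> Q 1 \<and> (\<forall>j<n. f (z i * w j) = (if i = j then 1 else 0))"
  proof (rule dual_vectors[OF Q_sub linfun_times[OF lf]])
    fix c assume c: "\<And>z. z \<in> Q 1 \<Longrightarrow> (\<Sum>j<n. c j * f (z * w j)) = 0"
    have "(\<Sum>j<n. s (c j) * w j) \<in> Q 3"
    proof (rule dual_gen_socle[OF f])
      fix y assume "y \<in> Q 1"
      have "(\<Sum>j<n. s (c j) * w j) * y = (\<Sum>j<n. s (c j) * (y * w j))"
        unfolding sum_distrib_right by (rule sum.cong) (simp_all add: mult.assoc mult.commute)
      then have "f ((\<Sum>j<n. s (c j) * w j) * y) = (\<Sum>j<n. c j * f (y * w j))"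
        by (simp only: linfun_simps[OF lf])
      with c[OF \<open>y \<in> Q 1\<close>] show "f ((\<Sum>j<n. s (c j) * w j) * y) = 0" by simp
    qed
    with w(3) show "\<forall>j<n. c j = 0" by (auto simp: indep_mod_def)
  qed
  then obtain z where "\<forall>i<n. z i \<in> Q 1 \<and> (\<forall>j<n. f (z i * w j) = (if i = j then 1 else 0))" by blast
  with f w show thesis by (intro that[of f w z]) (unfold_locales, auto)
qed

section \<open>Local algebras\<close>

text \<open>The presenting ring is itself local, as everything outside \<open>M\<close> is a unit.
  Each of its nonzero quotients is therefore local with the image of \<open>M\<close> as maximal
  ideal.\<close>

locale local_presentation = presentation s A e
  for s :: "'k::field \<Rightarrow> 'r::comm_ring_1" and A :: "('k, 'a) module" and e +
  fixes M :: "'r set"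
  assumes M_sub: "vs.subspace M"
    and M_mult: "x \<in> M \<Longrightarrow> x * y \<in> M"
    and M_unit: "x \<notin> M \<Longrightarrow> \<exists>y. x * y = 1"
    and M_proper: "1 \<notin> M"
    and ker_proper: "1 \<notin> ker"
begin

lemma ker_M: "ker \<subseteq> M"
proof
  fix x assume "x \<in> ker"
  then have "x * y \<in> ker" for y by (rule ker_times')
  then show "x \<in> M" using M_unit[of x] ker_proper by metis
qed

lemma e_M_iff: "e x \<in> e ` M \<longleftrightarrow> x \<in> M"
proof
  assume "e x \<in> e ` M"
  then obtain y where "y \<in> M" "x - y \<in> ker" by (auto simp: e_eq_iff)
  with vs.subspace_add[OF M_sub, of y "x - y"] ker_M show "x \<in> M" by auto
qed auto

lemma ideal_nonunit:
  assumes "ideal J A" "e x \<in> J" "x \<notin> M"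
  shows "J = carrier A"
proof -
  obtain y where "x * y = 1" using M_unit assms(3) by blast
  with ideal_preimage(2)[OF assms(1,2), of y] have "\<one>\<^bsub>A\<^esub> \<in> J" by (simp add: e_1)
  then show ?thesis using ideal.one_imp_carrier[OF assms(1)] by simp
qed

lemma maximalideal_M: "maximalideal (e ` M) A"
proof (rule maximalidealI)
  show "ideal (e ` M) A" by (rule ideal_image[OF M_sub M_mult])
  have "e 1 \<notin> e ` M" using M_proper by (simp only: e_M_iff not_False_eq_True)
  then show "carrier A \<noteq> e ` M" using e_carrier by metis
next
  fix J assume J: "ideal J A" "e ` M \<subseteq> J" "J \<subseteq> carrier A"
  show "J = e ` M \<or> J = carrier A"
  proof (cases "\<exists>x. e x \<in> J \<and> x \<notin> M")
    case True
    then show ?thesis using ideal_nonunit[OF J(1)] by blast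
  next
    case False
    then have "J \<subseteq> e ` M" using J(3) by (auto simp: e_surj)
    with J show ?thesis by auto
  qed
qed

lemma max_ideal_eq: "max_ideal A = e ` M"
  unfolding max_ideal_def
proof (rule the_equality)
  fix J assume J: "maximalideal J A"
  interpret J: maximalideal J A by fact
  have "J \<subseteq> e ` M"
  proof
    fix a assume a: "a \<in> J"
    then obtain x where x: "a = e x" using J.a_Hcarr by (force simp: e_surj)
    have "x \<in> M"
    proof (rule ccontr)
      assume "x \<notin> M"
      with ideal_nonunit[OF J.ideal_axioms, of x] a x have "J = carrier A" by simp
      with J.I_notcarr show False by simp
    qed
    with x show "a \<in> e ` M" by simp
  qed
  moreover have "ideal (e ` M) A" "e ` M \<subseteq> carrier A" "e ` M \<noteq> carrier A"
    using maximalideal_M maximalideal.I_notcarr[OF maximalideal_M] maximalideal.axioms(1)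
    by (auto simp: e_surj)
  ultimately show "J = e ` M" using J.I_maximal[of "e ` M"] by auto
qed (rule maximalideal_M)

definition Q :: "nat \<Rightarrow> 'r set" where
  "Q i = {x. e x \<in> ideal_power A (max_ideal A) i}"

lemma ideal_max: "ideal (max_ideal A) A"
  unfolding max_ideal_eq by (rule ideal_image[OF M_sub M_mult])

lemma ideal_ideal_power: "ideal (ideal_power A (max_ideal A) i) A"
proof (induction i)
  case 0
  then show ?case by (simp add: ideal_power_def A.oneideal)
next
  case (Suc i)
  then show ?case using A.ideal_prod_is_ideal[OF ideal_max] by (simp add: ideal_power_def)
qed

lemmas Q_subspace = ideal_preimage(1)[OF ideal_ideal_power, folded Q_def]
  and ker_Q = ideal_preimage(3)[OF ideal_ideal_power, folded Q_def]

lemma Q_times: "x \<in> Q i \<Longrightarrow> x * y \<in> Q i"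
  using ideal_preimage(2)[OF ideal_ideal_power] by (simp add: Q_def)

lemma Q_zero: "Q 0 = UNIV" by (simp add: Q_def ideal_power_def)

lemma e_Q: "e ` Q i = ideal_power A (max_ideal A) i"
proof -
  have "ideal_power A (max_ideal A) i \<subseteq> carrier A"
    using ideal_ideal_power additive_subgroup.a_subset ideal.axioms(1) by blast
  then show ?thesis by (auto simp: Q_def e_surj)
qed

lemma M_Q_prod:
  assumes "x \<in> M" "y \<in> Q i"
  shows "x * y \<in> Q (Suc i)"
  using ideal_prod.prod[of "e x" "max_ideal A" "e y" "ideal_power A (max_ideal A) i" A] assms
  by (simp add: Q_def ideal_power_def e_mult max_ideal_eq)

text \<open>\<open>ideal_prod\<close> is the additive closure of the products, so containing the
  products and the kernel suffices for a subspace. This is the source of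
  \<open>Q_gen\<close>.\<close>

lemma Q_Suc_induct:
  assumes T: "vs.subspace T" "ker \<subseteq> T" and prod: "\<And>x y. x \<in> M \<Longrightarrow> y \<in> Q i \<Longrightarrow> x * y \<in> T"
  shows "Q (Suc i) \<subseteq> T"
proof -
  have T': "x \<in> T" if "e x = e y" "y \<in> T" for x y
    using vs.subspace_add[OF T(1), of y "x - y"] that T(2) by (auto simp: e_eq_iff)
  have "a \<in> e ` T" if "a \<in> ideal_prod A (max_ideal A) (ideal_power A (max_ideal A) i)" for a
    using that
  proof induction
    case (prod a b)
    then have "a \<in> e ` M" "b \<in> e ` Q i" by (simp_all only: e_Q max_ideal_eq)
    then obtain x y where "a = e x" "x \<in> M" "b = e y" "y \<in> Q i" by blast
    with assms(3)[of x y] show ?case by (auto simp flip: e_mult)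
  next
    case (sum a b)
    then show ?case using vs.subspace_add[OF T(1)] by (auto simp flip: e_add)
  qed
  then show ?thesis using T' by (auto simp: Q_def ideal_power_def)
qed

lemma Q_1: "Q 1 = M"
proof
  have "Q (Suc 0) \<subseteq> M" by (rule Q_Suc_induct) (use M_sub ker_M M_mult in auto)
  then show "Q 1 \<subseteq> M" by simp
  show "M \<subseteq> Q 1" using M_Q_prod[of _ 1 0] by (auto simp: Q_zero)
qed

lemma Q_Suc_le: "Q (Suc i) \<subseteq> Q i"
  by (rule Q_Suc_induct[OF Q_subspace ker_Q]) (metis Q_times mult.commute)

lemma Q_prod: "x \<in> Q i \<Longrightarrow> y \<in> Q j \<Longrightarrow> x * y \<in> Q (i + j)"
proof (induction i arbitrary: x y j)
  case 0
  then show ?case using Q_times[of y j x] by (simp add: mult.commute)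
next
  case (Suc i)
  let ?T = "{x. \<forall>y\<in>Q j. x * y \<in> Q (Suc i + j)}"
  have "Q (Suc i) \<subseteq> ?T"
  proof (rule Q_Suc_induct)
    show "vs.subspace ?T" unfolding vs.subspace_def
      using vs.subspace_0[OF Q_subspace] vs.subspace_add[OF Q_subspace] vs.subspace_scale[OF Q_subspace]
      by (auto simp: distrib_right mult.assoc)
    show "ker \<subseteq> ?T" using ker_times' ker_Q by blast
    show "x * y \<in> ?T" if "x \<in> M" "y \<in> Q i" for x y
      using M_Q_prod[OF that(1) Suc.IH[OF that(2)]] by (simp add: mult.assoc)
  qed
  with Suc.prems show ?case by auto
qed

text \<open>The quotient by the power \<open>Suc i\<close> of the maximal ideal is presented by the
  same ring, with kernel \<open>Q (Suc i)\<close>; \<open>dimension_iff\<close> then applies to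
  it.\<close>

lemma hilbert_function_iff:
  "has_hilbert_function A h \<longleftrightarrow> (\<forall>i. reldim (h i) (Q i) (Q (Suc i)))"
proof -
  have "ring.dimension (quot_alg A (ideal_power A (max_ideal A) (Suc i))) d
      (scalars (quot_alg A (ideal_power A (max_ideal A) (Suc i))))
      ((\<lambda>x. ideal_power A (max_ideal A) (Suc i) +>\<^bsub>A\<^esub> x) ` ideal_power A (max_ideal A) i) \<longleftrightarrow>
    reldim d (Q i) (Q (Suc i))" for d i
  proof -
    let ?J = "ideal_power A (max_ideal A) (Suc i)"
    interpret B: presentation s "quot_alg A ?J" "\<lambda>x. ?J +>\<^bsub>A\<^esub> e x"
      by (rule presentation_quot[OF ideal_ideal_power])
    have k: "B.ker = Q (Suc i)" using ker_quot[OF ideal_ideal_power] by (simp add: Q_def)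
    show ?thesis
      using B.dimension_iff[OF Q_subspace, of i d] Q_Suc_le unfolding k
      by (simp add: image_image flip: e_Q[of i])
  qed
  then show ?thesis by (simp add: has_hilbert_function_def Let_def)
qed

lemma gorenstein_iff: "gorenstein A \<longleftrightarrow> reldim 1 {x. \<forall>y\<in>M. x * y \<in> ker} ker"
proof -
  let ?S = "{x. \<forall>y\<in>M. x * y \<in> ker}"
  have "socle A = e ` ?S"
    by (auto simp: socle_def max_ideal_eq e_surj ker_def simp flip: e_mult)
  moreover have "vs.subspace ?S" unfolding vs.subspace_def
    using vs.subspace_0[OF ker_subspace] vs.subspace_add[OF ker_subspace] vs.subspace_scale[OF ker_subspace]
    by (auto simp: distrib_right mult.assoc)
  ultimately show ?thesis
    unfolding gorenstein_def using dimension_iff[of ?S 1] ker_times' by auto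
qed

section \<open>Chains of ideals and finite length\<close>

definition ideals_over_ker :: "'r set set" where
  "ideals_over_ker = {J. vs.subspace J \<and> (\<forall>x\<in>J. \<forall>y. x * y \<in> J) \<and> ker \<subseteq> J}"

lemma finite_length_iff:
  "finite_length A \<longleftrightarrow> (\<exists>N. \<forall>k. \<forall>J :: nat \<Rightarrow> 'r set.
     (\<forall>i\<le>k. J i \<in> ideals_over_ker) \<and> (\<forall>i<k. J i \<subset> J (Suc i)) \<longrightarrow> k \<le> N)"
proof -
  have pre: "{x. e x \<in> e ` J} = J" if J: "J \<in> ideals_over_ker" for J
  proof (intro subset_antisym subsetI)
    fix x assume "x \<in> {x. e x \<in> e ` J}"
    then obtain y where "y \<in> J" "x - y \<in> ker" by (auto simp: e_eq_iff)
    with J vs.subspace_add[of J y "x - y"] show "x \<in> J" by (auto simp: ideals_over_ker_def)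
  qed auto
  have img: "e ` {x. e x \<in> J} = J" if "ideal J A" for J
    using that ideal.Icarr[OF that] by (auto simp: e_surj)
  have 1: "ideal (e ` J) A" if "J \<in> ideals_over_ker" for J
    using that by (intro ideal_image) (auto simp: ideals_over_ker_def)
  have 2: "{x. e x \<in> J} \<in> ideals_over_ker" if "ideal J A" for J
    using ideal_preimage[OF that] by (auto simp: ideals_over_ker_def)
  show ?thesis unfolding finite_length_def
  proof (intro ex_cong1 iffI allI impI)
    fix N k and J :: "nat \<Rightarrow> 'r set"
    assume H: "\<forall>k. \<forall>J. (\<forall>i\<le>k. ideal (J i) A) \<and> (\<forall>i<k. J i \<subset> J (Suc i)) \<longrightarrow> k \<le> N"
      and J: "(\<forall>i\<le>k. J i \<in> ideals_over_ker) \<and> (\<forall>i<k. J i \<subset> J (Suc i))"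
    have "e ` J i \<subset> e ` J (Suc i)" if "i < k" for i
    proof -
      have "J i \<in> ideals_over_ker" "J (Suc i) \<in> ideals_over_ker" "J i \<subset> J (Suc i)" using J that by auto
      then show ?thesis using pre[of "J i"] pre[of "J (Suc i)"] by blast
    qed
    with J 1 show "k \<le> N" using H[rule_format, of k "\<lambda>i. e ` J i"] by auto
  next
    fix N k and J :: "nat \<Rightarrow> 'a set"
    assume H: "\<forall>k. \<forall>J. (\<forall>i\<le>k. J i \<in> ideals_over_ker) \<and> (\<forall>i<k. J i \<subset> J (Suc i)) \<longrightarrow> k \<le> N"
      and J: "(\<forall>i\<le>k. ideal (J i) A) \<and> (\<forall>i<k. J i \<subset> J (Suc i))"
    have "{x. e x \<in> J i} \<subset> {x. e x \<in> J (Suc i)}" if "i < k" for i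
    proof -
      have "ideal (J i) A" "ideal (J (Suc i)) A" "J i \<subset> J (Suc i)" using J that by auto
      then show ?thesis using img[of "J i"] img[of "J (Suc i)"] by blast
    qed
    with J 2 show "k \<le> N" using H[rule_format, of k "\<lambda>i. {x. e x \<in> J i}"] by auto
  qed
qed

lemma principal_plus_ker:
  assumes "vs.subspace U" "\<And>x y. x \<in> U \<Longrightarrow> x * y \<in> U"
  shows "{x * t + k | t k. t \<in> U \<and> k \<in> ker} \<in> ideals_over_ker" (is "?J \<in> _")
proof -
  have 1: "ker \<subseteq> ?J"
  proof
    fix k assume "k \<in> ker"
    then show "k \<in> ?J" using vs.subspace_0[OF assms(1)] by (intro CollectI exI[of _ 0] exI[of _ k]) auto
  qed
  have 2: "a * y \<in> ?J" if "a \<in> ?J" for a y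
  proof -
    from that obtain t k where "a = x * t + k" "t \<in> U" "k \<in> ker" by auto
    then show ?thesis using assms(2) ker_times'
      by (intro CollectI exI[of _ "t * y"] exI[of _ "k * y"]) (auto simp: algebra_simps)
  qed
  have 3: "a + b \<in> ?J" if "a \<in> ?J" "b \<in> ?J" for a b
  proof -
    from that obtain t k t' k' where "a = x * t + k" "t \<in> U" "k \<in> ker" "b = x * t' + k'" "t' \<in> U" "k' \<in> ker"
      by auto
    then show ?thesis using vs.subspace_add[OF assms(1)] vs.subspace_add[OF ker_subspace]
      by (intro CollectI exI[of _ "t + t'"] exI[of _ "k + k'"]) (auto simp: algebra_simps)
  qed
  have "s c * a \<in> ?J" if "a \<in> ?J" for c a using 2[OF that, of "s c"] by (simp only: mult.commute)
  then have "vs.subspace ?J" unfolding vs.subspace_def using 1 3 vs.subspace_0[OF ker_subspace] by blast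
  with 1 2 show ?thesis unfolding ideals_over_ker_def by blast
qed

text \<open>Nakayama's lemma by the descending chain condition: in a minimal ideal \<open>J\<close> with
  \<open>J Q\<^sub>i \<noteq> 0\<close> take \<open>x\<close> with \<open>x Q\<^sub>i \<noteq> 0\<close>; then \<open>J = x M\<close>, so \<open>x \<in> x M\<close>.\<close>

lemma finite_length_nilpotent:
  assumes fl: "finite_length A" and Q: "Q i \<subseteq> Q (Suc i)"
  shows "Q i = ker"
proof (rule ccontr)
  assume "Q i \<noteq> ker"
  define R where "R = {(J, J'). J \<in> ideals_over_ker \<and> J' \<in> ideals_over_ker \<and> J \<subset> J'}"
  obtain N where N: "\<And>k J. (\<forall>i\<le>k. J i \<in> ideals_over_ker) \<Longrightarrow> (\<forall>i<k. J i \<subset> J (Suc i)) \<Longrightarrow> k \<le> N"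
    using fl unfolding finite_length_iff by blast
  have "wf R" unfolding wf_iff_no_infinite_down_chain
  proof
    assume "\<exists>f. \<forall>i. (f (Suc i), f i) \<in> R"
    then obtain g where g: "\<And>i. (g (Suc i), g i) \<in> R" by blast
    \<comment> \<open>Finite length bounds ascending chains, so an initial segment of the descending
      sequence is read backwards.\<close>
    have "Suc N \<le> N"
    proof (rule N[of _ "\<lambda>i. g (Suc N - i)"])
      show "\<forall>i\<le>Suc N. g (Suc N - i) \<in> ideals_over_ker" using g by (auto simp: R_def)
      show "\<forall>i<Suc N. g (Suc N - i) \<subset> g (Suc N - Suc i)"
      proof (intro allI impI)
        fix i assume "i < Suc N"
        then have "Suc N - i = Suc (Suc N - Suc i)" by simp
        then show "g (Suc N - i) \<subset> g (Suc N - Suc i)" using g[of "Suc N - Suc i"] by (simp add: R_def)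
      qed
    qed
    then show False by simp
  qed
  define P where "P = (\<lambda>J. J \<in> ideals_over_ker \<and> (\<exists>x\<in>J. \<exists>q\<in>Q i. x * q \<notin> ker))"
  have UI: "UNIV \<in> ideals_over_ker" unfolding ideals_over_ker_def by (simp add: vs.subspace_UNIV)
  have "P UNIV"
  proof -
    from \<open>Q i \<noteq> ker\<close> ker_Q[of i] obtain q where "q \<in> Q i" "q \<notin> ker" by blast
    then have "1 * q \<notin> ker" "q \<in> Q i" by simp_all
    then show ?thesis unfolding P_def using UI by blast
  qed
  then have "UNIV \<in> Collect P" by simp
  from wfE_min[OF \<open>wf R\<close> this] obtain J where J: "P J" and min: "\<And>J'. (J', J) \<in> R \<Longrightarrow> \<not> P J'"
    by (metis mem_Collect_eq)
  from J obtain x q where x: "x \<in> J" "q \<in> Q i" "x * q \<notin> ker" and JI: "J \<in> ideals_over_ker"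
    by (auto simp: P_def)
  let ?J = "{x * t + k | t k. t \<in> M \<and> k \<in> ker}"
  have J'I: "?J \<in> ideals_over_ker" by (rule principal_plus_ker[OF M_sub M_mult])
  \<comment> \<open>Otherwise \<open>x\<close> would send all products of \<open>M\<close> and
    \<open>Q i\<close> into \<open>ker\<close>, hence all of \<open>Q (Suc i)\<close>. This contains
    \<open>Q i\<close>, contrary to the choice of \<open>q\<close>.\<close>
  have "P ?J"
  proof (rule ccontr)
    assume nP: "\<not> P ?J"
    have *: "x * t * q \<in> ker" if "t \<in> M" "q \<in> Q i" for t q
    proof -
      have "x * t \<in> ?J" using that vs.subspace_0[OF ker_subspace] by force
      with nP J'I that show ?thesis unfolding P_def by blast
    qed
    have "Q (Suc i) \<subseteq> {y. x * y \<in> ker}"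
    proof (rule Q_Suc_induct)
      show "vs.subspace {y. x * y \<in> ker}" unfolding vs.subspace_def
        using vs.subspace_0[OF ker_subspace] vs.subspace_add[OF ker_subspace] vs.subspace_scale[OF ker_subspace]
        by (auto simp: distrib_left mult.left_commute[of x])
      show "ker \<subseteq> {y. x * y \<in> ker}" using ker_times by auto
    qed (use * in \<open>auto simp: mult.assoc\<close>)
    with Q x show False by blast
  qed
  moreover have "?J \<subseteq> J"
    using JI x(1) vs.subspace_add[of J] unfolding ideals_over_ker_def by blast
  ultimately have "?J = J" using min[of ?J] J'I JI by (auto simp: R_def)
  with x(1) have "x \<in> ?J" by simp
  then obtain t k where t: "x = x * t + k" "t \<in> M" "k \<in> ker" by blast
  \<comment> \<open>As \<open>1 - t\<close> is a unit and \<open>x * (1 - t)\<close> is in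
    \<open>ker\<close>, so is \<open>x\<close>.\<close>
  have "1 - t \<notin> M" using M_proper vs.subspace_add[OF M_sub _ t(2), of "1 - t"] by auto
  then obtain y where y: "(1 - t) * y = 1" using M_unit by blast
  have "x * (1 - t) = k" using t(1) by (simp add: algebra_simps)
  then have "x = k * y" using y by (metis mult.assoc mult.right_neutral)
  then have "x \<in> ker" using ker_times' t(3) by simp
  then show False using x(3) ker_times' by simp
qed

text \<open>An element of \<open>J (Suc i)\<close> outside \<open>J i\<close> is chosen for each
  step of a chain. These elements are independent modulo \<open>ker\<close>, so their number is
  bounded by that of a spanning family.\<close>

lemma finite_length_spans:
  assumes "spans_mod ker d t UNIV"
  shows "finite_length A"
  unfolding finite_length_iff
proof (intro exI allI impI)
  fix k and J :: "nat \<Rightarrow> 'r set"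
  assume J: "(\<forall>i\<le>k. J i \<in> ideals_over_ker) \<and> (\<forall>i<k. J i \<subset> J (Suc i))"
  have "\<forall>i. \<exists>u. i < k \<longrightarrow> u \<in> J (Suc i) \<and> u \<notin> J i" using J by blast
  then obtain u where u: "\<And>i. i < k \<Longrightarrow> u i \<in> J (Suc i)" "\<And>i. i < k \<Longrightarrow> u i \<notin> J i" by metis
  have sub: "vs.subspace (J i)" "ker \<subseteq> J i" if "i \<le> k" for i
    using J that by (auto simp: ideals_over_ker_def)
  have mono: "J i \<subseteq> J j" if "i \<le> j" "j \<le> k" for i j
    using that
  proof (induction j rule: dec_induct)
    case (step l)
    then have "J l \<subset> J (Suc l)" using J by auto
    with step show ?case by auto
  qed simp
  have "indep_mod ker l u" if "l \<le> k" for l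
    using that
  proof (induction l)
    case (Suc l)
    show ?case unfolding indep_mod_def
    proof (intro allI impI)
      fix c j assume c: "(\<Sum>j<Suc l. s (c j) * u j) \<in> ker" and j: "j < Suc l"
      have l: "l < k" "l \<le> k" using Suc.prems by auto
      have U: "(\<Sum>j<l. s (c j) * u j) \<in> J l"
      proof (intro vs.subspace_sum vs.subspace_scale sub(1) l)
        fix j assume "j \<in> {..<l}"
        then show "u j \<in> J l" using u(1)[of j] mono[of "Suc j" l] l by auto
      qed
      have "(\<Sum>j<l. s (c j) * u j) + s (c l) * u l \<in> J l" using c sub(2)[OF l(2)] by auto
      from vs.subspace_diff[OF sub(1)[OF l(2)] this U] have ul: "s (c l) * u l \<in> J l" by simp
      have cl: "c l = 0"
      proof (rule ccontr)
        assume "c l \<noteq> 0"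
        with vs.subspace_scale[OF sub(1)[OF l(2)] ul, of "inverse (c l)"] u(2)[OF l(1)] show False by simp
      qed
      with c have "(\<Sum>j<l. s (c j) * u j) \<in> ker" by simp
      with Suc.IH l(2) have "\<forall>j<l. c j = 0" unfolding indep_mod_def by blast
      with cl j show "c j = 0" by (auto simp: less_Suc_eq)
    qed
  qed (simp add: indep_mod_def)
  from steinitz_mod[OF ker_subspace assms UNIV_I this[OF order_refl]] show "k \<le> d" .
qed

end

section \<open>Power series in countably many variables\<close>

text \<open>The rings \<open>K[[x\<^sub>1, \<dots>, x\<^sub>r]]\<close> for all \<open>r\<close> are quotients of this one ring, by setting the variables
  with index at least \<open>r\<close> to zero. All algebras are presented by it, which avoids carrier sets.\<close>

typedef 'k mps = "UNIV :: 'k mpser set" morphisms coeff_mps Abs_mps ..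

lemma coeff_Abs_mps [simp]: "coeff_mps (Abs_mps f) = f"
  by (simp add: Abs_mps_inverse)

lemma mps_eqI: "(\<And>a. coeff_mps f a = coeff_mps g a) \<Longrightarrow> f = g"
  by (simp add: coeff_mps_inject[symmetric] fun_eq_iff)

instantiation mps :: (comm_ring_1) comm_ring_1
begin

definition zero_mps :: "'a mps" where "0 = Abs_mps (\<lambda>a. 0)"
definition one_mps :: "'a mps" where "1 = Abs_mps (\<lambda>a. if a = 0 then 1 else 0)"
definition plus_mps :: "'a mps \<Rightarrow> 'a mps \<Rightarrow> 'a mps"
  where "f + g = Abs_mps (\<lambda>a. coeff_mps f a + coeff_mps g a)"
definition minus_mps :: "'a mps \<Rightarrow> 'a mps \<Rightarrow> 'a mps"
  where "f - g = Abs_mps (\<lambda>a. coeff_mps f a - coeff_mps g a)"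
definition uminus_mps :: "'a mps \<Rightarrow> 'a mps" where "- f = Abs_mps (\<lambda>a. - coeff_mps f a)"
definition times_mps :: "'a mps \<Rightarrow> 'a mps \<Rightarrow> 'a mps"
  where "f * g = Abs_mps (\<lambda>a. \<Sum>(b, c) | b + c = a. coeff_mps f b * coeff_mps g c)"

instance
proof
  show "a * b * c = a * (b * c)" for a b c :: "'a mps"
    by (rule mps_eqI) (simp add: times_mps_def pser_mult_assoc)
  show "a * b = b * a" for a b :: "'a mps"
    unfolding times_mps_def
    by (intro arg_cong[of _ _ Abs_mps])
      (auto intro!: ext sum.reindex_bij_witness[where i = prod.swap and j = prod.swap] simp: ac_simps)
  show "1 * a = a" for a :: "'a mps"
  proof (rule mps_eqI)
    fix b
    have "(\<Sum>(c, d) | c + d = b. (if c = 0 then 1 else 0) * coeff_mps a d) =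
        (\<Sum>(c, d) \<in> {(0 :: expo, b)}. (if c = 0 then 1 else 0) * coeff_mps a d)"
      by (rule sum.mono_neutral_right) (auto simp: finite_expo_antidiagonal split: if_splits)
    then show "coeff_mps (1 * a) b = coeff_mps a b" by (simp add: times_mps_def one_mps_def)
  qed
  show "(a + b) * c = a * c + b * c" for a b c :: "'a mps"
    by (rule mps_eqI) (simp add: times_mps_def plus_mps_def distrib_right case_prod_unfold sum.distrib)
  show "(0 :: 'a mps) \<noteq> 1"
  proof
    assume "(0 :: 'a mps) = 1"
    then have "coeff_mps (0 :: 'a mps) 0 = coeff_mps 1 0" by simp
    then show False by (simp add: zero_mps_def one_mps_def)
  qed
qed (rule mps_eqI; simp add: zero_mps_def plus_mps_def minus_mps_def uminus_mps_def ac_simps)+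

end

lemma coeff_mps_simps [simp]:
  "coeff_mps 0 a = 0" "coeff_mps (f + g) a = coeff_mps f a + coeff_mps g a"
  "coeff_mps (f - g) a = coeff_mps f a - coeff_mps g a" "coeff_mps (- f) a = - coeff_mps f a"
  by (simp_all add: zero_mps_def plus_mps_def minus_mps_def uminus_mps_def)

lemma coeff_mps_1: "coeff_mps 1 a = (if a = 0 then 1 else 0)"
  by (simp add: one_mps_def)

lemma coeff_mps_mult: "coeff_mps (f * g) a = (\<Sum>(b, c) | b + c = a. coeff_mps f b * coeff_mps g c)"
  by (simp add: times_mps_def)

lemma coeff_mps_sum [simp]: "coeff_mps (\<Sum>i\<in>I. f i) a = (\<Sum>i\<in>I. coeff_mps (f i) a)"
  by (induction I rule: infinite_finite_induct) auto

definition mps_monom :: "'k::comm_ring_1 \<Rightarrow> expo \<Rightarrow> 'k mps" where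
  "mps_monom c a = Abs_mps (\<lambda>b. if b = a then c else 0)"

lemma coeff_mps_monom: "coeff_mps (mps_monom c a) b = (if b = a then c else 0)"
  by (simp add: mps_monom_def)

lemma coeff_mps_monom_mult:
  "coeff_mps (mps_monom c a * f) b = (if \<exists>d. b = a + d then c * coeff_mps f (b - a) else 0)"
proof -
  have "coeff_mps (mps_monom c a * f) b =
      (\<Sum>p\<in>{p. fst p + snd p = b}. if fst p = a then c * coeff_mps f (snd p) else 0)"
    unfolding coeff_mps_mult by (intro sum.cong) (auto simp: coeff_mps_monom)
  also have "\<dots> = (\<Sum>p\<in>{p. fst p + snd p = b \<and> fst p = a}. c * coeff_mps f (snd p))"
    by (rule sum.mono_neutral_cong_right) (use finite_expo_antidiagonal[of b] in \<open>auto simp: case_prod_unfold\<close>)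
  also have "{p. fst p + snd p = b \<and> fst p = a} = (if \<exists>d. b = a + d then {(a, b - a)} else {})"
    by auto
  finally show ?thesis by simp
qed

lemma mps_monom_mult: "mps_monom c a * mps_monom d b = mps_monom (c * d) (a + b)"
  by (rule mps_eqI) (auto simp: coeff_mps_monom_mult coeff_mps_monom)

definition mps_const :: "'k::comm_ring_1 \<Rightarrow> 'k mps" where "mps_const c = mps_monom c 0"

lemma coeff_mps_const_mult [simp]: "coeff_mps (mps_const c * f) a = c * coeff_mps f a"
  by (simp add: mps_const_def coeff_mps_monom_mult)

lemma coeff_mps_const: "coeff_mps (mps_const c) a = (if a = 0 then c else 0)"
  by (simp add: mps_const_def coeff_mps_monom)

interpretation mps: scalar_hom "mps_const :: 'k::field \<Rightarrow> 'k mps"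
proof
  show "mps_const (a + b) = mps_const a + mps_const b" for a b :: 'k
    by (rule mps_eqI) (simp add: coeff_mps_const)
  show "mps_const (a * b) = mps_const a * mps_const b" for a b :: 'k
    by (rule mps_eqI) (simp add: coeff_mps_const)
  show "mps_const (1 :: 'k) = 1" by (rule mps_eqI) (simp add: coeff_mps_const coeff_mps_1)
qed

section \<open>Degrees of exponents and units among power series\<close>

lemma total_degree_superset:
  assumes "finite S" "Poly_Mapping.keys a \<subseteq> S"
  shows "total_degree a = (\<Sum>i\<in>S. Poly_Mapping.lookup a i)"
  unfolding total_degree_def by (rule sum.mono_neutral_left) (use assms in \<open>auto simp: in_keys_iff\<close>)

lemma total_degree_add: "total_degree (a + b) = total_degree a + total_degree b"
proof -
  let ?S = "Poly_Mapping.keys a \<union> Poly_Mapping.keys b"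
  have "total_degree (a + b) = (\<Sum>i\<in>?S. Poly_Mapping.lookup (a + b) i)"
    by (rule total_degree_superset) (auto simp: keys_expo_add)
  then show ?thesis
    using total_degree_superset[of ?S a] total_degree_superset[of ?S b]
    by (simp add: lookup_add sum.distrib)
qed

lemma total_degree_0 [simp]: "total_degree 0 = 0"
  by (simp add: total_degree_def)

lemma total_degree_single [simp]: "total_degree (Poly_Mapping.single i k) = k"
  by (simp add: total_degree_def)

lemma total_degree_eq_0 [simp]: "total_degree a = 0 \<longleftrightarrow> a = 0"
proof
  assume "total_degree a = 0"
  then have "\<forall>i. Poly_Mapping.lookup a i = 0" by (auto simp: total_degree_def in_keys_iff)
  then show "a = 0" by (intro poly_mapping_eqI) simp
qed simp

lemma coeff_mps_power_0:
  assumes "coeff_mps u 0 = 0" "total_degree a < k"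
  shows "coeff_mps (u ^ k) a = 0"
  using assms(2)
proof (induction k arbitrary: a)
  case (Suc k)
  have "coeff_mps u b * coeff_mps (u ^ k) c = 0" if "b + c = a" for b c
  proof (cases "b = 0")
    case False
    then have "total_degree c < total_degree a" using that total_degree_eq_0[of b]
      by (auto simp: total_degree_add simp del: total_degree_eq_0)
    then show ?thesis using Suc by simp
  qed (simp add: assms)
  then show ?case by (auto simp: coeff_mps_mult intro!: sum.neutral)
qed simp

text \<open>After scaling to constant term 1 the inverse is the geometric series in
  \<open>u\<close>. Since \<open>u ^ k\<close> has no terms of degree below \<open>k\<close>, each
  coefficient of the series is a finite sum up to its own degree.\<close>

lemma mps_unit:
  fixes f :: "'k::field mps"
  assumes "coeff_mps f 0 \<noteq> 0"
  shows "\<exists>g. f * g = 1"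
proof -
  define c where "c = coeff_mps f 0"
  define u where "u = 1 - mps_const (inverse c) * f"
  define g where "g = Abs_mps (\<lambda>a. \<Sum>k\<le>total_degree a. coeff_mps (u ^ k) a)"
  have u0: "coeff_mps u 0 = 0" using assms by (simp add: u_def c_def coeff_mps_1)
  have g: "coeff_mps g a = coeff_mps (\<Sum>k\<le>N. u ^ k) a" if "total_degree a \<le> N" for a N
  proof -
    have "(\<Sum>k\<le>total_degree a. coeff_mps (u ^ k) a) = (\<Sum>k\<le>N. coeff_mps (u ^ k) a)"
      by (rule sum.mono_neutral_left) (use that coeff_mps_power_0[OF u0] in auto)
    then show ?thesis by (simp add: g_def Abs_mps_inverse)
  qed
  have "(1 - u) * g = 1"
  proof (rule mps_eqI)
    fix a
    let ?N = "total_degree a"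
    have "coeff_mps ((1 - u) * g) a = coeff_mps ((1 - u) * (\<Sum>k\<le>?N. u ^ k)) a"
      unfolding coeff_mps_mult
      by (rule sum.cong) (auto simp: total_degree_add simp del: coeff_mps_sum intro!: g)
    also have "\<dots> = coeff_mps (1 - u ^ Suc ?N) a" by (simp only: sum_gp_basic)
    also have "\<dots> = coeff_mps 1 a" using coeff_mps_power_0[OF u0, of a "Suc ?N"] by simp
    finally show "coeff_mps ((1 - u) * g) a = coeff_mps 1 a" .
  qed
  then have "f * (mps_const (inverse c) * g) = 1" by (simp add: u_def ac_simps)
  then show ?thesis by blast
qed

definition mps_restrict :: "nat \<Rightarrow> 'k::comm_ring_1 mps \<Rightarrow> 'k mpser" where
  "mps_restrict r f = (\<lambda>a. if Poly_Mapping.keys a \<subseteq> {..<r} then coeff_mps f a else 0)"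

text \<open>A sum of exponents is supported below \<open>r\<close> exactly if both summands are, so
  dropping all other coefficients is multiplicative. It amounts to setting the variables from
  \<open>r\<close> on to zero.\<close>

lemma presentation_pser_alg:
  "presentation (mps_const :: 'k::field \<Rightarrow> 'k mps) (pser_alg r) (mps_restrict r)"
proof
  show "carrier (pser_alg r :: ('k, 'k mpser) module) = range (mps_restrict r)"
  proof (intro subset_antisym subsetI)
    fix f :: "'k mpser" assume "f \<in> carrier (pser_alg r :: ('k, 'k mpser) module)"
    then have "f = mps_restrict r (Abs_mps f)"
      by (auto simp: mps_restrict_def pser_alg_def Abs_mps_inverse fun_eq_iff)
    then show "f \<in> range (mps_restrict r)" by blast
  qed (auto simp: mps_restrict_def pser_alg_def split: if_splits)
  show "mps_restrict r (x * y) = mps_restrict r x \<otimes>\<^bsub>pser_alg r\<^esub> mps_restrict r y" for x y :: "'k mps"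
  proof
    fix a
    have "(if Poly_Mapping.keys a \<subseteq> {..<r} then coeff_mps x b * coeff_mps y c else 0) =
        mps_restrict r x b * mps_restrict r y c" if "b + c = a" for b c
      using that by (auto simp: mps_restrict_def keys_expo_add)
    then have "(\<Sum>(b, c) | b + c = a. if Poly_Mapping.keys a \<subseteq> {..<r} then coeff_mps x b * coeff_mps y c else 0) =
        (\<Sum>(b, c) | b + c = a. mps_restrict r x b * mps_restrict r y c)"
      by (intro sum.cong) auto
    then show "mps_restrict r (x * y) a = (mps_restrict r x \<otimes>\<^bsub>pser_alg r\<^esub> mps_restrict r y) a"
      by (cases "Poly_Mapping.keys a \<subseteq> {..<r}")
        (simp_all add: pser_alg_def mps_restrict_def[of r "x * y"] coeff_mps_mult)
  qed
qed (auto simp: pser_alg_def mps_restrict_def fun_eq_iff coeff_mps_1)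

definition mps_max :: "'k::field mps set" where "mps_max = {f. coeff_mps f 0 = 0}"

lemma local_presentation_quot:
  fixes I :: "'k::field mpser set"
  assumes I: "ideal I (pser_alg r :: ('k, 'k mpser) module)" "I \<noteq> carrier (pser_alg r :: ('k, 'k mpser) module)"
  shows "local_presentation mps_const (quot_alg (pser_alg r) I)
    (\<lambda>f. I +>\<^bsub>pser_alg r\<^esub> mps_restrict r f) mps_max"
proof -
  interpret R: presentation "mps_const :: 'k \<Rightarrow> 'k mps" "pser_alg r" "mps_restrict r"
    by (rule presentation_pser_alg)
  interpret A: presentation "mps_const :: 'k \<Rightarrow> 'k mps" "quot_alg (pser_alg r) I"
      "\<lambda>f. I +>\<^bsub>pser_alg r\<^esub> mps_restrict r f"
    by (rule R.presentation_quot[OF I(1)])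
  show ?thesis
  proof
    show "mps.vs.subspace (mps_max :: 'k mps set)"
      unfolding mps.vs.subspace_def by (auto simp: mps_max_def)
    have "mps_restrict r 1 \<notin> I"
      using I ideal.one_imp_carrier[OF I(1)] by (auto simp: R.e_1)
    then show "1 \<notin> A.ker" by (simp add: R.ker_quot[OF I(1)])
    show "x * y \<in> mps_max" if "x \<in> mps_max" for x y :: "'k mps"
    proof -
      have "coeff_mps x b * coeff_mps y c = 0" if "b + c = 0" for b c
        using that \<open>x \<in> mps_max\<close> total_degree_add[of b c] by (auto simp: mps_max_def)
      then show ?thesis by (auto simp: mps_max_def coeff_mps_mult intro!: sum.neutral)
    qed
  qed (auto simp: mps_max_def coeff_mps_1 mps_unit)
qed

text \<open>The value 0 of the Hilbert function at 4 gives only \<open>Q 4 \<subseteq> Q 5\<close>.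
  \<open>finite_length_nilpotent\<close> improves this to \<open>Q 4 = ker\<close>, which the
  abstract filtration requires.\<close>

lemma local_gor_filtration:
  fixes A :: "('k::{alg_closed_field, field_char_0}, 'a) module"
  assumes A: "local_presentation (mps_const :: 'k \<Rightarrow> 'k mps) A e mps_max"
    and fl: "finite_length A" and gor: "gorenstein A"
    and hf: "has_hilbert_function A (\<lambda>i. if i < 4 then [1, m, n, 1] ! i else 0)"
  shows "local_presentation.Q A e 4 = presentation.ker A e" "local_presentation.Q A e 1 = mps_max"
    "gor_filtration (mps_const :: 'k \<Rightarrow> 'k mps) (local_presentation.Q A e) m n"
proof -
  interpret A: local_presentation "mps_const :: 'k \<Rightarrow> 'k mps" A e mps_max by (rule A)
  have dim: "mps.reldim (if i < 4 then [1, m, n, 1] ! i else 0) (A.Q i) (A.Q (Suc i))" for i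
    using hf unfolding A.hilbert_function_iff by blast
  have "A.Q 4 \<subseteq> A.Q (Suc 4)"
    using dim[of 4] by (auto simp: mps.reldim_def mps.spans_mod_def)
  then show Q4: "A.Q 4 = A.ker" by (rule A.finite_length_nilpotent[OF fl])
  show "A.Q 1 = mps_max" by (rule A.Q_1)
  show "gor_filtration (mps_const :: 'k \<Rightarrow> 'k mps) A.Q m n"
  proof
    show "A.Q (Suc i) \<subseteq> T"
      if "mps.vs.subspace T" "\<And>x y. x \<in> A.Q 1 \<Longrightarrow> y \<in> A.Q i \<Longrightarrow> x * y \<in> T" "A.Q 4 \<subseteq> T" for i T
      using that by (intro A.Q_Suc_induct) (auto simp: Q4 A.Q_1[simplified])
    show "\<exists>c. x - mps_const c \<in> A.Q 1" for x
      unfolding A.Q_1 by (intro exI[of _ "coeff_mps x 0"]) (simp add: mps_max_def coeff_mps_const)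
    show "c = 0" if "mps_const c \<in> A.Q 1" for c
      using that unfolding A.Q_1 by (simp add: mps_max_def coeff_mps_const)
    show "mps.reldim m (A.Q 1) (A.Q 2)" using dim[of 1] by (simp add: numeral_2_eq_2)
    show "mps.reldim n (A.Q 2) (A.Q 3)" using dim[of 2] by simp
    show "mps.reldim 1 (A.Q 3) (A.Q 4)" using dim[of 3] by simp
    show "mps.reldim 1 {x. \<forall>y\<in>A.Q 1. x * y \<in> A.Q 4} (A.Q 4)"
      using gor unfolding A.gorenstein_iff by (simp add: Q4 A.Q_1[simplified])
  qed (use A.Q_subspace A.Q_Suc_le A.Q_zero A.Q_prod in auto)
qed

section \<open>Macaulay's inverse systems\<close>

abbreviation expo_var :: "nat \<Rightarrow> expo" where "expo_var i \<equiv> Poly_Mapping.single i (Suc 0)"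

lemma expo_var_eq_iff [simp]: "expo_var i = expo_var j \<longleftrightarrow> i = j"
proof
  assume "expo_var i = expo_var j"
  then have "Poly_Mapping.keys (expo_var i) = Poly_Mapping.keys (expo_var j)" by simp
  then show "i = j" by simp
qed simp

lemma expo_split:
  assumes "i \<in> Poly_Mapping.keys (a :: expo)"
  shows "a = expo_var i + (a - expo_var i)"
  using assms
  by (intro poly_mapping_eqI) (auto simp: lookup_add lookup_minus lookup_single when_def in_keys_iff)

lemma expo_Suc_cases:
  assumes "total_degree a = Suc k"
  obtains i b where "a = expo_var i + b" "total_degree b = k" "i \<in> Poly_Mapping.keys a"
    "Poly_Mapping.keys b \<subseteq> Poly_Mapping.keys a"
proof -
  have "a \<noteq> 0" using assms by auto
  then obtain i where i: "i \<in> Poly_Mapping.keys a" by fastforce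
  note a = expo_split[OF i]
  have "total_degree a = 1 + total_degree (a - expo_var i)"
    using arg_cong[OF a, of total_degree] by (simp add: total_degree_add del: One_nat_def)
  moreover have "Poly_Mapping.keys (a - expo_var i) \<subseteq> Poly_Mapping.keys a"
    by (subst (2) a) (auto simp: keys_expo_add)
  ultimately show thesis using that[OF a _ i] assms by simp
qed

lemma expo_induct [case_names zero var]:
  assumes "P 0" "\<And>i a. P a \<Longrightarrow> P (expo_var i + a)"
  shows "P a"
proof (induction "total_degree a" arbitrary: a)
  case (Suc k)
  obtain i b where "a = expo_var i + b" "total_degree b = k" using Suc(2)[symmetric] by (rule expo_Suc_cases)
  with Suc(1)[of b] assms(2) show ?case by simp
qed (use assms in auto)

definition monom_at :: "(nat \<Rightarrow> 'r::comm_monoid_mult) \<Rightarrow> expo \<Rightarrow> 'r" where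
  "monom_at z a = (\<Prod>i\<in>Poly_Mapping.keys a. z i ^ Poly_Mapping.lookup a i)"

lemma monom_at_superset:
  assumes "finite S" "Poly_Mapping.keys a \<subseteq> S"
  shows "monom_at z a = (\<Prod>i\<in>S. z i ^ Poly_Mapping.lookup a i)"
  unfolding monom_at_def by (rule prod.mono_neutral_left) (use assms in \<open>auto simp: in_keys_iff\<close>)

lemma monom_at_0 [simp]: "monom_at z 0 = 1"
  by (simp add: monom_at_def)

lemma monom_at_add: "monom_at z (a + b) = monom_at z a * monom_at z b"
proof -
  let ?S = "Poly_Mapping.keys a \<union> Poly_Mapping.keys b"
  have "monom_at z (a + b) = (\<Prod>i\<in>?S. z i ^ Poly_Mapping.lookup (a + b) i)"
    by (rule monom_at_superset) (auto simp: keys_expo_add)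
  then show ?thesis
    using monom_at_superset[of ?S a z] monom_at_superset[of ?S b z]
    by (simp add: lookup_add power_add prod.distrib)
qed

lemma monom_at_var [simp]: "monom_at z (expo_var i) = z i"
  by (simp add: monom_at_def)

definition efact :: "expo \<Rightarrow> 'k::field_char_0" where
  "efact a = (\<Prod>i\<in>Poly_Mapping.keys a. fact (Poly_Mapping.lookup a i))"

lemma efact_superset:
  assumes "finite S" "Poly_Mapping.keys a \<subseteq> S"
  shows "efact a = (\<Prod>i\<in>S. fact (Poly_Mapping.lookup a i))"
  unfolding efact_def by (rule prod.mono_neutral_left) (use assms in \<open>auto simp: in_keys_iff\<close>)


lemma efact_nonzero [simp]: "efact a \<noteq> 0"
  by (simp add: efact_def)

lemma efact_0 [simp]: "efact 0 = 1"
  by (simp add: efact_def)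

lemma efact_Suc: "efact (expo_var i + a) = of_nat (Suc (Poly_Mapping.lookup a i)) * efact a"
proof -
  let ?S = "insert i (Poly_Mapping.keys a)"
  have "efact (expo_var i + a) = (\<Prod>j\<in>?S. fact (Poly_Mapping.lookup (expo_var i + a) j) :: 'a)"
    by (rule efact_superset) (auto simp: keys_expo_add split: if_splits)
  also have "\<dots> = fact (Suc (Poly_Mapping.lookup a i)) * (\<Prod>j\<in>?S - {i}. fact (Poly_Mapping.lookup a j))"
    by (subst prod.remove[of _ i]) (auto simp: lookup_add lookup_single when_def intro!: prod.cong)
  also have "\<dots> = of_nat (Suc (Poly_Mapping.lookup a i)) * (\<Prod>j\<in>?S. fact (Poly_Mapping.lookup a j))"
    by (subst (2) prod.remove[of _ i]) (auto simp: mult.assoc)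
  also have "(\<Prod>j\<in>?S. fact (Poly_Mapping.lookup a j)) = efact a"
    by (rule efact_superset[symmetric]) auto
  finally show ?thesis .
qed

lemma lookup_pd_power:
  fixes p :: "'k::field_char_0 mpoly"
  shows "Poly_Mapping.lookup ((pd i ^^ k) p) b * efact b =
    efact (b + Poly_Mapping.single i k) * Poly_Mapping.lookup p (b + Poly_Mapping.single i k)"
proof (induction k arbitrary: b)
  case (Suc k)
  have "efact (b + expo_var i) = of_nat (Suc (Poly_Mapping.lookup b i)) * (efact b :: 'k)"
    using efact_Suc[of i b] by (simp only: add.commute)
  then have "Poly_Mapping.lookup ((pd i ^^ Suc k) p) b * efact b =
      Poly_Mapping.lookup ((pd i ^^ k) p) (b + expo_var i) * efact (b + expo_var i)"
    by (simp add: lookup_pd del: of_nat_Suc)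
  also have "\<dots> = efact (b + Poly_Mapping.single i (Suc k)) *
      Poly_Mapping.lookup p (b + Poly_Mapping.single i (Suc k))"
    unfolding Suc by (simp add: add.assoc flip: single_add)
  finally show ?case .
qed simp

text \<open>When every coefficient is multiplied by the factorial of its exponent, differentiation
  becomes a mere shift of exponents. Factorials on both sides avoid a division.\<close>

lemma lookup_pds:
  fixes g :: "'k::field_char_0 mpoly"
  shows "Poly_Mapping.lookup (pds a g) b * efact b = efact (a + b) * Poly_Mapping.lookup g (a + b)"
proof -
  let ?L = "Poly_Mapping.lookup" and ?K = "Poly_Mapping.keys"
  have *: "?L (fold (\<lambda>i. pd i ^^ ?L a i) xs p) b * efact b =
      efact (b + (\<Sum>i\<in>set xs. Poly_Mapping.single i (?L a i))) *
      ?L p (b + (\<Sum>i\<in>set xs. Poly_Mapping.single i (?L a i)))" if "distinct xs" for xs and p :: "'k mpoly"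
    using that
  proof (induction xs arbitrary: p)
    case (Cons i xs)
    let ?b = "b + (\<Sum>i\<in>set xs. Poly_Mapping.single i (?L a i))"
    have "?L (fold (\<lambda>i. pd i ^^ ?L a i) (i # xs) p) b * efact b =
        ?L ((pd i ^^ ?L a i) p) ?b * efact ?b"
      using Cons by (simp add: mult.commute[of "efact ?b"])
    also have "\<dots> = efact (?b + Poly_Mapping.single i (?L a i)) * ?L p (?b + Poly_Mapping.single i (?L a i))"
      by (rule lookup_pd_power)
    also have "?b + Poly_Mapping.single i (?L a i) = b + (\<Sum>i\<in>set (i # xs). Poly_Mapping.single i (?L a i))"
      using Cons.prems by (simp add: ac_simps)
    finally show ?case .
  qed (simp add: mult.commute)
  have "(\<Sum>i\<in>?K a. Poly_Mapping.single i (?L a i)) = a"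
    by (intro poly_mapping_eqI) (simp add: lookup_sum lookup_single when_def in_keys_iff)
  with *[of "sorted_list_of_set (?K a)" g] show ?thesis by (simp add: pds_def add.commute)
qed

lemma lookup_pscale [simp]: "Poly_Mapping.lookup (pscale c p) a = c * Poly_Mapping.lookup p a"
  unfolding pscale_def pconst_def
  by (subst mult_map_scale_conv_mult[symmetric]) (simp add: Poly_Mapping.map.rep_eq when_def)

text \<open>\<open>dual_eval G f\<close> is the constant term of \<open>f \<circ> G\<close>, see \<open>lookup_act\<close>.\<close>

definition dual_eval :: "'k::field_char_0 mpoly \<Rightarrow> 'k mps \<Rightarrow> 'k" where
  "dual_eval G f = (\<Sum>a\<in>Poly_Mapping.keys G. coeff_mps f a * (efact a * Poly_Mapping.lookup G a))"

lemma linfun_dual_eval: "mps.linfun (dual_eval G)"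
  unfolding mps.linfun_def dual_eval_def
  by (simp add: distrib_right sum.distrib sum_distrib_left mult.assoc)

lemma dual_eval_superset:
  assumes "finite S" "Poly_Mapping.keys G \<subseteq> S"
  shows "dual_eval G f = (\<Sum>a\<in>S. coeff_mps f a * (efact a * Poly_Mapping.lookup G a))"
  unfolding dual_eval_def by (rule sum.mono_neutral_left) (use assms in \<open>auto simp: in_keys_iff\<close>)

lemma dual_eval_monom: "dual_eval G (mps_monom c a) = c * (efact a * Poly_Mapping.lookup G a)"
proof -
  let ?S = "insert a (Poly_Mapping.keys G)"
  have "dual_eval G (mps_monom c a) =
      (\<Sum>b\<in>?S. coeff_mps (mps_monom c a) b * (efact b * Poly_Mapping.lookup G b))"
    by (rule dual_eval_superset) auto
  also have "\<dots> = (\<Sum>b\<in>?S. if b = a then c * (efact a * Poly_Mapping.lookup G a) else 0)"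
    by (rule sum.cong) (auto simp: coeff_mps_monom)
  finally show ?thesis by simp
qed

lemma dual_eval_cong:
  assumes "\<And>a. a \<in> Poly_Mapping.keys G \<Longrightarrow> coeff_mps f a = coeff_mps g a"
  shows "dual_eval G f = dual_eval G g"
  using assms by (auto simp: dual_eval_def)

text \<open>Up to the factor \<open>efact b\<close>, the coefficient at \<open>b\<close> is the
  constant term left after differentiating by \<open>b\<close>, and that differentiation is the
  action of the monomial with exponent \<open>b\<close>.\<close>

lemma lookup_act:
  fixes f :: "'k::field_char_0 mpser"
  shows "efact b * Poly_Mapping.lookup (act f G) b = dual_eval G (mps_monom 1 b * Abs_mps f)"
proof -
  let ?L = "Poly_Mapping.lookup" and ?K = "Poly_Mapping.keys"
  define T where "T = {a. a + b \<in> ?K G}"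
  have "finite ((\<lambda>a. a + b) ` T)" by (rule finite_subset[of _ "?K G"]) (auto simp: T_def)
  then have T: "finite T" by (rule finite_imageD) (auto simp: inj_on_def)
  define S where "S = {a. pds a G \<noteq> 0} \<union> T"
  have S: "finite S" using T finite_pds_support[of G] by (simp add: S_def)
  have "{a. pscale (f a) (pds a G) \<noteq> 0} \<subseteq> S"
    by (auto simp: S_def pscale_def)
  then have "act f G = (\<Sum>a\<in>S. pscale (f a) (pds a G))"
    unfolding act_def by (rule Sum_any.expand_superset[OF S])
  then have "efact b * ?L (act f G) b = (\<Sum>a\<in>S. f a * (?L (pds a G) b * efact b))"
    by (simp add: lookup_sum sum_distrib_left ac_simps)
  also have "\<dots> = (\<Sum>a\<in>S. f a * (efact (a + b) * ?L G (a + b)))"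
    by (simp only: lookup_pds)
  also have "\<dots> = (\<Sum>a\<in>T. f a * (efact (a + b) * ?L G (a + b)))"
    by (rule sum.mono_neutral_right) (use S in \<open>auto simp: S_def T_def in_keys_iff\<close>)
  also have "\<dots> = (\<Sum>d\<in>(\<lambda>a. a + b) ` T. f (d - b) * (efact d * ?L G d))"
    by (subst sum.reindex) (auto simp: inj_on_def)
  also have "\<dots> = dual_eval G (mps_monom 1 b * Abs_mps f)"
    unfolding dual_eval_def
    by (rule sum.mono_neutral_cong_left) (auto simp: T_def coeff_mps_monom_mult image_iff add.commute)
  finally show ?thesis .
qed

text \<open>The largest ideal on which the functional \<open>dual_eval G\<close> vanishes. This form
  of the annihilator suits duality arguments; \<open>annih_act\<close> identifies it with the one
  defined by differentiation.\<close>

definition annih :: "'k::field_char_0 mpoly \<Rightarrow> 'k mps set" where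
  "annih G = {f. \<forall>g. dual_eval G (g * f) = 0}"

text \<open>Monomials suffice as multipliers: \<open>dual_eval G\<close> sees only finitely many
  coefficients, so the multiplier may be cut down to the finite set \<open>B\<close> of exponents
  dividing a monomial of \<open>G\<close>.\<close>

lemma annih_iff: "f \<in> annih G \<longleftrightarrow> (\<forall>b. dual_eval G (mps_monom 1 b * f) = 0)"
proof
  assume *: "\<forall>b. dual_eval G (mps_monom 1 b * f) = 0"
  have "dual_eval G (g * f) = 0" for g
  proof -
    define B where "B = (\<Union>d\<in>Poly_Mapping.keys G. fst ` {(b :: expo, c). b + c = d})"
    have B: "finite B" by (auto simp: B_def finite_expo_antidiagonal)
    define g' where "g' = (\<Sum>b\<in>B. mps_const (coeff_mps g b) * mps_monom 1 b)"
    have g': "coeff_mps g' b = coeff_mps g b" if "b \<in> B" for b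
    proof -
      have "coeff_mps g' b = (\<Sum>d\<in>B. if b = d then coeff_mps g d else 0)"
        unfolding g'_def by (auto simp: coeff_mps_monom intro!: sum.cong)
      then show ?thesis using that B by simp
    qed
    have "dual_eval G (g * f) = dual_eval G (g' * f)"
    proof (rule dual_eval_cong)
      fix a assume a: "a \<in> Poly_Mapping.keys G"
      have "coeff_mps g' b = coeff_mps g b" if "b + c = a" for b c
      proof (rule g')
        have "b \<in> fst ` {(b, c). b + c = a}" using that by force
        with a show "b \<in> B" by (auto simp: B_def)
      qed
      then show "coeff_mps (g * f) a = coeff_mps (g' * f) a" unfolding coeff_mps_mult
        by (intro sum.cong) auto
    qed
    also have "g' * f = (\<Sum>b\<in>B. mps_const (coeff_mps g b) * (mps_monom 1 b * f))"
      by (simp add: g'_def sum_distrib_right mult.assoc)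
    also have "dual_eval G \<dots> = 0"
      using * by (simp only: mps.linfun_sum[OF linfun_dual_eval] mps.linfun_scale[OF linfun_dual_eval]) simp
    finally show ?thesis .
  qed
  then show "f \<in> annih G" by (simp add: annih_def)
qed (simp add: annih_def)

lemma annih_act: "f \<in> annih G \<longleftrightarrow> act (coeff_mps f) G = 0"
proof -
  have "act (coeff_mps f) G = 0 \<longleftrightarrow> (\<forall>b. efact b * Poly_Mapping.lookup (act (coeff_mps f) G) b = 0)"
    by (auto intro!: poly_mapping_eqI)
  also have "\<dots> \<longleftrightarrow> f \<in> annih G" by (simp only: lookup_act coeff_mps_inverse annih_iff)
  finally show ?thesis by simp
qed

lemma annih_subspace: "mps.vs.subspace (annih G)"
proof -
  have *: "dual_eval G (g * (mps_const c * f)) = c * dual_eval G (g * f)" for g c f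
    using mps.linfun_scale[OF linfun_dual_eval, of G c "g * f"] by (simp add: mult.left_commute)
  show ?thesis unfolding mps.vs.subspace_def annih_def
    by (auto simp: * distrib_left mps.linfun_simps[OF linfun_dual_eval])
qed

lemma annih_mult: "f \<in> annih G \<Longrightarrow> f * g \<in> annih G"
proof -
  assume f: "f \<in> annih G"
  have "dual_eval G (h * (f * g)) = 0" for h
  proof -
    have "h * (f * g) = (h * g) * f" by (simp add: ac_simps)
    moreover have "dual_eval G ((h * g) * f) = 0" using f by (simp add: annih_def)
    ultimately show ?thesis by (simp only:)
  qed
  then show "f * g \<in> annih G" by (simp add: annih_def)
qed

text \<open>\<open>G\<close> involves only the first \<open>m\<close> variables, so terms of a
  series containing any other variable act on it as zero.\<close>

lemma annih_restrict:
  assumes "G \<in> mpolys m"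
  shows "Abs_mps (mps_restrict m f) \<in> annih G \<longleftrightarrow> f \<in> annih G"
proof -
  have "dual_eval G (mps_monom 1 b * Abs_mps (mps_restrict m f)) = dual_eval G (mps_monom 1 b * f)" for b
  proof (rule dual_eval_cong)
    fix a assume "a \<in> Poly_Mapping.keys G"
    with assms have "Poly_Mapping.keys a \<subseteq> {..<m}" by (auto simp: mpolys_def)
    then show "coeff_mps (mps_monom 1 b * Abs_mps (mps_restrict m f)) a = coeff_mps (mps_monom 1 b * f) a"
      by (auto simp: coeff_mps_monom_mult mps_restrict_def keys_expo_add)
  qed
  then show ?thesis by (simp add: annih_iff)
qed

lemma annihilator_eq:
  assumes "G \<in> mpolys m"
  shows "annihilator m G = mps_restrict m ` annih G"
proof -
  interpret R: presentation "mps_const :: 'a \<Rightarrow> 'a mps" "pser_alg m" "mps_restrict m"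
    by (rule presentation_pser_alg)
  have "mps_restrict m f \<in> annihilator m G \<longleftrightarrow> f \<in> annih G" for f
    using annih_restrict[OF assms, of f] by (simp add: annihilator_def annih_act)
  moreover have "annihilator m G \<subseteq> range (mps_restrict m)"
    by (auto simp: annihilator_def R.e_surj)
  ultimately show ?thesis by auto
qed

lemma ideal_annihilator:
  assumes "G \<in> mpolys m"
  shows "ideal (annihilator m G) (pser_alg m :: ('k::field_char_0, 'k mpser) module)"
proof -
  interpret R: presentation "mps_const :: 'k \<Rightarrow> 'k mps" "pser_alg m" "mps_restrict m"
    by (rule presentation_pser_alg)
  show ?thesis unfolding annihilator_eq[OF assms]
    by (rule R.ideal_image[OF annih_subspace annih_mult])
qed

lemma inv_sys_presentation:
  fixes G :: "'k::field_char_0 mpoly"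
  assumes G: "G \<in> mpolys m"
  shows "presentation mps_const (inv_sys_alg m G) (\<lambda>f. annihilator m G +>\<^bsub>pser_alg m\<^esub> mps_restrict m f)" (is ?P)
    and "presentation.ker (inv_sys_alg m G) (\<lambda>f. annihilator m G +>\<^bsub>pser_alg m\<^esub> mps_restrict m f) = annih G"
proof -
  interpret R: presentation "mps_const :: 'k \<Rightarrow> 'k mps" "pser_alg m" "mps_restrict m"
    by (rule presentation_pser_alg)
  show ?P unfolding inv_sys_alg_def by (rule R.presentation_quot[OF ideal_annihilator[OF G]])
  have "mps_restrict m f \<in> annihilator m G \<longleftrightarrow> f \<in> annih G" for f
    using annih_restrict[OF G, of f] R.e_carrier[of f] by (simp add: annihilator_def annih_act)
  then show "presentation.ker (inv_sys_alg m G) (\<lambda>f. annihilator m G +>\<^bsub>pser_alg m\<^esub> mps_restrict m f) = annih G"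
    unfolding inv_sys_alg_def R.ker_quot[OF ideal_annihilator[OF G]] by simp
qed

definition expos :: "nat \<Rightarrow> nat \<Rightarrow> expo set" where
  "expos m d = {a. Poly_Mapping.keys a \<subseteq> {..<m} \<and> total_degree a < d}"

lemma finite_expos: "finite (expos m d)"
proof (induction d)
  case (Suc d)
  have "expos m (Suc d) \<subseteq> insert 0 ((\<lambda>(i, a). expo_var i + a) ` ({..<m} \<times> expos m d))"
  proof
    fix a assume a: "a \<in> expos m (Suc d)"
    show "a \<in> insert 0 ((\<lambda>(i, a). expo_var i + a) ` ({..<m} \<times> expos m d))"
    proof (cases "total_degree a")
      case (Suc k)
      then obtain i b where "a = expo_var i + b" "total_degree b = k" "i \<in> Poly_Mapping.keys a"
          "Poly_Mapping.keys b \<subseteq> Poly_Mapping.keys a" by (rule expo_Suc_cases)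
      with a Suc have "i \<in> {..<m}" "b \<in> expos m d" by (auto simp: expos_def)
      with \<open>a = expo_var i + b\<close> show ?thesis by force
    qed simp
  qed
  with Suc show ?case by (auto intro: finite_subset)
qed (simp add: expos_def)

lemma expos_addD: "b + c \<in> expos m d \<Longrightarrow> b \<in> expos m d \<and> c \<in> expos m d"
  by (auto simp: expos_def keys_expo_add total_degree_add)

lemma in_plusI: "u \<in> A \<Longrightarrow> v \<in> B \<Longrightarrow> x = u + v \<Longrightarrow> x \<in> {u + v | u v. u \<in> A \<and> v \<in> B}"
  by blast

section \<open>Evaluation of power series at generators of the maximal ideal\<close>

context gor_filtration
begin

lemma monom_at_Q:
  assumes "\<And>i. i < m \<Longrightarrow> Z i \<in> Q 1" "Poly_Mapping.keys a \<subseteq> {..<m}"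
  shows "monom_at Z a \<in> Q (total_degree a)"
  using assms(2)
proof (induction a rule: expo_induct)
  case (var i a)
  then show ?case using Q_prod[of "Z i" 1 "monom_at Z a"] assms(1)[of i]
    by (simp add: keys_expo_add monom_at_add total_degree_add)
qed (simp add: Q_0)

text \<open>Multiplying the spanning monomials of degree \<open>k\<close> by the generators gives
  those of degree \<open>Suc k\<close>, up to higher order. The bound 3 keeps \<open>Q 4\<close>
  inside the error term, as \<open>Q_gen\<close> demands.\<close>

lemma monomial_span_step:
  assumes Z: "\<And>i. i < m \<Longrightarrow> Z i \<in> Q 1" "spans_mod (Q 2) m Z (Q 1)" and k: "k \<le> 3"
  shows "Q k \<subseteq> {u + v | u v. u \<in> vs.span (monom_at Z ` {a. Poly_Mapping.keys a \<subseteq> {..<m} \<and> total_degree a = k})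
    \<and> v \<in> Q (Suc k)}" (is "Q k \<subseteq> ?T k")
  using k
proof (induction k)
  case 0
  show ?case
  proof
    fix x
    obtain c where c: "x - s c \<in> Q 1" using Q_local by blast
    have "s c \<in> vs.span {1}" using vs.span_scale[OF vs.span_base[of 1 "{1}"], of c] by simp
    moreover have "monom_at Z ` {a. Poly_Mapping.keys a \<subseteq> {..<m} \<and> total_degree a = 0} = {1}" by auto
    ultimately show "x \<in> ?T 0" using c by (intro in_plusI[of "s c" _ "x - s c"]) simp_all
  qed
next
  case (Suc k)
  let ?S = "\<lambda>k. monom_at Z ` {a. Poly_Mapping.keys a \<subseteq> {..<m} \<and> total_degree a = k}"
  have T: "vs.subspace (?T (Suc k))" by (intro vs.subspace_sums vs.subspace_span Q_sub)
  have QT: "x \<in> ?T (Suc k)" if "x \<in> Q (Suc (Suc k))" for x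
    using that vs.span_zero by (intro in_plusI[of 0 _ x]) simp_all
  have ZS: "Z i * u \<in> vs.span (?S (Suc k))" if "i < m" "u \<in> vs.span (?S k)" for i u
    using that(2)
  proof (induction rule: vs.span_induct_alt)
    case base
    then show ?case by (simp add: vs.span_zero)
  next
    case (step c b y)
    then obtain a where a: "b = monom_at Z a" "Poly_Mapping.keys a \<subseteq> {..<m}" "total_degree a = k" by auto
    have "Z i * b \<in> ?S (Suc k)"
      using a that(1) by (intro image_eqI[of _ _ "expo_var i + a"])
        (auto simp: monom_at_add[of Z "expo_var i" a] monom_at_var[of Z i, simplified] keys_expo_add total_degree_add split: if_splits)
    from vs.span_add[OF vs.span_scale[OF vs.span_base[OF this], of c] step(2)]
    have "s c * (Z i * b) + Z i * y \<in> vs.span (?S (Suc k))" .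
    then show ?case by (simp add: distrib_left mult.left_commute)
  qed
  show ?case
  proof (rule Q_gen[OF T])
    show "Q 4 \<subseteq> ?T (Suc k)" using QT Q_le[of "Suc (Suc k)" 4] Suc.prems by auto
    fix x y assume x: "x \<in> Q 1" and y: "y \<in> Q k"
    obtain c where c: "x - (\<Sum>i<m. s (c i) * Z i) \<in> Q 2" using spans_modE[OF Z(2) x] .
    define x' where "x' = (\<Sum>i<m. s (c i) * Z i)"
    have x': "x' \<in> Q 1" unfolding x'_def using Z(1) by (auto intro!: vs.subspace_sum vs.subspace_scale Q_sub)
    from Suc y obtain u v where uv: "y = u + v" "u \<in> vs.span (?S k)" "v \<in> Q (Suc k)" by fastforce
    have "x' * u = (\<Sum>i<m. s (c i) * (Z i * u))" by (simp add: x'_def sum_distrib_right mult.assoc)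
    then have "x' * u \<in> vs.span (?S (Suc k))"
      using ZS[OF _ uv(2)] by (auto intro!: vs.span_sum vs.span_scale)
    moreover have "x' * v + (x - x') * y \<in> Q (Suc (Suc k))"
      using Q_prod[OF x' uv(3)] Q_prod[OF c y] by (intro vs.subspace_add Q_sub) (simp_all add: x'_def)
    moreover have "x * y = x' * u + (x' * v + (x - x') * y)" by (simp add: uv(1) algebra_simps)
    ultimately show "x * y \<in> ?T (Suc k)" by blast
  qed
qed

text \<open>Substitution of the \<open>Z i\<close> for the variables. Monomials of degree at least 4
  in elements of \<open>Q 1\<close> lie in \<open>Q 4\<close>, so truncation replaces convergence;
  the price is that multiplicativity holds only modulo \<open>Q 4\<close>. Variables from
  \<open>m\<close> on are sent to zero.\<close>

definition eval_trunc :: "(nat \<Rightarrow> 'r) \<Rightarrow> 'k mps \<Rightarrow> 'r" where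
  "eval_trunc Z p = (\<Sum>a\<in>expos m 4. s (coeff_mps p a) * monom_at Z a)"

lemma s_sum: "s (\<Sum>i\<in>I. h i) = (\<Sum>i\<in>I. s (h i))"
  by (induction I rule: infinite_finite_induct) (auto simp: s_add)

lemma eval_trunc_add: "eval_trunc Z (p + q) = eval_trunc Z p + eval_trunc Z q"
  by (simp add: eval_trunc_def s_add distrib_right sum.distrib)

lemma eval_trunc_scale: "eval_trunc Z (mps_const c * p) = s c * eval_trunc Z p"
  by (simp add: eval_trunc_def sum_distrib_left)

lemma eval_trunc_monom: "a \<in> expos m 4 \<Longrightarrow> eval_trunc Z (mps_monom 1 a) = monom_at Z a"
proof -
  assume a: "a \<in> expos m 4"
  have "eval_trunc Z (mps_monom 1 a) = (\<Sum>b\<in>expos m 4. if b = a then monom_at Z a else 0)"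
    unfolding eval_trunc_def by (rule sum.cong) (auto simp: coeff_mps_monom)
  with a show ?thesis by (simp add: finite_expos)
qed

lemma eval_trunc_1: "eval_trunc Z 1 = 1"
proof -
  have "(1 :: 'k mps) = mps_monom 1 0" by (rule mps_eqI) (simp add: coeff_mps_1 coeff_mps_monom)
  moreover have "0 \<in> expos m 4" by (simp add: expos_def)
  ultimately show ?thesis using eval_trunc_monom[of 0 Z] by simp
qed

text \<open>The two sides differ in the pairs of monomials of degree below 4 whose product has
  degree at least 4, and these products lie in \<open>Q 4\<close>.\<close>

lemma eval_trunc_mult:
  assumes Z: "\<And>i. i < m \<Longrightarrow> Z i \<in> Q 1"
  shows "eval_trunc Z p * eval_trunc Z q - eval_trunc Z (p * q) \<in> Q 4"
proof -
  let ?E = "expos m 4"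
  let ?t = "\<lambda>(b, c). s (coeff_mps p b * coeff_mps q c) * monom_at Z (b + c)"
  define D where "D = {(b, c). b + c \<in> ?E}"
  have D: "D \<subseteq> ?E \<times> ?E" unfolding D_def by (auto dest: expos_addD)
  have "eval_trunc Z p * eval_trunc Z q = (\<Sum>x\<in>?E \<times> ?E. ?t x)"
    unfolding eval_trunc_def sum_product sum.cartesian_product
    by (rule sum.cong[OF refl]) (simp only: case_prod_unfold s_mult monom_at_add ac_simps)
  moreover have "eval_trunc Z (p * q) = (\<Sum>x\<in>D. ?t x)"
  proof -
    have "eval_trunc Z (p * q) = (\<Sum>a\<in>?E. \<Sum>x\<in>{(b, c). b + c = a}. ?t x)"
      unfolding eval_trunc_def coeff_mps_mult s_sum sum_distrib_right
      by (intro sum.cong) (auto simp: case_prod_unfold)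
    also have "\<dots> = (\<Sum>(a, x)\<in>(SIGMA a:?E. {(b, c). b + c = a}). ?t x)"
      by (rule sum.Sigma) (auto simp: finite_expos finite_expo_antidiagonal)
    also have "\<dots> = (\<Sum>x\<in>D. ?t x)"
      by (rule sum.reindex_bij_witness[where i = "\<lambda>x. (fst x + snd x, x)" and j = snd]) (auto simp: D_def)
    finally show ?thesis .
  qed
  moreover have "(\<Sum>x\<in>?E \<times> ?E. ?t x) = (\<Sum>x\<in>?E \<times> ?E - D. ?t x) + (\<Sum>x\<in>D. ?t x)"
    by (rule sum.subset_diff[OF D]) (simp add: finite_expos)
  moreover have "(\<Sum>x\<in>?E \<times> ?E - D. ?t x) \<in> Q 4"
  proof (rule vs.subspace_sum[OF Q_sub])
    fix x assume "x \<in> ?E \<times> ?E - D"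
    then obtain b c where x: "x = (b, c)" "b \<in> ?E" "c \<in> ?E" "b + c \<notin> ?E" by (auto simp: D_def)
    then have "Poly_Mapping.keys (b + c) \<subseteq> {..<m}" "4 \<le> total_degree (b + c)"
      by (auto simp: expos_def keys_expo_add not_less)
    then have "monom_at Z (b + c) \<in> Q (total_degree (b + c))" "Q (total_degree (b + c)) \<subseteq> Q 4"
      by (auto intro!: monom_at_Q[OF Z] Q_le)
    then have "monom_at Z (b + c) \<in> Q 4" by (rule subsetD[rotated])
    then show "?t x \<in> Q 4" unfolding x(1) by (auto intro: vs.subspace_scale Q_sub)
  qed
  ultimately show ?thesis by simp
qed

text \<open>The set \<open>T\<close> of values modulo \<open>Q 4\<close> is a subspace; starting
  from \<open>Q 4\<close>, each level \<open>Q k\<close> is absorbed into it because it is spanned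
  by monomials modulo the next one.\<close>

lemma eval_trunc_surj:
  assumes Z: "\<And>i. i < m \<Longrightarrow> Z i \<in> Q 1" "spans_mod (Q 2) m Z (Q 1)"
  shows "\<exists>p. x - eval_trunc Z p \<in> Q 4"
proof -
  define T where "T = {x. \<exists>p. x - eval_trunc Z p \<in> Q 4}"
  have et0: "eval_trunc Z 0 = 0" by (simp add: eval_trunc_def)
  have T: "vs.subspace T" unfolding vs.subspace_def
  proof (intro conjI ballI allI)
    show "0 \<in> T" unfolding T_def using vs.subspace_0[OF Q_sub] by (intro CollectI exI[of _ 0]) (simp add: et0)
  next
    fix x y assume "x \<in> T" "y \<in> T"
    then obtain p q where "x - eval_trunc Z p \<in> Q 4" "y - eval_trunc Z q \<in> Q 4" by (auto simp: T_def)
    from vs.subspace_add[OF Q_sub this] have "x + y - eval_trunc Z (p + q) \<in> Q 4"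
      by (simp add: eval_trunc_add algebra_simps)
    then show "x + y \<in> T" by (auto simp: T_def)
  next
    fix c x assume "x \<in> T"
    then obtain p where "x - eval_trunc Z p \<in> Q 4" by (auto simp: T_def)
    from vs.subspace_scale[OF Q_sub this] have "s c * x - eval_trunc Z (mps_const c * p) \<in> Q 4"
      by (simp add: eval_trunc_scale right_diff_distrib)
    then show "s c * x \<in> T" by (auto simp: T_def)
  qed
  have mon: "monom_at Z a \<in> T" if "Poly_Mapping.keys a \<subseteq> {..<m}" "total_degree a < 4" for a
    unfolding T_def using that vs.subspace_0[OF Q_sub]
    by (intro CollectI exI[of _ "mps_monom 1 a"]) (simp add: eval_trunc_monom expos_def)
  have "Q k \<subseteq> T" if "k \<le> 4" for k
    using that
  proof (induction k rule: inc_induct)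
    case base
    have "x - eval_trunc Z 0 \<in> Q 4" if "x \<in> Q 4" for x using that by (simp add: et0)
    then show ?case unfolding T_def by blast
  next
    case (step k)
    have "vs.span (monom_at Z ` {a. Poly_Mapping.keys a \<subseteq> {..<m} \<and> total_degree a = k}) \<subseteq> T"
      using mon step by (intro vs.span_minimal T) auto
    moreover have "Q k \<subseteq> {u + v | u v. u \<in> vs.span (monom_at Z ` {a. Poly_Mapping.keys a \<subseteq> {..<m} \<and>
        total_degree a = k}) \<and> v \<in> Q (Suc k)}"
      by (rule monomial_span_step[OF Z]) (use step in simp_all)
    ultimately show ?case using step.IH vs.subspace_add[OF T] by blast
  qed
  from this[of 0] show ?thesis by (auto simp: Q_0 T_def)
qed

text \<open>Evaluation at the \<open>Z i\<close> presents \<open>A\<close> by power series, so only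
  its kernel has to be compared with the annihilator of \<open>G\<close>. By \<open>gG\<close> the
  functional \<open>g\<close> becomes \<open>dual_eval G\<close> under evaluation. A series
  evaluates into \<open>Q 4\<close> exactly if \<open>g\<close> kills all multiples of its value, by
  non-degeneracy of \<open>g\<close>, and that is membership in \<open>annih G\<close>.\<close>

theorem inv_sys_iso:
  assumes A: "presentation s A e" "presentation.ker A e = Q 4"
    and Z: "\<And>i. i < m \<Longrightarrow> Z i \<in> Q 1" "spans_mod (Q 2) m Z (Q 1)"
    and g: "linfun g" "\<And>x. x \<in> Q 4 \<Longrightarrow> g x = 0" "\<And>x. (\<And>y. g (x * y) = 0) \<Longrightarrow> x \<in> Q 4"
    and G: "G \<in> mpolys m" "\<And>a. a \<in> Poly_Mapping.keys G \<Longrightarrow> total_degree a < 4"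
    and gG: "\<And>a. a \<in> expos m 4 \<Longrightarrow> g (monom_at Z a) = efact a * Poly_Mapping.lookup G a"
  shows "alg_iso (inv_sys_alg m G) A"
proof -
  interpret A: presentation s A e by (rule A(1))
  have k: "e x = e y \<longleftrightarrow> x - y \<in> Q 4" for x y using A.e_eq_iff A(2) by simp
  let ?p = "\<lambda>f. e (eval_trunc Z f)"
  have pres: "presentation mps_const A ?p"
  proof
    show "carrier A = range ?p"
      using eval_trunc_surj[OF Z] by (auto simp: A.e_surj k image_iff)
    show "?p (f * h) = ?p f \<otimes>\<^bsub>A\<^esub> ?p h" for f h
    proof -
      have "e (eval_trunc Z f * eval_trunc Z h) = ?p (f * h)"
        unfolding k by (rule eval_trunc_mult[OF Z(1)])
      then show ?thesis by (simp add: A.e_mult)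
    qed
    show "?p 0 = \<zero>\<^bsub>A\<^esub>" by (simp add: eval_trunc_def A.e_0)
  qed (simp_all add: eval_trunc_add eval_trunc_1 eval_trunc_scale A.e_add A.e_1 A.e_scale)
  have gp: "g (eval_trunc Z f) = dual_eval G f" for f
  proof -
    have "Poly_Mapping.keys G \<subseteq> expos m 4" using G by (auto simp: expos_def mpolys_def)
    then have "dual_eval G f = (\<Sum>a\<in>expos m 4. coeff_mps f a * (efact a * Poly_Mapping.lookup G a))"
      by (intro dual_eval_superset finite_expos)
    then show ?thesis by (simp add: eval_trunc_def linfun_simps[OF g(1)] gG)
  qed
  have "eval_trunc Z f \<in> Q 4 \<longleftrightarrow> f \<in> annih G" for f
  proof -
    have 1: "g (eval_trunc Z h * eval_trunc Z f) = dual_eval G (h * f)" for h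
      using g(2)[OF eval_trunc_mult[of Z h f, OF Z(1)]] by (simp add: linfun_simps[OF g(1)] gp)
    have 2: "g (x * eval_trunc Z f) = 0" if h: "\<And>h. g (eval_trunc Z h * eval_trunc Z f) = 0" for x
    proof -
      obtain h' where "x - eval_trunc Z h' \<in> Q 4" using eval_trunc_surj[OF Z] by blast
      from g(2)[OF Q_mult[OF this, of "eval_trunc Z f"]] h[of h'] show ?thesis
        by (simp add: left_diff_distrib linfun_simps[OF g(1)])
    qed
    show ?thesis
    proof
      assume "eval_trunc Z f \<in> Q 4"
      then have "g (eval_trunc Z h * eval_trunc Z f) = 0" for h
        by (rule g(2)[OF Q_mult'])
      then show "f \<in> annih G" by (simp add: annih_def 1)
    next
      assume f: "f \<in> annih G"
      have "g (x * eval_trunc Z f) = 0" for x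
        by (rule 2) (use f in \<open>simp add: 1 annih_def\<close>)
      then have "g (eval_trunc Z f * x) = 0" for x by (simp only: mult.commute[of _ x])
      then show "eval_trunc Z f \<in> Q 4" by (rule g(3))
    qed
  qed
  moreover have "?p f = \<zero>\<^bsub>A\<^esub> \<longleftrightarrow> eval_trunc Z f \<in> Q 4" for f
    using k[of "eval_trunc Z f" 0] by (simp add: A.e_0)
  ultimately have "presentation.ker A ?p = annih G"
    unfolding presentation.ker_def[OF pres] by blast
  then show ?thesis
    by (intro presentation_iso[OF inv_sys_presentation(1)[OF G(1)] pres])
      (simp only: inv_sys_presentation(2)[OF G(1)])
qed

end

section \<open>Cubic forms\<close>

lemma pd_add: "pd i (p + q) = pd i p + pd i q"
  by (intro poly_mapping_eqI) (simp add: lookup_pd lookup_add distrib_left)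

lemma pd_pscale: "pd i (pscale c p) = pscale c (pd i (p :: 'k::field_char_0 mpoly))"
  by (intro poly_mapping_eqI) (simp add: lookup_pd mult.left_commute)

lemma pd_0 [simp]: "pd i 0 = 0"
  by (intro poly_mapping_eqI) (simp add: lookup_pd)

lemma pd_sum: "pd i (\<Sum>x\<in>I. f x) = (\<Sum>x\<in>I. pd i (f x))"
  by (induction I rule: infinite_finite_induct) (auto simp: pd_add)

lemma pscale_add_right: "pscale c (p + q) = pscale c p + pscale c (q :: 'k::field_char_0 mpoly)"
  by (intro poly_mapping_eqI) (simp add: lookup_add distrib_left)

lemma pscale_0_left [simp]: "pscale 0 (p :: 'k::field_char_0 mpoly) = 0"
  and pscale_0_right [simp]: "pscale c (0 :: 'k::field_char_0 mpoly) = 0"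
  and pscale_1 [simp]: "pscale 1 (p :: 'k::field_char_0 mpoly) = p"
  by (intro poly_mapping_eqI; simp)+

lemma pscale_sum: "pscale c (\<Sum>x\<in>I. f x) = (\<Sum>x\<in>I. pscale c (f x :: 'k::field_char_0 mpoly))"
  by (intro poly_mapping_eqI) (simp add: lookup_sum sum_distrib_left)

lemma pscale_pscale: "pscale c (pscale d p) = pscale (c * d) (p :: 'k::field_char_0 mpoly)"
  by (intro poly_mapping_eqI) simp

lemma pscale_mult: "pscale c p * q = pscale c (p * q)" "p * pscale c q = pscale c (p * q)"
  by (simp_all add: pscale_def ac_simps)

lemma pd_single: "pd i (Poly_Mapping.single a c) =
    Poly_Mapping.single (a - expo_var i) (of_nat (Poly_Mapping.lookup a i) * c)"
  by (cases "c = 0") (simp_all add: pd_def)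

lemma pvar_mult_single: "pvar i * Poly_Mapping.single a c = Poly_Mapping.single (expo_var i + a) c"
  by (simp add: pvar_def mult_single)

lemma mpoly_induct [case_names zero add single]:
  assumes "P 0" "\<And>p q. P p \<Longrightarrow> P q \<Longrightarrow> P (p + q)" "\<And>a c. P (Poly_Mapping.single a c)"
  shows "P (p :: 'k::comm_ring_1 mpoly)"
proof -
  have "p = (\<Sum>a\<in>Poly_Mapping.keys p. Poly_Mapping.single a (Poly_Mapping.lookup p a))"
    by (intro poly_mapping_eqI) (simp add: lookup_sum lookup_single when_def in_keys_iff)
  moreover have "P (\<Sum>a\<in>A. Poly_Mapping.single a (Poly_Mapping.lookup p a))" for A
    by (induction A rule: infinite_finite_induct) (use assms in auto)
  ultimately show ?thesis by metis
qed

lemma pd_pvar_mult: "pd j (pvar i * p) = (if i = j then p else 0) + pvar i * pd j p"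
proof (induction p rule: mpoly_induct)
  case (single a c)
  \<comment> \<open>Exponent subtraction truncates, so exponents that do not contain the variable
    \<open>j\<close> need separate treatment.\<close>
  consider "i = j" "Poly_Mapping.lookup a j = 0" | "i \<noteq> j" "Poly_Mapping.lookup a j = 0"
    | "j \<in> Poly_Mapping.keys a" by (auto simp: in_keys_iff)
  then show ?case
  proof cases
    case 3
    define b where "b = a - expo_var j"
    have a: "a = expo_var j + b" using expo_split[OF 3] by (simp add: b_def)
    have s: "expo_var i + (expo_var j + b) - expo_var j = expo_var i + b"
      using add_diff_cancel_left'[of "expo_var j" "expo_var i + b"] by (simp add: add.left_commute)
    have "pd j (pvar i * Poly_Mapping.single a c) = Poly_Mapping.single (expo_var i + b)
        (of_nat (Poly_Mapping.lookup (expo_var i + a) j) * c)"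
      by (simp only: pvar_mult_single pd_single) (simp only: a s)
    also have "\<dots> = Poly_Mapping.single (expo_var i + b) (if i = j then c else 0) +
        Poly_Mapping.single (expo_var i + b) (of_nat (Poly_Mapping.lookup a j) * c)"
      by (simp add: lookup_add lookup_single when_def distrib_right flip: single_add)
    also have "Poly_Mapping.single (expo_var i + b) (of_nat (Poly_Mapping.lookup a j) * c) =
        pvar i * pd j (Poly_Mapping.single a c)"
      by (simp only: pd_single pvar_mult_single b_def)
    also have "Poly_Mapping.single (expo_var i + b) (if i = j then c else 0) =
        (if i = j then Poly_Mapping.single a c else 0)" by (simp add: a)
    finally show ?thesis .
  qed (simp_all add: pvar_mult_single pd_single lookup_add lookup_single when_def)
qed (simp_all add: distrib_left pd_add)

section \<open>Linear substitutions and the chain rule\<close>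

definition poly_subst :: "(nat \<Rightarrow> 'k mpoly) \<Rightarrow> 'k::field_char_0 mpoly \<Rightarrow> 'k mpoly" where
  "poly_subst L F = (\<Sum>a\<in>Poly_Mapping.keys F. pscale (Poly_Mapping.lookup F a) (monom_at L a))"

lemma poly_subst_superset:
  assumes "finite S" "Poly_Mapping.keys F \<subseteq> S"
  shows "poly_subst L F = (\<Sum>a\<in>S. pscale (Poly_Mapping.lookup F a) (monom_at L a))"
  unfolding poly_subst_def by (rule sum.mono_neutral_left) (use assms in \<open>auto simp: in_keys_iff\<close>)

lemma poly_subst_0 [simp]: "poly_subst L 0 = 0"
  by (simp add: poly_subst_def)

lemma poly_subst_add: "poly_subst L (p + q) = poly_subst L p + poly_subst L q"
proof -
  let ?S = "Poly_Mapping.keys p \<union> Poly_Mapping.keys q"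
  have "poly_subst L (p + q) = (\<Sum>a\<in>?S. pscale (Poly_Mapping.lookup (p + q) a) (monom_at L a))"
    by (rule poly_subst_superset) (use keys_add[of p q] in auto)
  moreover have "pscale (a + b) (r :: 'a mpoly) = pscale a r + pscale b r" for a b r
    by (intro poly_mapping_eqI) (simp add: lookup_add distrib_right)
  ultimately show ?thesis
    using poly_subst_superset[of ?S p L] poly_subst_superset[of ?S q L]
    by (simp add: lookup_add sum.distrib)
qed

lemma poly_subst_single: "poly_subst L (Poly_Mapping.single a c) = pscale c (monom_at L a)"
  by (cases "c = 0") (simp_all add: poly_subst_def)

lemma poly_subst_pvar_mult: "poly_subst L (pvar k * p) = L k * poly_subst L p"
  by (induction p rule: mpoly_induct)
    (simp_all add: poly_subst_add distrib_left pvar_mult_single poly_subst_single monom_at_add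
      pscale_mult monom_at_var[of L k, simplified])

lemma poly_subst_pscale: "poly_subst L (pscale c p) = pscale c (poly_subst L p)"
  by (induction p rule: mpoly_induct)
    (simp_all add: poly_subst_add pscale_add_right pscale_pscale pscale_def[of c "Poly_Mapping.single _ _"]
      pconst_def mult_single poly_subst_single)

context
  fixes n :: nat and M :: "'k::field_char_0 mat"
begin

definition lin_form :: "nat \<Rightarrow> 'k mpoly" where
  "lin_form i = (\<Sum>j<n. pscale (M $$ (i, j)) (pvar j))"

lemma lin_subst_eq: "lin_subst n M F = poly_subst lin_form F"
  by (simp add: lin_subst_def poly_subst_def monom_at_def lin_form_def[abs_def])

lemma pd_lin_form_mult:
  assumes "j < n"
  shows "pd j (lin_form i * p) = pscale (M $$ (i, j)) p + lin_form i * pd j p"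
proof -
  have "pd j (lin_form i * p) = (\<Sum>k<n. pscale (M $$ (i, k)) ((if k = j then p else 0) + pvar k * pd j p))"
    by (simp add: lin_form_def sum_distrib_right pscale_mult pd_sum pd_pscale pd_pvar_mult)
  also have "\<dots> = (\<Sum>k<n. if k = j then pscale (M $$ (i, j)) p else 0) + lin_form i * pd j p"
    unfolding pscale_add_right sum.distrib lin_form_def sum_distrib_right pscale_mult
    by (intro arg_cong2[of _ _ _ _ "(+)"] sum.cong) auto
  finally show ?thesis using assms by simp
qed

text \<open>The chain rule: \<open>M $$ (i, j)\<close> is the derivative by \<open>y_j\<close> of
  the form substituted for \<open>y_i\<close>. It is proved for monomials by adding one variable at
  a time, with the product rule, and extended linearly.\<close>

lemma pd_lin_subst:
  assumes j: "j < n" and F: "F \<in> mpolys n"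
  shows "pd j (lin_subst n M F) = (\<Sum>i<n. pscale (M $$ (i, j)) (lin_subst n M (pd i F)))"
proof -
  let ?S = "poly_subst lin_form"
  have mon: "pd j (monom_at lin_form a) = (\<Sum>i<n. pscale (M $$ (i, j)) (?S (pd i (Poly_Mapping.single a 1))))"
    if "Poly_Mapping.keys a \<subseteq> {..<n}" for a
    using that
  proof (induction a rule: expo_induct)
    case zero
    have "pd i (Poly_Mapping.single 0 c) = 0" for i and c :: 'k by (simp add: pd_single)
    from this[of _ 1] have "pd i 1 = (0 :: 'k mpoly)" for i by simp
    then show ?case by simp
  next
    case (var k a)
    then have k: "k < n" "Poly_Mapping.keys a \<subseteq> {..<n}" by (auto simp: keys_expo_add)
    have *: "pd i (Poly_Mapping.single (expo_var k + a) 1) =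
        (if k = i then Poly_Mapping.single a (1 :: 'k) else 0) + pvar k * pd i (Poly_Mapping.single a 1)" for i
      unfolding pvar_mult_single[symmetric] by (rule pd_pvar_mult)
    have "pd j (monom_at lin_form (expo_var k + a)) =
        pscale (M $$ (k, j)) (monom_at lin_form a) + lin_form k * pd j (monom_at lin_form a)"
      by (simp add: monom_at_add monom_at_var[of lin_form k, simplified] pd_lin_form_mult[OF j])
    also have "pscale (M $$ (k, j)) (monom_at lin_form a) =
        (\<Sum>i<n. if i = k then pscale (M $$ (k, j)) (monom_at lin_form a) else 0)"
      using k by simp
    also have "\<dots> = (\<Sum>i<n. pscale (M $$ (i, j)) (?S (if k = i then Poly_Mapping.single a 1 else 0)))"
      by (intro sum.cong) (auto simp: poly_subst_single)
    also have "lin_form k * pd j (monom_at lin_form a) =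
        (\<Sum>i<n. pscale (M $$ (i, j)) (?S (pvar k * pd i (Poly_Mapping.single a 1))))"
      unfolding var(1)[OF k(2)] by (simp add: sum_distrib_left pscale_mult poly_subst_pvar_mult)
    finally show ?case by (simp only: * poly_subst_add pscale_add_right sum.distrib)
  qed
  have single: "pd i (Poly_Mapping.single a c) = pscale c (pd i (Poly_Mapping.single a 1))" for i a and c :: 'k
    by (intro poly_mapping_eqI) (simp add: pd_single lookup_single when_def)
  have sum: "pd j (?S F) = (\<Sum>i<n. pscale (M $$ (i, j)) (?S (pd i F)))"
    if "finite A" "\<And>a. a \<in> A \<Longrightarrow> Poly_Mapping.keys a \<subseteq> {..<n}"
      "F = (\<Sum>a\<in>A. Poly_Mapping.single a (f a))" for A f F
    using that
  proof (induction A arbitrary: F rule: finite_induct)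
    case (insert a A)
    then have "pd j (?S (Poly_Mapping.single a (f a))) =
        (\<Sum>i<n. pscale (M $$ (i, j)) (?S (pd i (Poly_Mapping.single a (f a)))))"
      unfolding single[of _ a "f a"]
      by (simp add: poly_subst_single poly_subst_pscale pd_pscale mon pscale_sum pscale_pscale mult.commute)
    with insert show ?case
      by (simp add: poly_subst_add pd_add pscale_add_right sum.distrib)
  qed simp
  show ?thesis unfolding lin_subst_eq
  proof (rule sum)
    show "F = (\<Sum>a\<in>Poly_Mapping.keys F. Poly_Mapping.single a (Poly_Mapping.lookup F a))"
      by (intro poly_mapping_eqI) (simp add: lookup_sum lookup_single when_def in_keys_iff)
  qed (use F in \<open>auto simp: mpolys_def\<close>)
qed

end

lemma pd_forms: "F \<in> forms n (Suc d) \<Longrightarrow> pd i F \<in> forms n d"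
proof -
  assume F: "F \<in> forms n (Suc d)"
  have "Poly_Mapping.keys a \<subseteq> {..<n} \<and> total_degree a = d" if "a \<in> Poly_Mapping.keys (pd i F)" for a
  proof -
    have "a + expo_var i \<in> Poly_Mapping.keys F" using that by (auto simp: in_keys_iff lookup_pd)
    with F have "Poly_Mapping.keys (a + expo_var i) \<subseteq> {..<n}" "total_degree (a + expo_var i) = Suc d"
      by (auto simp: forms_def mpolys_def)
    then show ?thesis by (simp add: keys_expo_add total_degree_add)
  qed
  then show ?thesis by (auto simp: forms_def mpolys_def)
qed

lemma forms_sum: "(\<And>x. x \<in> I \<Longrightarrow> f x \<in> forms n d) \<Longrightarrow> (\<Sum>x\<in>I. f x) \<in> forms n d"
proof -
  assume f: "\<And>x. x \<in> I \<Longrightarrow> f x \<in> forms n d"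
  have "\<exists>x\<in>I. a \<in> Poly_Mapping.keys (f x)" if "a \<in> Poly_Mapping.keys (\<Sum>x\<in>I. f x)" for a
    using that by (auto simp: in_keys_iff lookup_sum elim: sum.not_neutral_contains_not_neutral)
  with f show ?thesis by (fastforce simp: forms_def mpolys_def)
qed

lemma forms_mult: "p \<in> forms n d \<Longrightarrow> q \<in> forms n d' \<Longrightarrow> p * q \<in> forms n (d + d')"
  using keys_mult[of p q] by (fastforce simp: forms_def mpolys_def keys_expo_add total_degree_add)

lemma forms_pscale: "p \<in> forms n d \<Longrightarrow> pscale c (p :: 'k::field_char_0 mpoly) \<in> forms n d"
  by (auto simp: forms_def mpolys_def in_keys_iff)

lemma forms_pvar: "i < n \<Longrightarrow> pvar i \<in> forms n 1"
  by (simp add: forms_def mpolys_def pvar_def)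

lemma forms_lin_subst:
  assumes "F \<in> forms n d"
  shows "lin_subst n M (F :: 'k::field_char_0 mpoly) \<in> forms n d"
proof -
  have L: "lin_form n M i \<in> forms n 1" for i
    unfolding lin_form_def by (intro forms_sum forms_pscale forms_pvar) simp
  have 0: "(1 :: 'k mpoly) \<in> forms n 0" by (simp add: forms_def mpolys_def)
  have mon: "monom_at (lin_form n M) a \<in> forms n (total_degree a)" for a
  proof (induction a rule: expo_induct)
    case (var i a)
    then show ?case using forms_mult[OF L[of i] var]
      by (simp add: monom_at_add monom_at_var[of _ i, simplified] total_degree_add)
  qed (simp add: 0)
  have "monom_at (lin_form n M) a \<in> forms n d" if "a \<in> Poly_Mapping.keys F" for a
    using mon[of a] assms that by (auto simp: forms_def)
  then show ?thesis unfolding lin_subst_eq poly_subst_def by (intro forms_sum forms_pscale) auto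
qed

text \<open>For a cubic form these are the coefficients of its symmetric trilinear form, normalised
  so that the value at three equal vectors is six times the value of the cubic.\<close>

definition polar :: "'k::field_char_0 mpoly \<Rightarrow> nat \<Rightarrow> nat \<Rightarrow> nat \<Rightarrow> 'k" where
  "polar F i j k = Poly_Mapping.lookup (pd i (pd j (pd k F))) 0"

lemma polar_eq: "polar F i j k = efact (expo_var i + (expo_var j + expo_var k)) *
    Poly_Mapping.lookup F (expo_var i + (expo_var j + expo_var k))"
proof -
  have *: "efact a * Poly_Mapping.lookup (pd i p) a = efact (expo_var i + a) * Poly_Mapping.lookup p (expo_var i + a)"
    for i a and p :: "'a mpoly"
    by (simp add: efact_Suc[of i a] lookup_pd add.commute[of a] mult.assoc mult.left_commute del: of_nat_Suc)
  have "polar F i j k = efact 0 * Poly_Mapping.lookup (pd i (pd j (pd k F))) 0" by (simp add: polar_def)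
  also have "\<dots> = efact (expo_var k + (expo_var j + (expo_var i + 0))) *
      Poly_Mapping.lookup F (expo_var k + (expo_var j + (expo_var i + 0)))" by (simp only: *)
  finally show ?thesis by (simp add: ac_simps)
qed

lemma expo_degree_3:
  assumes "total_degree a = 3" "Poly_Mapping.keys a \<subseteq> {..<n}"
  obtains i j k where "i < n" "j < n" "k < n" "a = expo_var i + (expo_var j + expo_var k)"
proof -
  from assms(1) have "total_degree a = Suc 2" by simp
  then obtain i b where i: "a = expo_var i + b" "total_degree b = 2" "i \<in> Poly_Mapping.keys a"
    "Poly_Mapping.keys b \<subseteq> Poly_Mapping.keys a" by (rule expo_Suc_cases)
  from i(2) have "total_degree b = Suc 1" by simp
  then obtain j c where j: "b = expo_var j + c" "total_degree c = 1" "j \<in> Poly_Mapping.keys b"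
    "Poly_Mapping.keys c \<subseteq> Poly_Mapping.keys b" by (rule expo_Suc_cases)
  from j(2) have "total_degree c = Suc 0" by simp
  then obtain k d where k: "c = expo_var k + d" "total_degree d = 0" "k \<in> Poly_Mapping.keys c"
    by (rule expo_Suc_cases)
  show thesis using that[of i j k] i j k assms(2) by auto
qed

text \<open>By \<open>polar_eq\<close> a third derivative is a coefficient times a factorial, which
  is invertible in characteristic zero.\<close>

lemma cubic_eqI:
  assumes "F \<in> forms n 3" "G \<in> forms n 3"
    and "\<And>i j k. i < n \<Longrightarrow> j < n \<Longrightarrow> k < n \<Longrightarrow> polar F i j k = polar G i j k"
  shows "F = G"
proof (rule poly_mapping_eqI)
  fix a
  show "Poly_Mapping.lookup F a = Poly_Mapping.lookup G a"
  proof (cases "total_degree a = 3 \<and> Poly_Mapping.keys a \<subseteq> {..<n}")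
    case True
    then obtain i j k where "i < n" "j < n" "k < n" "a = expo_var i + (expo_var j + expo_var k)"
      by (blast elim: expo_degree_3)
    with assms(3)[of i j k] show ?thesis by (simp add: polar_eq)
  next
    case False
    then have "a \<notin> Poly_Mapping.keys F" "a \<notin> Poly_Mapping.keys G"
      using assms by (auto simp: forms_def mpolys_def)
    then show ?thesis by (simp add: in_keys_iff)
  qed
qed

lemma polar_pscale: "polar (pscale c F) i j k = c * polar F i j k"
  by (simp add: polar_def pd_pscale)

text \<open>The chain rule is applied three times; the third derivatives of a cubic are constants,
  which the substitution leaves unchanged.\<close>

lemma polar_lin_subst:
  assumes F: "F \<in> forms n 3" and "i < n" "j < n" "k < n"
  shows "polar (lin_subst n M F) i j k =
    (\<Sum>c<n. \<Sum>b<n. \<Sum>a<n. M $$ (c, k) * M $$ (b, j) * M $$ (a, i) * polar F a b c)"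
proof -
  have f: "pd c F \<in> forms n 2" "pd b (pd c F) \<in> forms n 1" "pd a (pd b (pd c F)) \<in> forms n 0" for a b c
    using F by (auto intro!: pd_forms simp: numeral_eq_Suc)
  have mp: "p \<in> mpolys n" if "p \<in> forms n d" for p :: "'a mpoly" and d using that by (simp add: forms_def)
  have 0: "Poly_Mapping.lookup (lin_subst n M p) 0 = Poly_Mapping.lookup p 0" if "p \<in> forms n 0" for p
  proof -
    have "p = Poly_Mapping.single 0 (Poly_Mapping.lookup p 0)"
      using that by (intro poly_mapping_eqI) (force simp: forms_def lookup_single when_def in_keys_iff)
    then have "lin_subst n M p = pscale (Poly_Mapping.lookup p 0) 1"
      using poly_subst_single[of "lin_form n M" 0 "Poly_Mapping.lookup p 0"] by (simp add: lin_subst_eq)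
    then show ?thesis by (simp add: lookup_one)
  qed
  show ?thesis
    unfolding polar_def pd_lin_subst[OF assms(4) mp[OF F]] pd_sum pd_pscale
      pd_lin_subst[OF assms(3) mp[OF f(1)]] pd_lin_subst[OF assms(2) mp[OF f(2)]]
    by (simp add: lookup_sum 0[OF f(3)] sum_distrib_left mult.assoc)
qed

text \<open>The sum is the value of the linear form \<open>x\<close> at the point \<open>c\<close>.
  If the forms span everything, all variables vanish at a common zero. If not, a basis of their span
  is a homogeneous system with fewer equations than unknowns and has a nonzero solution.\<close>

lemma dim_linear_forms:
  fixes S :: "'k::field_char_0 mpoly set"
  assumes S: "S \<subseteq> forms n 1"
  shows "mpoly.dim (mpoly.span S) = n \<longleftrightarrow>
    (\<forall>c. (\<forall>x\<in>S. (\<Sum>k<n. c k * Poly_Mapping.lookup x (expo_var k)) = 0) \<longrightarrow> (\<forall>k<n. c k = 0))"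
proof -
  let ?V = "pvar ` {..<n} :: 'k mpoly set"
  have V: "x \<in> mpoly.span ?V" if x: "x \<in> forms n 1" for x
  proof -
    have "x = (\<Sum>k<n. pscale (Poly_Mapping.lookup x (expo_var k)) (pvar k))"
    proof (rule poly_mapping_eqI)
      fix a
      have "Poly_Mapping.lookup (\<Sum>k<n. pscale (Poly_Mapping.lookup x (expo_var k)) (pvar k)) a =
          (\<Sum>k<n. if a = expo_var k then Poly_Mapping.lookup x a else 0)"
        by (simp add: lookup_sum pvar_def lookup_single when_def) (auto intro!: sum.cong)
      also have "\<dots> = Poly_Mapping.lookup x a"
      proof (cases "a \<in> Poly_Mapping.keys x")
        case True
        then have "total_degree a = Suc 0" "Poly_Mapping.keys a \<subseteq> {..<n}"
          using x by (auto simp: forms_def mpolys_def)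
        from this(1) obtain k b where "a = expo_var k + b" "total_degree b = 0" "k \<in> Poly_Mapping.keys a"
          by (rule expo_Suc_cases)
        with \<open>Poly_Mapping.keys a \<subseteq> {..<n}\<close> have "a = expo_var k" "k < n" by auto
        then show ?thesis by simp
      qed (auto simp: in_keys_iff intro!: sum.neutral)
      finally show "Poly_Mapping.lookup x a =
        Poly_Mapping.lookup (\<Sum>k<n. pscale (Poly_Mapping.lookup x (expo_var k)) (pvar k)) a" by simp
    qed
    also have "\<dots> \<in> mpoly.span ?V"
      by (intro mpoly.span_sum mpoly.span_scale mpoly.span_base) auto
    finally show ?thesis .
  qed
  obtain B where B: "B \<subseteq> S" "mpoly.independent B" "S \<subseteq> mpoly.span B" "card B = mpoly.dim S"
    by (rule mpoly.basis_exists)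
  have bound: "finite C \<and> card C \<le> n" if "mpoly.independent C" "C \<subseteq> forms n 1" for C :: "'k mpoly set"
  proof -
    have "finite C \<and> card C \<le> card ?V"
      by (rule mpoly.independent_span_bound) (use that V in auto)
    then show ?thesis using card_image_le[of "{..<n}" pvar] by (metis card_lessThan finite_lessThan le_trans)
  qed
  have finB: "finite B" "card B \<le> n" using bound[of B] B S by auto
  define \<phi> where "\<phi> = (\<lambda>c x. \<Sum>k<n. c k * Poly_Mapping.lookup (x :: 'k mpoly) (expo_var k))"
  have span: "\<phi> c x = 0" if "\<And>b. b \<in> B \<Longrightarrow> \<phi> c b = 0" "x \<in> mpoly.span B" for c x
    using that(2)
  proof (induction rule: mpoly.span_induct_alt)
    case (step d b y)
    have "\<phi> c (pscale d b + y) = d * \<phi> c b + \<phi> c y"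
      by (simp add: \<phi>_def lookup_add distrib_left sum.distrib sum_distrib_left mult.left_commute)
    with step that(1) show ?case by simp
  qed (simp add: \<phi>_def)
  have "mpoly.dim S = n \<longleftrightarrow> (\<forall>c. (\<forall>x\<in>S. \<phi> c x = 0) \<longrightarrow> (\<forall>k<n. c k = 0))"
  proof
    assume dim: "mpoly.dim S = n"
    show "\<forall>c. (\<forall>x\<in>S. \<phi> c x = 0) \<longrightarrow> (\<forall>k<n. c k = 0)"
    proof (intro allI impI)
      fix c k assume c: "\<forall>x\<in>S. \<phi> c x = 0" and k: "k < n"
      have "pvar k \<in> mpoly.span B"
      proof (rule ccontr)
        assume nin: "pvar k \<notin> mpoly.span B"
        then have "pvar k \<notin> B" by (auto intro: mpoly.span_base)
        moreover have "finite (insert (pvar k) B) \<and> card (insert (pvar k) B) \<le> n"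
        proof (rule bound)
          show "mpoly.independent (insert (pvar k) B)" by (rule mpoly.independent_insertI[OF nin B(2)])
          show "insert (pvar k) B \<subseteq> forms n 1" using B(1) S forms_pvar[OF k] by blast
        qed
        ultimately show False using finB B(4) dim by simp
      qed
      then have "\<phi> c (pvar k) = 0" by (rule span[rotated]) (use c B(1) in auto)
      moreover have "\<phi> c (pvar k) = (\<Sum>j<n. if j = k then c k else 0)"
        unfolding \<phi>_def pvar_def by (intro sum.cong) (auto simp: lookup_single when_def)
      ultimately show "c k = 0" using k by simp
    qed
  next
    assume R: "\<forall>c. (\<forall>x\<in>S. \<phi> c x = 0) \<longrightarrow> (\<forall>k<n. c k = 0)"
    show "mpoly.dim S = n"
    proof (rule ccontr)
      assume "mpoly.dim S \<noteq> n"
      then have "card B < card {..<n}" using finB B(4) by simp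
      from homogeneous_system[OF finB(1) finite_lessThan this, of "\<lambda>b k. Poly_Mapping.lookup b (expo_var k)"]
      obtain c where c: "\<exists>k\<in>{..<n}. c k \<noteq> 0" "\<forall>b\<in>B. \<phi> c b = 0"
        by (auto simp: \<phi>_def mult.commute)
      have "\<phi> c x = 0" if "x \<in> S" for x
        by (rule span) (use c B(3) that in auto)
      with R c(1) show False by auto
    qed
  qed
  then show ?thesis by (simp add: \<phi>_def)
qed

text \<open>The coefficient of \<open>y_k\<close> in a second derivative of \<open>F\<close> is a
  value of \<open>polar\<close>, so \<open>dim_linear_forms\<close> turns the dimension condition
  into the triviality of the radical of the trilinear form.\<close>

lemma nondeg_cubics_iff:
  fixes F :: "'k::field_char_0 mpoly"
  shows "F \<in> nondeg_cubics n \<longleftrightarrow> F \<in> forms n 3 \<and>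
    (\<forall>c. (\<forall>i<n. \<forall>j<n. (\<Sum>k<n. c k * polar F k i j) = 0) \<longrightarrow> (\<forall>k<n. c k = 0))"
proof -
  let ?X = "{pd i (pd j F) | i j. i < n \<and> j < n}"
  have "mpoly.dim (mpoly.span ?X) = n \<longleftrightarrow>
    (\<forall>c. (\<forall>i<n. \<forall>j<n. (\<Sum>k<n. c k * polar F k i j) = 0) \<longrightarrow> (\<forall>k<n. c k = 0))" if F: "F \<in> forms n 3"
  proof -
    have "?X \<subseteq> forms n 1"
      using pd_forms[of F n 2] pd_forms[of _ n 1] F by (auto simp: numeral_eq_Suc)
    moreover have lk: "Poly_Mapping.lookup (pd i (pd j F)) (expo_var k) = polar F k i j" for i j k
      by (simp add: polar_def lookup_pd[of k])
    have "(\<forall>x\<in>?X. (\<Sum>k<n. c k * Poly_Mapping.lookup x (expo_var k)) = 0) \<longleftrightarrow>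
        (\<forall>i<n. \<forall>j<n. (\<Sum>k<n. c k * polar F k i j) = 0)" for c
      unfolding lk[symmetric] by blast
    ultimately show ?thesis by (simp only: dim_linear_forms)
  qed
  then show ?thesis by (auto simp: nondeg_cubics_def)
qed

section \<open>The algebra of a non degenerate cubic\<close>

text \<open>The preimage of the \<open>i\<close>-th power of the maximal ideal of the series ring in
  \<open>m\<close> variables; coefficients at exponents involving later variables are
  unconstrained.\<close>

definition order_ideal :: "nat \<Rightarrow> nat \<Rightarrow> 'k::field mps set" where
  "order_ideal m i = {f. \<forall>a\<in>expos m i. coeff_mps f a = 0}"

lemma order_ideal_subspace: "mps.vs.subspace (order_ideal m i)"
  unfolding mps.vs.subspace_def order_ideal_def by auto

lemma order_ideal_0: "order_ideal m 0 = UNIV"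
  by (auto simp: order_ideal_def expos_def)

lemma order_ideal_1: "order_ideal m 1 = mps_max"
proof -
  have "expos m 1 = {0}" by (auto simp: expos_def)
  then show ?thesis by (simp add: order_ideal_def mps_max_def)
qed

lemma order_ideal_antimono: "i \<le> j \<Longrightarrow> order_ideal m j \<subseteq> order_ideal m i"
  by (auto simp: order_ideal_def expos_def)

lemma order_ideal_mult:
  assumes "f \<in> order_ideal m i" "g \<in> order_ideal m j" "k \<le> i + j"
  shows "f * g \<in> order_ideal m k"
  unfolding order_ideal_def
proof (intro CollectI ballI)
  fix a assume a: "a \<in> expos m k"
  have "coeff_mps f b * coeff_mps g c = 0" if "b + c = a" for b c
  proof -
    have "b \<in> expos m i \<or> c \<in> expos m j"
      using a that assms(3) by (auto simp: expos_def total_degree_add keys_expo_add)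
    then show ?thesis using assms(1,2) by (auto simp: order_ideal_def)
  qed
  then show "coeff_mps (f * g) a = 0" by (auto simp: coeff_mps_mult intro!: sum.neutral)
qed

lemma order_ideal_monom: "i \<le> total_degree a \<Longrightarrow> mps_monom c a \<in> order_ideal m i"
  by (auto simp: order_ideal_def expos_def coeff_mps_monom)

lemma order_ideal_expand:
  "f - (\<Sum>b\<in>expos m d. mps_const (coeff_mps f b) * mps_monom 1 b) \<in> order_ideal m d"
  unfolding order_ideal_def
proof (intro CollectI ballI)
  fix a assume a: "a \<in> expos m d"
  have "coeff_mps (\<Sum>b\<in>expos m d. mps_const (coeff_mps f b) * mps_monom 1 b) a =
      (\<Sum>b\<in>expos m d. if b = a then coeff_mps f a else 0)"
    by (auto simp: coeff_mps_monom intro!: sum.cong)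
  then show "coeff_mps (f - (\<Sum>b\<in>expos m d. mps_const (coeff_mps f b) * mps_monom 1 b)) a = 0"
    using a by (simp add: finite_expos)
qed

definition mps_var :: "nat \<Rightarrow> 'k::field mps" where "mps_var i = mps_monom 1 (expo_var i)"

lemma mps_var_order: "mps_var i \<in> order_ideal m 1"
  by (simp add: mps_var_def order_ideal_monom)

lemma order_ideal_linear_part:
  assumes "f \<in> order_ideal m 1"
  shows "f - (\<Sum>k<m. mps_const (coeff_mps f (expo_var k)) * mps_var k) \<in> order_ideal m 2"
  unfolding order_ideal_def
proof (intro CollectI ballI)
  fix a assume a: "a \<in> expos m 2"
  let ?l = "\<Sum>k<m. mps_const (coeff_mps f (expo_var k)) * mps_var k"
  have l: "coeff_mps ?l a = (\<Sum>k<m. if a = expo_var k then coeff_mps f a else 0)"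
    by (auto simp: mps_var_def coeff_mps_monom intro!: sum.cong)
  show "coeff_mps (f - ?l) a = 0"
  proof (cases "total_degree a")
    case 0
    then have "a = 0" by simp
    then have "coeff_mps f a = 0" using assms by (simp add: order_ideal_def expos_def)
    then show ?thesis unfolding coeff_mps_simps(3) l by (auto intro!: sum.neutral)
  next
    case (Suc d)
    then obtain k b where k: "a = expo_var k + b" "total_degree b = d" "k \<in> Poly_Mapping.keys a"
      by (rule expo_Suc_cases)
    then have "a = expo_var k" "k < m" using a Suc by (auto simp: expos_def)
    then show ?thesis unfolding coeff_mps_simps(3) l by simp
  qed
qed

lemma mps_monom_1_0: "mps_monom 1 0 = 1"
  by (rule mps_eqI) (simp add: coeff_mps_1 coeff_mps_monom)

locale nondeg_cubic =
  fixes m n :: nat and F :: "'k::field_char_0 mpoly"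
  assumes n_pos: "1 \<le> n" and n_le: "n \<le> m" and F: "F \<in> nondeg_cubics n"
begin

definition G :: "'k mpoly" where "G = F + (\<Sum>i = n..<m. pvar i ^ 2)"

lemma cubic_alg_eq: "cubic_alg m n F = inv_sys_alg m G"
  by (simp add: cubic_alg_def G_def)

lemma F_forms: "F \<in> forms n 3"
  using F by (simp add: nondeg_cubics_iff)

lemma F_nondeg: "(\<And>i j. i < n \<Longrightarrow> j < n \<Longrightarrow> (\<Sum>k<n. c k * polar F k i j) = 0) \<Longrightarrow> k < n \<Longrightarrow> c k = 0"
  using F unfolding nondeg_cubics_iff by blast

lemma lookup_G: "Poly_Mapping.lookup G a = Poly_Mapping.lookup F a +
    (if \<exists>i. n \<le> i \<and> i < m \<and> a = expo_var i + expo_var i then 1 else 0)"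
proof -
  have sq: "(pvar i ^ 2 :: 'k mpoly) = Poly_Mapping.single (expo_var i + expo_var i) 1" for i
    by (simp add: pvar_def power2_eq_square mult_single)
  have inj: "expo_var i + expo_var i = expo_var j + expo_var j \<longleftrightarrow> i = j" for i j
  proof
    assume "expo_var i + expo_var i = expo_var j + expo_var j"
    then have "Poly_Mapping.keys (expo_var i + expo_var i) = Poly_Mapping.keys (expo_var j + expo_var j)" by simp
    then show "i = j" by (simp only: keys_expo_add) simp
  qed simp
  have "(\<Sum>i = n..<m. Poly_Mapping.lookup (pvar i ^ 2 :: 'k mpoly) a) =
      (if \<exists>i. n \<le> i \<and> i < m \<and> a = expo_var i + expo_var i then 1 else 0)"
  proof (cases "\<exists>i. n \<le> i \<and> i < m \<and> a = expo_var i + expo_var i")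
    case True
    then obtain i where i: "n \<le> i" "i < m" "a = expo_var i + expo_var i" by blast
    have "(\<Sum>j = n..<m. Poly_Mapping.lookup (pvar j ^ 2 :: 'k mpoly) a) = (\<Sum>j = n..<m. if j = i then 1 else 0)"
      unfolding sq by (intro sum.cong) (auto simp: lookup_single when_def i(3) inj)
    also have "\<dots> = 1" using i by simp
    finally show ?thesis using True by simp
  next
    case False
    then show ?thesis unfolding sq by (auto simp: lookup_single when_def intro!: sum.neutral)
  qed
  then show ?thesis by (simp add: G_def lookup_add lookup_sum)
qed

lemma keys_G_cases:
  assumes "a \<in> Poly_Mapping.keys G"
  obtains "Poly_Mapping.keys a \<subseteq> {..<n}" "total_degree a = 3" "a \<in> Poly_Mapping.keys F"
  | i where "n \<le> i" "i < m" "a = expo_var i + expo_var i"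
proof -
  consider "a \<in> Poly_Mapping.keys F" | "\<exists>i. n \<le> i \<and> i < m \<and> a = expo_var i + expo_var i"
    using assms by (force simp: in_keys_iff lookup_G)
  then show thesis
  proof cases
    case 1
    then show ?thesis using F_forms by (intro that(1)) (auto simp: forms_def mpolys_def)
  qed (use that in blast)
qed

lemma G_mpolys: "G \<in> mpolys m"
  unfolding mpolys_def using n_le by (auto elim!: keys_G_cases simp: keys_expo_add)

lemma G_degree: "a \<in> Poly_Mapping.keys G \<Longrightarrow> total_degree a < 4"
  by (auto elim!: keys_G_cases simp: total_degree_add)

abbreviation ev :: "'k mps \<Rightarrow> 'k" where "ev \<equiv> dual_eval G"

lemmas ev_simps = mps.linfun_simps[OF linfun_dual_eval]

lemma polar_outside: "\<not> (i < n \<and> j < n \<and> k < n) \<Longrightarrow> polar F i j k = 0"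
proof -
  let ?a = "expo_var i + (expo_var j + expo_var k)"
  assume ijk: "\<not> (i < n \<and> j < n \<and> k < n)"
  have "?a \<notin> Poly_Mapping.keys F"
  proof
    assume "?a \<in> Poly_Mapping.keys F"
    then have "Poly_Mapping.keys ?a \<subseteq> {..<n}" using F_forms unfolding forms_def mpolys_def by blast
    with ijk show False by (auto simp: keys_expo_add)
  qed
  then show ?thesis by (simp add: polar_eq in_keys_iff)
qed

lemma ev_cubic: "ev (mps_var i * (mps_var j * mps_var k)) = polar F i j k"
proof -
  have "expo_var i + (expo_var j + expo_var k) \<noteq> expo_var l + expo_var l" for l
    by (metis One_nat_def Suc_1 add_Suc_right add_cancel_right_right nat.distinct(1) nat.inject
        one_add_one total_degree_add total_degree_single)
  then show ?thesis
    by (simp add: mps_var_def mps_monom_mult dual_eval_monom lookup_G polar_eq)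
qed

lemma F_lookup_low: "total_degree a \<noteq> 3 \<Longrightarrow> Poly_Mapping.lookup F a = 0"
  using F_forms by (auto simp: forms_def in_keys_iff)

lemma efact_square: "efact (expo_var i + expo_var i) = (2 :: 'k)"
proof -
  have "efact (expo_var i + expo_var i) = (2 :: 'k) * efact (expo_var i + 0)"
    using efact_Suc[of i "expo_var i", where ?'a = 'k] by simp
  also have "efact (expo_var i + 0) = (1 :: 'k)" by (subst efact_Suc) simp
  finally show ?thesis by simp
qed

lemma expo_pair_eq: "expo_var i + expo_var j = expo_var l + expo_var l \<longleftrightarrow> i = l \<and> j = l"
proof
  assume "expo_var i + expo_var j = expo_var l + expo_var l"
  then have "Poly_Mapping.keys (expo_var i + expo_var j) = Poly_Mapping.keys (expo_var l + expo_var l)" by simp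
  then have "{i, j} = {l}" by (simp only: keys_expo_add) auto
  then show "i = l \<and> j = l" by auto
qed auto

lemma ev_quadratic: "ev (mps_var i * mps_var j) = (if i = j \<and> n \<le> i \<and> i < m then 2 else 0)"
proof -
  have "Poly_Mapping.lookup F (expo_var i + expo_var j) = 0"
    by (rule F_lookup_low) (simp add: total_degree_add)
  then show ?thesis
    by (auto simp: mps_var_def mps_monom_mult dual_eval_monom lookup_G expo_pair_eq efact_square)
qed

lemma ev_linear: "ev (mps_var i) = 0"
proof -
  have "expo_var i \<noteq> expo_var l + expo_var l" for l
  proof
    assume "expo_var i = expo_var l + expo_var l"
    from arg_cong[OF this, of total_degree] show False by (simp add: total_degree_add)
  qed
  moreover have "Poly_Mapping.lookup F (expo_var i) = 0" by (rule F_lookup_low) simp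
  ultimately show ?thesis by (simp add: mps_var_def dual_eval_monom lookup_G)
qed

lemma ev_1: "ev 1 = 0"
proof -
  have "0 \<noteq> expo_var l + expo_var l" for l
  proof
    assume "0 = expo_var l + expo_var l"
    from arg_cong[OF this, of total_degree] show False by (simp add: total_degree_add)
  qed
  moreover have "Poly_Mapping.lookup F 0 = 0" by (rule F_lookup_low) simp
  ultimately have "ev (mps_monom 1 0) = 0" by (simp add: dual_eval_monom lookup_G)
  then show ?thesis by (simp only: mps_monom_1_0)
qed

lemma ev_order_4: "f \<in> order_ideal m 4 \<Longrightarrow> ev f = 0"
  using G_mpolys G_degree unfolding dual_eval_def
  by (intro sum.neutral) (auto simp: order_ideal_def expos_def mpolys_def)

lemma annihI:
  assumes "\<And>b. b \<in> expos m 4 \<Longrightarrow> ev (mps_monom 1 b * f) = 0"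
  shows "f \<in> annih G"
  unfolding annih_iff
proof
  fix b
  show "ev (mps_monom 1 b * f) = 0"
  proof (cases "b \<in> expos m 4")
    case False
    have "coeff_mps (mps_monom 1 b * f) a = 0" if "a \<in> Poly_Mapping.keys G" for a
    proof -
      have "a \<in> expos m 4" using that G_mpolys G_degree by (auto simp: expos_def mpolys_def)
      then have "\<nexists>d. a = b + d" using False expos_addD by blast
      then show ?thesis by (simp add: coeff_mps_monom_mult)
    qed
    then show ?thesis unfolding dual_eval_def by (intro sum.neutral) auto
  qed (rule assms)
qed

lemma annih_ev: "f \<in> annih G \<Longrightarrow> ev (g * f) = 0"
  by (simp add: annih_def)

lemma annih_ev': "f \<in> annih G \<Longrightarrow> ev f = 0"
  using annih_ev[of f 1] by simp

lemma order_4_annih: "order_ideal m 4 \<subseteq> annih G"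
  using order_ideal_mult[of _ m 0 _ 4 4] ev_order_4
  by (auto simp: annih_def order_ideal_0)

text \<open>A variable with index at least \<open>n\<close> enters \<open>G\<close> at most through
  its square, so the value depends only on a linear coefficient of \<open>f\<close>, and this is
  zero.\<close>

lemma ev_var_order_2:
  assumes "f \<in> order_ideal m 2" "n \<le> k"
  shows "ev (mps_var k * f) = 0"
  unfolding dual_eval_def
proof (intro sum.neutral ballI)
  fix a assume "a \<in> Poly_Mapping.keys G"
  then have "coeff_mps (mps_var k * f) a = 0"
  proof (cases rule: keys_G_cases)
    case 1
    then have "\<nexists>d. a = expo_var k + d" using assms(2) by (auto simp: keys_expo_add)
    then show ?thesis by (simp add: mps_var_def coeff_mps_monom_mult)
  next
    case (2 i)
    have "coeff_mps f (expo_var i) = 0" using assms(1) 2 by (simp add: order_ideal_def expos_def)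
    moreover have "i = k" if "expo_var i + expo_var i = expo_var k + d" for d
    proof -
      have "k \<in> Poly_Mapping.keys (expo_var k + d)" by (simp add: keys_expo_add)
      then show ?thesis unfolding that[symmetric] by (simp add: keys_expo_add)
    qed
    ultimately show ?thesis
      by (cases "i = k") (auto simp: mps_var_def coeff_mps_monom_mult 2(3))
  qed
  then show "coeff_mps (mps_var k * f) a * (efact a * Poly_Mapping.lookup G a) = 0" by simp
qed

text \<open>With \<open>n \<ge> 1\<close>, non-degeneracy gives a nonzero third derivative of
  \<open>F\<close>, which is the value of \<open>ev\<close> on a product of three variables;
  rescaling makes it 1.\<close>

lemma top_exists: "\<exists>t\<in>order_ideal m 3. ev t = 1"
proof -
  have "\<exists>i j k. polar F k i j \<noteq> 0"
  proof (rule ccontr)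
    assume "\<not> ?thesis"
    then have "(1 :: 'k) = 0" using F_nondeg[of "\<lambda>_. 1" 0] n_pos by simp
    then show False by simp
  qed
  then obtain i j k where p: "polar F k i j \<noteq> 0" by blast
  let ?t = "mps_var k * (mps_var i * mps_var j) :: 'k mps"
  have "?t \<in> order_ideal m 3"
    using mps_var_order by (intro order_ideal_mult[of _ m 1 _ 2] order_ideal_mult[of _ m 1 _ 1]) auto
  then have "mps_const (inverse (polar F k i j)) * ?t \<in> order_ideal m 3"
    by (rule mps.vs.subspace_scale[OF order_ideal_subspace])
  moreover have "ev (mps_const (inverse (polar F k i j)) * ?t) = 1"
    using p by (simp only: ev_simps ev_cubic) simp
  ultimately show ?thesis by blast
qed

text \<open>The coefficients of an annihilating \<open>f\<close> vanish in turn. Multiplication with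
  a cubic element isolates the constant one. Products \<open>x_i x_j\<close> then give a relation
  among derivatives of \<open>F\<close>, so the first \<open>n\<close> linear ones vanish by
  non-degeneracy. Finally \<open>x_k\<close> with \<open>n \<le> k\<close> isolates its own
  coefficient through the square in \<open>G\<close>.\<close>

lemma annih_order_2: "annih G \<subseteq> order_ideal m 2"
proof
  fix f assume f: "f \<in> annih G"
  obtain t where t: "t \<in> order_ideal m 3" "ev t = 1" using top_exists by blast
  have "f - mps_const (coeff_mps f 0) \<in> order_ideal m 1"
    unfolding order_ideal_1 mps_max_def by (simp add: coeff_mps_const)
  then have "ev (t * (f - mps_const (coeff_mps f 0))) = 0"
    by (intro ev_order_4 order_ideal_mult[OF t(1)]) auto
  moreover have "t * (f - mps_const (coeff_mps f 0)) = t * f - mps_const (coeff_mps f 0) * t"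
    by (simp add: algebra_simps)
  ultimately have "coeff_mps f 0 = 0" using t(2) annih_ev[OF f, of t] by (simp add: ev_simps)
  then have f1: "f \<in> order_ideal m 1" unfolding order_ideal_1 mps_max_def by simp
  define f2 where "f2 = f - (\<Sum>k<m. mps_const (coeff_mps f (expo_var k)) * mps_var k)"
  have f2: "f2 \<in> order_ideal m 2" unfolding f2_def by (rule order_ideal_linear_part[OF f1])
  have gf: "ev (g * f2) = - (\<Sum>k<m. coeff_mps f (expo_var k) * ev (mps_var k * g))" for g
  proof -
    have "g * f2 = g * f - (\<Sum>k<m. mps_const (coeff_mps f (expo_var k)) * (mps_var k * g))"
      by (simp add: f2_def right_diff_distrib sum_distrib_left ac_simps)
    then show ?thesis using annih_ev[OF f, of g] by (simp only: ev_simps) simp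
  qed
  have low: "coeff_mps f (expo_var k) = 0" if "k < n" for k
  proof (rule F_nondeg[OF _ that])
    fix i j assume ij: "i < n" "j < n"
    have "mps_var i * mps_var j * f2 \<in> order_ideal m 4"
      using f2 mps_var_order by (intro order_ideal_mult[of _ m 2 _ 2] order_ideal_mult[of _ m 1 _ 1]) auto
    then have "(\<Sum>k<m. coeff_mps f (expo_var k) * polar F k i j) = 0"
      using gf[of "mps_var i * mps_var j"] ev_order_4 by (simp add: ev_cubic)
    moreover have "(\<Sum>k<m. coeff_mps f (expo_var k) * polar F k i j) =
        (\<Sum>k<n. coeff_mps f (expo_var k) * polar F k i j)"
      using n_le by (intro sum.mono_neutral_right) (auto simp: polar_outside)
    ultimately show "(\<Sum>k<n. coeff_mps f (expo_var k) * polar F k i j) = 0" by simp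
  qed
  have high: "coeff_mps f (expo_var k) = 0" if "n \<le> k" "k < m" for k
  proof -
    have "(\<Sum>j<m. coeff_mps f (expo_var j) * ev (mps_var j * mps_var k)) = 0"
      using gf[of "mps_var k"] ev_var_order_2[OF f2 that(1)] by simp
    also have "(\<Sum>j<m. coeff_mps f (expo_var j) * ev (mps_var j * mps_var k)) =
        (\<Sum>j<m. if j = k then 2 * coeff_mps f (expo_var k) else 0)"
      using that by (intro sum.cong) (auto simp: ev_quadratic)
    finally show ?thesis using that by simp
  qed
  have "(\<Sum>k<m. mps_const (coeff_mps f (expo_var k)) * mps_var k) = 0"
    using low high by (intro sum.neutral) (metis lessThan_iff mps.s_0 mult_zero_left not_le)
  then show "f \<in> order_ideal m 2" using f2 by (simp add: f2_def)
qed

lemma ev_separates_order_3: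
  assumes "f \<in> order_ideal m 3" "ev f = 0"
  shows "f \<in> annih G"
proof (rule annihI)
  fix b
  show "ev (mps_monom 1 b * f) = 0"
  proof (cases "b = 0")
    case True
    with assms show ?thesis by (simp add: mps_monom_1_0)
  next
    case False
    then have "1 \<le> total_degree b" by (simp add: Suc_le_eq neq0_conv[symmetric] del: neq0_conv)
    then show ?thesis
      by (intro ev_order_4 order_ideal_mult[OF order_ideal_monom assms(1)]) auto
  qed
qed

text \<open>A multiple of the top element with the same value under \<open>ev\<close> is subtracted.
  The difference is orthogonal to 1 by construction, to the first \<open>n\<close> variables by
  assumption, to the other ones because of the shape of \<open>G\<close>, and to everything of
  degree at least 2 by order.\<close>

lemma ev_separates_order_2:
  assumes f: "f \<in> order_ideal m 2" "\<And>k. k < n \<Longrightarrow> ev (mps_var k * f) = 0"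
  shows "\<exists>g\<in>order_ideal m 3. f - g \<in> annih G"
proof -
  obtain t where t: "t \<in> order_ideal m 3" "ev t = 1" using top_exists by blast
  define g where "g = mps_const (ev f) * t"
  have g: "g \<in> order_ideal m 3" unfolding g_def by (rule mps.vs.subspace_scale[OF order_ideal_subspace t(1)])
  have h2: "f - g \<in> order_ideal m 2"
    using f(1) g order_ideal_antimono[of 2 3 m] by (intro mps.vs.subspace_diff[OF order_ideal_subspace]) auto
  have "f - g \<in> annih G"
  proof (rule annihI)
    fix b assume b: "b \<in> expos m 4"
    consider "total_degree b = 0" | "total_degree b = Suc 0" | "2 \<le> total_degree b" by linarith
    then show "ev (mps_monom 1 b * (f - g)) = 0"
    proof cases
      case 1
      with t show ?thesis by (simp add: g_def ev_simps mps_monom_1_0)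
    next
      case 2
      then obtain k d where k: "b = expo_var k + d" "total_degree d = 0" "k \<in> Poly_Mapping.keys b"
        by (rule expo_Suc_cases)
      then have bk: "mps_monom 1 b = (mps_var k :: 'k mps)" by (simp add: mps_var_def)
      have "ev (mps_var k * g) = 0" using mps_var_order g
        by (intro ev_order_4 order_ideal_mult[of _ m 1 _ 3]) auto
      moreover have "ev (mps_var k * f) = 0" using f ev_var_order_2[of f k] by (cases "k < n") auto
      ultimately show ?thesis by (simp add: bk right_diff_distrib ev_simps)
    next
      case 3
      then show ?thesis by (intro ev_order_4 order_ideal_mult[OF order_ideal_monom h2]) auto
    qed
  qed
  with g show ?thesis by blast
qed

section \<open>The algebra of \<open>F\<close> and the powers of its maximal ideal\<close>

definition e :: "'k mps \<Rightarrow> 'k mpser set" where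
  "e f = annihilator m G +>\<^bsub>pser_alg m\<^esub> mps_restrict m f"

lemma annihilator_proper: "annihilator m G \<noteq> carrier (pser_alg m)"
proof -
  have "mps_restrict m 1 \<notin> annihilator m G"
  proof
    assume "mps_restrict m 1 \<in> annihilator m G"
    then have "1 \<in> annih G" using annih_restrict[OF G_mpolys, of 1] by (simp add: annihilator_def annih_act)
    then have "coeff_mps (1 :: 'k mps) 0 = 0" using annih_order_2 by (force simp: order_ideal_def expos_def)
    then show False by (simp add: coeff_mps_1)
  qed
  moreover have "mps_restrict m (1 :: 'k mps) \<in> carrier (pser_alg m)"
    using presentation.e_carrier[OF presentation_pser_alg] by blast
  ultimately show ?thesis by metis
qed

sublocale A: local_presentation "mps_const :: 'k \<Rightarrow> 'k mps" "cubic_alg m n F" e mps_max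
  unfolding cubic_alg_eq inv_sys_alg_def e_def[abs_def]
  by (intro local_presentation_quot ideal_annihilator G_mpolys annihilator_proper)

lemma ker_eq: "A.ker = annih G"
  using inv_sys_presentation(2)[OF G_mpolys] unfolding cubic_alg_eq e_def[abs_def] .

text \<open>Modulo the annihilator a series is a finite sum of monomials of degree below 4. If the
  order is at least \<open>Suc i\<close>, each monomial that occurs is a variable times a monomial
  of degree at least \<open>i\<close>, so induction applies.\<close>

lemma order_ideal_Q: "order_ideal m i \<subseteq> A.Q i"
proof (induction i)
  case (Suc i)
  show ?case
  proof
    fix f :: "'k mps" assume f: "f \<in> order_ideal m (Suc i)"
    have "mps_const (coeff_mps f b) * mps_monom 1 b \<in> A.Q (Suc i)" if b: "b \<in> expos m 4" for b
    proof (cases "total_degree b < Suc i")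
      case True
      then have "coeff_mps f b = 0" using f b by (simp add: order_ideal_def expos_def)
      then show ?thesis using mps.vs.subspace_0[OF A.Q_subspace] by simp
    next
      case False
      then obtain d where "total_degree b = Suc d" by (cases "total_degree b") auto
      then obtain k c where k: "b = expo_var k + c" "total_degree c = d" by (rule expo_Suc_cases)
      have "mps_monom 1 c \<in> A.Q i" using Suc order_ideal_monom[of i c 1 m] False k by (auto simp: total_degree_add)
      moreover have "mps_var k \<in> mps_max" using mps_var_order order_ideal_1 by blast
      ultimately have "mps_var k * mps_monom 1 c \<in> A.Q (Suc i)" by (intro A.M_Q_prod)
      then show ?thesis unfolding k(1)
        by (intro mps.vs.subspace_scale[OF A.Q_subspace]) (simp add: mps_var_def mps_monom_mult)
    qed
    then have "(\<Sum>b\<in>expos m 4. mps_const (coeff_mps f b) * mps_monom 1 b) \<in> A.Q (Suc i)"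
      by (rule mps.vs.subspace_sum[OF A.Q_subspace])
    moreover have "f - (\<Sum>b\<in>expos m 4. mps_const (coeff_mps f b) * mps_monom 1 b) \<in> A.Q (Suc i)"
      using order_ideal_expand[of f m 4] order_4_annih A.ker_Q[of "Suc i"] ker_eq by blast
    ultimately show "f \<in> A.Q (Suc i)" using mps.vs.subspace_add[OF A.Q_subspace] by fastforce
  qed
qed (simp add: A.Q_zero)

lemma Q_eq: "A.Q i = {f + g | f g. f \<in> order_ideal m i \<and> g \<in> annih G}" (is "_ = ?T i")
proof
  show "?T i \<subseteq> A.Q i"
    using order_ideal_Q A.ker_Q[of i] mps.vs.subspace_add[OF A.Q_subspace] unfolding ker_eq by blast
  show "A.Q i \<subseteq> ?T i"
  proof (induction i)
    case 0
    show ?case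
    proof
      fix x :: "'k mps"
      show "x \<in> ?T 0" using mps.vs.subspace_0[OF annih_subspace]
        by (intro in_plusI[of x _ 0]) (auto simp: order_ideal_0)
    qed
  next
    case (Suc i)
    show ?case
    proof (rule A.Q_Suc_induct)
      show "mps.vs.subspace (?T (Suc i))"
        by (intro mps.vs.subspace_sums order_ideal_subspace annih_subspace)
      show "A.ker \<subseteq> ?T (Suc i)" unfolding ker_eq
        using mps.vs.subspace_0[OF order_ideal_subspace[of m "Suc i"]] by force
      fix x y :: "'k mps" assume x: "x \<in> mps_max" and "y \<in> A.Q i"
      with Suc obtain f g where fg: "y = f + g" "f \<in> order_ideal m i" "g \<in> annih G" by blast
      have "x * f \<in> order_ideal m (Suc i)"
        using x fg(2) by (intro order_ideal_mult[of _ m 1 _ i]) (auto simp: order_ideal_1[simplified])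
      moreover have "x * g \<in> annih G" using annih_mult[OF fg(3), of x] by (simp add: mult.commute)
      ultimately show "x * y \<in> ?T (Suc i)" unfolding fg(1) distrib_left by blast
    qed
  qed
qed

lemma Q_low: "i \<le> 2 \<Longrightarrow> A.Q i = order_ideal m i"
proof
  assume "i \<le> 2"
  then have "annih G \<subseteq> order_ideal m i" using annih_order_2 order_ideal_antimono by blast
  then show "A.Q i \<subseteq> order_ideal m i"
    unfolding Q_eq using mps.vs.subspace_add[OF order_ideal_subspace] by blast
qed (rule order_ideal_Q)

lemma Q_high: "4 \<le> i \<Longrightarrow> A.Q i = annih G"
proof
  assume "4 \<le> i"
  then have "order_ideal m i \<subseteq> annih G" using order_4_annih order_ideal_antimono by blast
  then show "A.Q i \<subseteq> annih G"
    unfolding Q_eq using mps.vs.subspace_add[OF annih_subspace] by blast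
qed (use A.ker_Q ker_eq in simp)

lemma Q_3_ev: "f \<in> A.Q 3 \<Longrightarrow> x \<in> mps_max \<Longrightarrow> ev (f * x) = 0"
proof -
  assume "f \<in> A.Q 3" and x: "x \<in> mps_max"
  then obtain g h where f: "f = g + h" "g \<in> order_ideal m 3" "h \<in> annih G" unfolding Q_eq by blast
  have "ev (g * x) = 0" using f(2) x
    by (intro ev_order_4 order_ideal_mult[of _ m 3 _ 1]) (auto simp: order_ideal_1[simplified])
  moreover have "ev (h * x) = 0" by (rule annih_ev'[OF annih_mult[OF f(3)]])
  ultimately show "ev (f * x) = 0" by (simp add: f(1) distrib_right ev_simps)
qed

lemma Q_3_separates: "f \<in> A.Q 3 \<Longrightarrow> ev f = 0 \<Longrightarrow> f \<in> annih G"
proof -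
  assume "f \<in> A.Q 3" and f0: "ev f = 0"
  then obtain g h where f: "f = g + h" "g \<in> order_ideal m 3" "h \<in> annih G" unfolding Q_eq by blast
  have "ev g = 0" using f0 annih_ev'[OF f(3)] by (simp add: f(1) ev_simps)
  from mps.vs.subspace_add[OF annih_subspace ev_separates_order_3[OF f(2) this] f(3)]
  show "f \<in> annih G" by (simp add: f(1))
qed

text \<open>Each graded piece has explicit coordinates for \<open>reldimI\<close>: the constant
  coefficient, the linear coefficients, the pairings with the first \<open>n\<close> variables, and
  \<open>ev\<close> itself.\<close>

lemma hilbert_function: "has_hilbert_function (cubic_alg m n F) (\<lambda>i. if i < 4 then [1, m, n, 1] ! i else 0)"
  unfolding A.hilbert_function_iff
proof
  fix i :: nat
  have lin0: "mps.linfun (\<lambda>f :: 'k mps. coeff_mps f a)" for a by (simp add: mps.linfun_def)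
  have var_max: "mps_var k \<in> mps_max" for k using mps_var_order order_ideal_1 by blast
  obtain t where t: "t \<in> order_ideal m 3" "ev t = 1" using top_exists by blast
  consider "i = 0" | "i = 1" | "i = 2" | "i = 3" | "4 \<le> i" by linarith
  then show "mps.reldim (if i < 4 then [1, m, n, 1] ! i else 0) (A.Q i) (A.Q (Suc i))"
  proof cases
    case 1
    have "mps.reldim 1 (A.Q 0) (A.Q 1)" unfolding A.Q_zero A.Q_1
      by (rule mps.reldimI[of _ "\<lambda>_. 1" _ "\<lambda>_ f. coeff_mps f 0"])
        (auto simp: lin0 coeff_mps_1 mps_max_def mps.vs.subspace_UNIV)
    with 1 show ?thesis by simp
  next
    case 2
    have "mps.reldim m (order_ideal m 1 :: 'k mps set) (order_ideal m 2)"
    proof (rule mps.reldimI[of _ "mps_var" _ "\<lambda>k f. coeff_mps f (expo_var k)"])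
      show "coeff_mps (mps_var j :: 'k mps) (expo_var k) = (if j = k then 1 else 0)" for j k
        by (auto simp: mps_var_def coeff_mps_monom)
      show "coeff_mps x (expo_var k) = 0" if "x \<in> order_ideal m 2" "k < m" for x :: "'k mps" and k
        using that by (simp add: order_ideal_def expos_def)
      fix f :: "'k mps" assume "f \<in> order_ideal m 1" "\<And>k. k < m \<Longrightarrow> coeff_mps f (expo_var k) = 0"
      with order_ideal_linear_part[of f m] show "f \<in> order_ideal m 2" by simp
    qed (auto simp: lin0 mps_var_order[simplified] order_ideal_subspace)
    with 2 show ?thesis using Q_low[of 1] Q_low[of 2] by (simp add: numeral_2_eq_2)
  next
    case 3
    \<comment> \<open>Multiplication by a variable with index below \<open>n\<close>, followed by
      \<open>ev\<close>, gives a coordinate on degree 2. These functionals are independent because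
      evaluating a relation on products of two variables contradicts the non-degeneracy of
      \<open>F\<close>.\<close>
    have lin: "mps.linfun (\<lambda>f. ev (f * mps_var k))" for k by (rule mps.linfun_times[OF linfun_dual_eval])
    have "\<exists>u. \<forall>i<n. u i \<in> order_ideal m 2 \<and> (\<forall>j<n. ev (u i * mps_var j) = (if i = j then 1 else 0))"
    proof (rule mps.dual_vectors[OF order_ideal_subspace lin])
      fix c assume c: "\<And>z. z \<in> order_ideal m 2 \<Longrightarrow> (\<Sum>j<n. c j * ev (z * mps_var j)) = 0"
      show "\<forall>j<n. c j = 0"
      proof (intro allI impI)
        fix k assume "k < n"
        show "c k = 0"
        proof (rule F_nondeg[OF _ \<open>k < n\<close>])
          fix i j
          have "mps_var i * mps_var j \<in> (order_ideal m 2 :: 'k mps set)"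
            using mps_var_order by (intro order_ideal_mult[of _ m 1 _ 1]) auto
          from c[OF this] show "(\<Sum>k<n. c k * polar F k i j) = 0"
            by (simp add: mult.commute[of "_ * _" "mps_var _"] ev_cubic)
        qed
      qed
    qed
    then obtain u where u: "\<And>i. i < n \<Longrightarrow> u i \<in> order_ideal m 2"
      "\<And>i j. i < n \<Longrightarrow> j < n \<Longrightarrow> ev (u i * mps_var j) = (if i = j then 1 else 0)" by blast
    have "mps.reldim n (order_ideal m 2) (A.Q 3)"
    proof (rule mps.reldimI[of _ u _ "\<lambda>k f. ev (f * mps_var k)"])
      show "ev (x * mps_var k) = 0" if "x \<in> A.Q 3" for x k by (rule Q_3_ev[OF that var_max])
      fix f assume f: "f \<in> order_ideal m 2" "\<And>k. k < n \<Longrightarrow> ev (f * mps_var k) = 0"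
      then obtain g where "g \<in> order_ideal m 3" "f - g \<in> annih G"
        using ev_separates_order_2[of f] by (auto simp: mult.commute)
      moreover have "f = g + (f - g)" by simp
      ultimately show "f \<in> A.Q 3" unfolding Q_eq by blast
    qed (use u lin order_ideal_subspace in auto)
    with 3 Q_low[of 2] show ?thesis by simp
  next
    case 4
    have "mps.reldim 1 (A.Q 3) (A.Q 4)"
    proof (rule mps.reldimI[of _ "\<lambda>_. t" _ "\<lambda>_. ev"])
      show "ev x = 0" if "x \<in> A.Q 4" for x using that annih_ev' by (simp add: Q_high)
      show "x \<in> A.Q 4" if "x \<in> A.Q 3" "\<And>k. k < (1::nat) \<Longrightarrow> ev x = 0" for x
        using Q_3_separates[OF that(1)] that(2)[of 0] by (simp add: Q_high)
    qed (use t order_ideal_Q linfun_dual_eval A.Q_subspace in auto)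
    with 4 show ?thesis by simp
  next
    case 5
    then show ?thesis
      by (auto simp: Q_high mps.reldim_def mps.spans_mod_def mps.indep_mod_def)
  qed
qed

text \<open>A socle element is killed by every monomial except 1, so the single value of
  \<open>ev\<close> on it decides whether it is in the annihilator.\<close>

lemma gorenstein_cubic: "gorenstein (cubic_alg m n F)"
  unfolding A.gorenstein_iff ker_eq
proof -
  obtain t where t: "t \<in> order_ideal m 3" "ev t = 1" using top_exists by blast
  let ?S = "{x. \<forall>y\<in>mps_max. x * y \<in> annih G}"
  have sub: "mps.vs.subspace ?S" unfolding mps.vs.subspace_def
    by (auto simp: distrib_right mult.assoc intro!: mps.vs.subspace_0[OF annih_subspace]
        mps.vs.subspace_add[OF annih_subspace] mps.vs.subspace_scale[OF annih_subspace])
  show "mps.reldim 1 ?S (annih G)"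
  proof (rule mps.reldimI[of _ "\<lambda>_. t" _ "\<lambda>_. ev"])
    show "t \<in> ?S" 
    proof (intro CollectI ballI)
      fix y :: "'k mps" assume "y \<in> mps_max"
      then have "t * y \<in> order_ideal m 4" using t(1)
        by (intro order_ideal_mult[of _ m 3 _ 1]) (auto simp: order_ideal_1[simplified])
      then show "t * y \<in> annih G" using order_4_annih by blast
    qed
    fix f assume f: "f \<in> ?S" "\<And>k. k < (1::nat) \<Longrightarrow> ev f = 0"
    show "f \<in> annih G"
    proof (rule annihI)
      fix b
      show "ev (mps_monom 1 b * f) = 0"
      proof (cases "b = 0")
        case True
        with f(2)[of 0] show ?thesis by (simp add: mps_monom_1_0)
      next
        case False
        then have "mps_monom (1 :: 'k) b \<in> mps_max" by (simp add: mps_max_def coeff_mps_monom)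
        with f(1) have "f * mps_monom 1 b \<in> annih G" by blast
        from annih_ev'[OF this] show ?thesis by (simp only: mult.commute)
      qed
    qed
  qed (use t linfun_dual_eval annih_ev' sub in auto)
qed

lemma finite_length_cubic: "finite_length (cubic_alg m n F)"
proof -
  let ?E = "expos m 4"
  obtain h where h: "bij_betw h {..<card ?E} ?E"
    using ex_bij_betw_nat_finite[OF finite_expos] by (auto simp: lessThan_atLeast0)
  have "mps.spans_mod A.ker (card ?E) (\<lambda>j. mps_monom 1 (h j)) UNIV"
    unfolding mps.spans_mod_def ker_eq
  proof
    fix f :: "'k mps"
    have "(\<Sum>j<card ?E. mps_const (coeff_mps f (h j)) * mps_monom 1 (h j)) =
        (\<Sum>b\<in>?E. mps_const (coeff_mps f b) * mps_monom 1 b)"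
      by (rule sum.reindex_bij_betw[OF h])
    then have "f - (\<Sum>j<card ?E. mps_const (coeff_mps f (h j)) * mps_monom 1 (h j)) \<in> annih G"
      using order_ideal_expand[of f m 4] order_4_annih by auto
    then show "\<exists>c. f - (\<Sum>j<card ?E. mps_const (c j) * mps_monom 1 (h j)) \<in> annih G"
      by (rule exI[of _ "\<lambda>j. coeff_mps f (h j)"])
  qed
  then show ?thesis by (rule A.finite_length_spans)
qed

theorem cubic_alg_gor: "cubic_alg m n F \<in> gor_algs m n"
proof -
  have "cubic_alg m n F \<in> artin_local_algs"
    using finite_length_cubic ideal_annihilator[OF G_mpolys] annihilator_proper
    unfolding artin_local_algs_def cubic_alg_eq inv_sys_alg_def by blast
  then show ?thesis using gorenstein_cubic hilbert_function by (simp add: gor_algs_def)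
qed

end

section \<open>Classification\<close>

lemma invertible_matI_kernel:
  fixes M :: "'k::field mat"
  assumes M: "M \<in> carrier_mat n n"
    and ker: "\<And>v. (\<And>a. a < n \<Longrightarrow> (\<Sum>i<n. M $$ (a, i) * v i) = 0) \<Longrightarrow> \<forall>i<n. v i = 0"
  shows "invertible_mat M"
proof -
  have "det M \<noteq> 0"
  proof
    assume "det M = 0"
    then obtain v where v: "v \<in> carrier_vec n" "v \<noteq> 0\<^sub>v n" "M *\<^sub>v v = 0\<^sub>v n"
      using det_0_iff_vec_prod_zero_field[OF M] by blast
    have "\<forall>i<n. v $ i = 0"
    proof (rule ker)
      fix a assume "a < n"
      then have "(\<Sum>i<n. M $$ (a, i) * v $ i) = (M *\<^sub>v v) $ a"
        using M v(1) by (simp add: scalar_prod_def lessThan_atLeast0)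
      then show "(\<Sum>i<n. M $$ (a, i) * v $ i) = 0" using v(3) \<open>a < n\<close> by simp
    qed
    then have "v = 0\<^sub>v n" using v(1) by (intro eq_vecI) auto
    with v(2) show False by simp
  qed
  then have "M \<in> Units (ring_mat TYPE('k) n undefined)" by (rule det_non_zero_imp_unit[OF M])
  then show ?thesis using M
    by (auto simp: Units_def ring_mat_def invertible_mat_def inverts_mat_def square_mat.simps)
qed

lemma invertible_mat_inverse:
  fixes M :: "'k::field mat"
  assumes M: "M \<in> carrier_mat n n" "invertible_mat M"
  obtains N where "\<And>a k. a < n \<Longrightarrow> k < n \<Longrightarrow> (\<Sum>i<n. M $$ (a, i) * N i k) = (if a = k then 1 else 0)"
proof -
  obtain B where B: "M * B = 1\<^sub>m n" "B * M = 1\<^sub>m (dim_row B)"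
    using M unfolding invertible_mat_def inverts_mat_def by auto
  have "dim_col B = n" using arg_cong[OF B(1), of dim_col] by simp
  moreover have "dim_row B = n" using arg_cong[OF B(2), of dim_col] M by simp
  ultimately have "(\<Sum>i<n. M $$ (a, i) * B $$ (i, k)) = (if a = k then 1 else 0)" if "a < n" "k < n" for a k
  proof -
    have "(\<Sum>i<n. M $$ (a, i) * B $$ (i, k)) = (M * B) $$ (a, k)"
      using M that \<open>dim_col B = n\<close> \<open>dim_row B = n\<close> by (simp add: scalar_prod_def lessThan_atLeast0)
    then show ?thesis using that by (simp add: B(1))
  qed
  then show thesis by (rule that)
qed

lemma alg_iso_refl:
  assumes "presentation s A e"
  shows "alg_iso A A"
  using presentation_iso[OF assms assms] by simp

lemma alg_iso_sym:
  assumes "presentation s A e" and iso: "alg_iso A B"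
  shows "alg_iso B A"
proof -
  interpret A: presentation s A e by fact
  obtain h where h: "h \<in> ring_iso A B" "\<And>c a. a \<in> carrier A \<Longrightarrow> h (c \<odot>\<^bsub>A\<^esub> a) = c \<odot>\<^bsub>B\<^esub> h a"
    using iso unfolding alg_iso_def by blast
  have bij: "bij_betw h (carrier A) (carrier B)" using h(1) by (simp add: ring_iso_def)
  let ?g = "inv_into (carrier A) h"
  have "?g \<in> ring_iso B A" by (rule ring_iso_set_sym[OF A.A.ring_axioms h(1)])
  moreover have "?g (c \<odot>\<^bsub>B\<^esub> b) = c \<odot>\<^bsub>A\<^esub> ?g b" if b: "b \<in> carrier B" for c b
  proof -
    have gb: "?g b \<in> carrier A" "h (?g b) = b"
      using bij b by (auto simp: bij_betw_def inv_into_into f_inv_into_f)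
    then obtain x where "?g b = e x" by (auto simp: A.e_surj)
    then have "c \<odot>\<^bsub>A\<^esub> ?g b \<in> carrier A" by (simp flip: A.e_scale)
    then have "?g (h (c \<odot>\<^bsub>A\<^esub> ?g b)) = c \<odot>\<^bsub>A\<^esub> ?g b"
      using bij by (auto simp: bij_betw_def)
    with h(2)[OF gb(1), of c] gb(2) show ?thesis by simp
  qed
  ultimately show ?thesis unfolding alg_iso_def by blast
qed

lemma alg_iso_trans:
  assumes "alg_iso A B" "alg_iso B C"
  shows "alg_iso A C"
proof -
  obtain h where h: "h \<in> ring_iso A B" "\<And>c a. a \<in> carrier A \<Longrightarrow> h (c \<odot>\<^bsub>A\<^esub> a) = c \<odot>\<^bsub>B\<^esub> h a"
    using assms(1) unfolding alg_iso_def by blast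
  obtain g where g: "g \<in> ring_iso B C" "\<And>c a. a \<in> carrier B \<Longrightarrow> g (c \<odot>\<^bsub>B\<^esub> a) = c \<odot>\<^bsub>C\<^esub> g a"
    using assms(2) unfolding alg_iso_def by blast
  have "h a \<in> carrier B" if "a \<in> carrier A" for a
    using h(1) that by (auto simp: ring_iso_def bij_betw_def)
  with h(2) g(2) ring_iso_set_trans[OF h(1) g(1)] show ?thesis
    unfolding alg_iso_def by (intro bexI[of _ "g \<circ> h"]) auto
qed

lemma gor_algs_local_presentation:
  assumes "A \<in> gor_algs m n"
  obtains e where "local_presentation (mps_const :: 'k::field \<Rightarrow> 'k mps) A e mps_max"
proof -
  from assms obtain r I where "ideal I (pser_alg r :: ('k, 'k mpser) module)"
      "I \<noteq> carrier (pser_alg r :: ('k, 'k mpser) module)" "A = quot_alg (pser_alg r) I"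
    by (auto simp: gor_algs_def artin_local_algs_def)
  with local_presentation_quot that show thesis by blast
qed

lemma equiv_gor_iso: "equiv (gor_algs m n :: ('k::field, 'k mpser set) module set) (gor_iso m n)"
proof (rule equivI)
  have pres: "\<exists>e. presentation (mps_const :: 'k \<Rightarrow> 'k mps) A e" if "A \<in> gor_algs m n"
    for A :: "('k, 'k mpser set) module"
    using that by (metis gor_algs_local_presentation local_presentation.axioms(1))
  show "refl_on (gor_algs m n :: ('k, 'k mpser set) module set) (gor_iso m n)"
    unfolding refl_on_def
  proof
    fix A :: "('k, 'k mpser set) module" assume A: "A \<in> gor_algs m n"
    then obtain e where "presentation (mps_const :: 'k \<Rightarrow> 'k mps) A e" using pres by blast
    then have "alg_iso A A" by (rule alg_iso_refl)
    with A show "(A, A) \<in> gor_iso m n" by (simp add: gor_iso_def)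
  qed
  show "sym (gor_iso m n :: (('k, 'k mpser set) module \<times> _) set)"
  proof (rule symI)
    fix A B :: "('k, 'k mpser set) module" assume "(A, B) \<in> gor_iso m n"
    then have AB: "A \<in> gor_algs m n" "B \<in> gor_algs m n" "alg_iso A B" by (simp_all add: gor_iso_def)
    then obtain e where "presentation (mps_const :: 'k \<Rightarrow> 'k mps) A e" using pres by blast
    then have "alg_iso B A" using AB(3) by (rule alg_iso_sym)
    with AB show "(B, A) \<in> gor_iso m n" by (simp add: gor_iso_def)
  qed
  show "trans (gor_iso m n :: (('k, 'k mpser set) module \<times> _) set)"
    using alg_iso_trans unfolding trans_def gor_iso_def by blast
qed (auto simp: gor_iso_def)

section \<open>Recognising the algebra of a cubic\<close>

lemma expos_4_cases:
  assumes "a \<in> expos m 4"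
  obtains "a = 0" | i where "i < m" "a = expo_var i" | i j where "i < m" "j < m" "a = expo_var i + expo_var j"
  | i j k where "i < m" "j < m" "k < m" "a = expo_var i + (expo_var j + expo_var k)"
proof -
  have keys: "Poly_Mapping.keys a \<subseteq> {..<m}" using assms by (simp add: expos_def)
  have deg: "total_degree a < 4" using assms by (simp add: expos_def)
  show thesis
  proof (cases "total_degree a = 3")
    case True
    then show ?thesis using expo_degree_3[OF _ keys] that(4) by blast
  next
    case False
    show ?thesis
    proof (cases "total_degree a")
      case 0
      then show ?thesis using that(1) by simp
    next
      case (Suc d)
      then obtain i b where i: "a = expo_var i + b" "total_degree b = d" "i \<in> Poly_Mapping.keys a"
        "Poly_Mapping.keys b \<subseteq> Poly_Mapping.keys a" by (rule expo_Suc_cases)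
      show ?thesis
      proof (cases "total_degree b")
        case 0
        then show ?thesis using that(2)[of i] i keys by auto
      next
        case (Suc l)
        then obtain j c where j: "b = expo_var j + c" "total_degree c = l" "j \<in> Poly_Mapping.keys b"
          by (rule expo_Suc_cases)
        have "c = 0" using i j Suc deg False by (simp flip: total_degree_eq_0 add: total_degree_add)
        then show ?thesis using that(3)[of i j] i j keys by auto
      qed
    qed
  qed
qed

text \<open>The values of \<open>g\<close> on the monomials of degree 0 to 3 in the
  \<open>Z i\<close> are required to agree with those of \<open>dual_eval\<close> for
  \<open>F\<close> plus the squares; higher monomials lie in \<open>Q 4\<close>. The criterion is
  used for an arbitrary Gorenstein algebra and, with changed generators, for the algebra of a given
  cubic.\<close>

lemma (in gor_filtration) cubic_iso:
  assumes F: "F \<in> nondeg_cubics n" and n: "1 \<le> n" "n \<le> m"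
    and A: "presentation s A e" "presentation.ker A e = Q 4"
    and Z: "\<And>i. i < m \<Longrightarrow> Z i \<in> Q 1" "spans_mod (Q 2) m Z (Q 1)"
    and g: "linfun g" "\<And>x. x \<in> Q 4 \<Longrightarrow> g x = 0" "\<And>x. (\<And>y. g (x * y) = 0) \<Longrightarrow> x \<in> Q 4"
    and g1: "g 1 = 0" "\<And>i. i < m \<Longrightarrow> g (Z i) = 0"
    and g2: "\<And>i j. i < m \<Longrightarrow> j < m \<Longrightarrow> g (Z i * Z j) = (if i = j \<and> n \<le> i then 2 else 0)"
    and g3: "\<And>i j k. i < m \<Longrightarrow> j < m \<Longrightarrow> k < m \<Longrightarrow> g (Z i * (Z j * Z k)) = polar F i j k"
  shows "alg_iso (cubic_alg m n F) A"
proof -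
  interpret N: nondeg_cubic m n F using F n by unfold_locales
  have "g (monom_at Z a) = efact a * Poly_Mapping.lookup N.G a" if "a \<in> expos m 4" for a
  proof -
    have v: "monom_at Z (expo_var i) = Z i" for i using monom_at_var[of Z i] by simp
    have "g (monom_at Z a) = N.ev (mps_monom 1 a)"
      using that
    proof (cases rule: expos_4_cases)
      case 1
      then show ?thesis using g1 N.ev_1 by (simp add: mps_monom_1_0)
    next
      case (2 i)
      then show ?thesis using g1 N.ev_linear[of i] by (simp add: v mps_var_def)
    next
      case (3 i j)
      then show ?thesis using g2 N.ev_quadratic[of i j] by (simp add: v monom_at_add mps_var_def mps_monom_mult)
    next
      case (4 i j k)
      then show ?thesis using g3 N.ev_cubic[of i j k] by (simp add: v monom_at_add mps_var_def mps_monom_mult)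
    qed
    then show ?thesis by (simp add: dual_eval_monom)
  qed
  then show ?thesis unfolding N.cubic_alg_eq
    by (intro inv_sys_iso[OF A Z g N.G_mpolys N.G_degree])
qed

lemma gor_algs_cubic:
  fixes A :: "('k::{alg_closed_field, field_char_0}, 'k mpser set) module"
  assumes A: "A \<in> gor_algs m n" and n: "1 \<le> n"
  shows "\<exists>F\<in>nondeg_cubics n. alg_iso (cubic_alg m n F) A"
proof -
  obtain e where e: "local_presentation (mps_const :: 'k \<Rightarrow> 'k mps) A e mps_max"
    using A by (rule gor_algs_local_presentation)
  have fl: "finite_length A" "gorenstein A"
    "has_hilbert_function A (\<lambda>i. if i < 4 then [1, m, n, 1] ! i else 0)"
    using A by (auto simp: gor_algs_def artin_local_algs_def)
  note gf = local_gor_filtration[OF e fl]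
  interpret A: local_presentation "mps_const :: 'k \<Rightarrow> 'k mps" A e mps_max by (rule e)
  interpret Q: gor_filtration "mps_const :: 'k \<Rightarrow> 'k mps" A.Q m n by (rule gf(3))
  obtain f w z where fwz: "gor_dual_basis mps_const A.Q m n f w z" by (rule Q.gor_dual_basis_exists)
  interpret D: gor_dual_basis "mps_const :: 'k \<Rightarrow> 'k mps" A.Q m n f w z by (rule fwz)
  obtain Z g where g: "mps.linfun g" "\<And>x. x \<in> A.Q 4 \<Longrightarrow> g x = 0"
    "\<And>x. (\<And>y. g (x * y) = 0) \<Longrightarrow> x \<in> A.Q 4"
    and nm: "n \<le> m" and g1: "g 1 = 0" and Z: "\<And>i. i < m \<Longrightarrow> Z i \<in> A.Q 1"
    "mps.spans_mod (A.Q 2) m Z (A.Q 1)" and gZ: "\<And>i. i < m \<Longrightarrow> g (Z i) = 0"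
    and g2: "\<And>i j. i < m \<Longrightarrow> j < m \<Longrightarrow> g (Z i * Z j) = (if i = j \<and> n \<le> i then 2 else 0)"
    and g3: "\<And>i j k. i < m \<Longrightarrow> j < m \<Longrightarrow> k < m \<Longrightarrow> n \<le> i \<Longrightarrow> g (Z i * (Z j * Z k)) = 0"
    and nd: "\<And>c. (\<And>i j. i < n \<Longrightarrow> j < n \<Longrightarrow> (\<Sum>k<n. c k * g (Z k * (Z i * Z j))) = 0) \<Longrightarrow> \<forall>k<n. c k = 0"
    by (rule D.adapted_generators) blast
  define S where "S = {a \<in> expos n 4. total_degree a = 3}"
  \<comment> \<open>Division by the factorial makes the third derivatives of \<open>F\<close> equal
    to the values of \<open>g\<close> on products of three generators.\<close>
  define F where "F = Poly_Mapping.Abs_poly_mapping (\<lambda>a. if a \<in> S then g (monom_at Z a) / efact a else 0)"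
  have "finite {a. (if a \<in> S then g (monom_at Z a) / efact a else 0) \<noteq> 0}"
    by (rule finite_subset[OF _ finite_expos[of n 4]]) (auto simp: S_def)
  then have lF: "Poly_Mapping.lookup F a = (if a \<in> S then g (monom_at Z a) / efact a else 0)" for a
    unfolding F_def by simp
  have "Poly_Mapping.keys F \<subseteq> S" by (auto simp: in_keys_iff lF split: if_splits)
  then have F3: "F \<in> forms n 3"
    unfolding forms_def mpolys_def by (auto simp: S_def expos_def)
  have pF: "polar F i j k = g (Z i * (Z j * Z k))" if "i < n" "j < n" "k < n" for i j k
  proof -
    have "monom_at Z (expo_var l) = Z l" for l using monom_at_var[of Z l] by simp
    moreover have "expo_var i + (expo_var j + expo_var k) \<in> S"
      using that by (simp add: S_def expos_def total_degree_add keys_expo_add)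
    ultimately show ?thesis by (simp add: polar_eq lF monom_at_add)
  qed
  have F: "F \<in> nondeg_cubics n" unfolding nondeg_cubics_iff
  proof (intro conjI F3 allI impI)
    fix c k assume c: "\<forall>i<n. \<forall>j<n. (\<Sum>k<n. c k * polar F k i j) = 0" and k: "k < n"
    have "(\<Sum>k<n. c k * g (Z k * (Z i * Z j))) = 0" if "i < n" "j < n" for i j
    proof -
      have "(\<Sum>k<n. c k * g (Z k * (Z i * Z j))) = (\<Sum>k<n. c k * polar F k i j)"
        using that by (intro sum.cong) (auto simp: pF)
      then show ?thesis using c that by simp
    qed
    then show "c k = 0" using nd[of c] k by blast
  qed
  interpret N: nondeg_cubic m n F using F n nm by unfold_locales
  \<comment> \<open>If some index is at least \<open>n\<close>, commutativity moves that generator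
    to the front, where \<open>g3\<close> gives 0, in agreement with
    \<open>polar_outside\<close>.\<close>
  have "g (Z i * (Z j * Z k)) = polar F i j k" if "i < m" "j < m" "k < m" for i j k
  proof (cases "i < n \<and> j < n \<and> k < n")
    case True
    then show ?thesis by (simp add: pF)
  next
    case False
    have "Z i * (Z j * Z k) = Z j * (Z i * Z k)" "Z i * (Z j * Z k) = Z k * (Z i * Z j)"
      by (simp_all add: ac_simps)
    then have "g (Z i * (Z j * Z k)) = 0"
      using False that g3[of i j k] g3[of j i k] g3[of k i j] by (metis not_le)
    with False show ?thesis by (simp add: N.polar_outside)
  qed
  then have "alg_iso (cubic_alg m n F) A"
    using gf(1) by (intro Q.cubic_iso[OF F n nm A.presentation_axioms _ Z g g1 gZ g2]) auto
  with F show ?thesis by blast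
qed

context nondeg_cubic
begin

text \<open>Trilinear expansion; variables with index at least \<open>n\<close> drop out since
  \<open>polar F\<close> vanishes there. The range \<open>d\<close> is used with the value
  \<open>n\<close> for a change of variables and with \<open>m\<close> for linear parts of arbitrary
  series.\<close>

lemma ev_triple_sum:
  assumes "n \<le> d"
  shows
  "ev ((\<Sum>a<d. mps_const (p a) * mps_var a) * ((\<Sum>b<d. mps_const (q b) * mps_var b) *
      (\<Sum>c<d. mps_const (r c) * mps_var c))) =
    (\<Sum>c<n. \<Sum>b<n. \<Sum>a<n. r c * q b * p a * polar F a b c)"
proof -
  have "(\<Sum>a<d. mps_const (p a) * mps_var a) * ((\<Sum>b<d. mps_const (q b) * mps_var b) *
      (\<Sum>c<d. mps_const (r c) * mps_var c)) =
    (\<Sum>a<d. \<Sum>b<d. \<Sum>c<d. mps_const (r c * q b * p a) * (mps_var a * (mps_var b * mps_var c)))"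
    unfolding sum_distrib_right unfolding sum_distrib_left mps.s_mult
    by (intro sum.cong refl) (simp only: ac_simps)
  then have "ev ((\<Sum>a<d. mps_const (p a) * mps_var a) * ((\<Sum>b<d. mps_const (q b) * mps_var b) *
      (\<Sum>c<d. mps_const (r c) * mps_var c))) =
    (\<Sum>a<d. \<Sum>b<d. \<Sum>c<d. r c * q b * p a * polar F a b c)"
    by (simp only: ev_simps ev_cubic)
  also have "\<dots> = (\<Sum>a<d. \<Sum>c<d. \<Sum>b<d. r c * q b * p a * polar F a b c)"
    by (intro sum.cong refl sum.swap)
  also have "\<dots> = (\<Sum>c<d. \<Sum>a<d. \<Sum>b<d. r c * q b * p a * polar F a b c)"
    by (rule sum.swap)
  also have "\<dots> = (\<Sum>c<d. \<Sum>b<d. \<Sum>a<d. r c * q b * p a * polar F a b c)"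
    by (intro sum.cong refl sum.swap)
  also have "\<dots> = (\<Sum>c<n. \<Sum>b<n. \<Sum>a<n. r c * q b * p a * polar F a b c)"
    by (intro sum.mono_neutral_cong_right ballI sum.neutral) (use assms in \<open>auto simp: polar_outside\<close>)
  finally show ?thesis .
qed

end

text \<open>The algebra of \<open>F\<close> stays fixed, and generators and a functional are chosen
  for which its cubic becomes \<open>F'\<close>: the first \<open>n\<close> variables are
  transformed by \<open>M\<close>, and the functional is multiplied by \<open>c\<close>.\<close>

lemma proj_equiv_alg_iso:
  fixes F F' :: "'k::{alg_closed_field, field_char_0} mpoly"
  assumes n: "1 \<le> n" "n \<le> m" and eq: "(F, F') \<in> proj_equiv n"
  shows "alg_iso (cubic_alg m n F') (cubic_alg m n F)"
proof -
  from eq obtain M c where F: "F \<in> nondeg_cubics n" and F': "F' \<in> nondeg_cubics n"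
    and M: "M \<in> carrier_mat n n" "invertible_mat M" and c: "c \<noteq> 0" "F' = pscale c (lin_subst n M F)"
    by (auto simp: proj_equiv_def)
  interpret N: nondeg_cubic m n F using F n by unfold_locales
  note gf = local_gor_filtration[OF N.A.local_presentation_axioms N.finite_length_cubic
      N.gorenstein_cubic N.hilbert_function]
  interpret Q: gor_filtration "mps_const :: 'k \<Rightarrow> 'k mps" N.A.Q m n by (rule gf(3))
  \<comment> \<open>Multiplying the functional by \<open>c\<close> would also multiply the squares
    by \<open>c\<close>; scaling the remaining variables by a square root of
    \<open>inverse c\<close> restores them.\<close>
  obtain r where r: "r ^ 2 = inverse c" using nth_root_exists[of 2 "inverse c"] by auto
  have r0: "r \<noteq> 0" using r c by auto
  have rc: "c * (r * r) = 1" using r c by (simp add: power2_eq_square)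
  obtain B where B: "\<And>a k. a < n \<Longrightarrow> k < n \<Longrightarrow> (\<Sum>i<n. M $$ (a, i) * B i k) = (if a = k then 1 else 0)"
    by (rule invertible_mat_inverse[OF M]) blast
  \<comment> \<open>Columns of \<open>M\<close> appear here, whereas the substitution in
    \<open>F\<close> uses rows: differential operators transform dually to the variables they act
    on.\<close>
  define l where "l = (\<lambda>i. \<Sum>a<n. mps_const (M $$ (a, i)) * mps_var a)"
  define Z where "Z = (\<lambda>i. if i < n then l i else mps_const r * mps_var i)"
  define g where "g = (\<lambda>f. c * N.ev f)"
  have lin_g: "mps.linfun g"
    using linfun_dual_eval[of N.G] unfolding g_def mps.linfun_def by (simp add: algebra_simps)
  note gs = mps.linfun_simps[OF lin_g]
  have Q1: "N.A.Q 1 = order_ideal m 1" and Q2: "N.A.Q 2 = order_ideal m 2" and Q4: "N.A.Q 4 = annih N.G"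
    by (simp_all add: N.Q_low N.Q_high)
  have l1: "l i \<in> order_ideal m 1" for i
    unfolding l_def using mps_var_order
    by (auto intro!: mps.vs.subspace_sum mps.vs.subspace_scale order_ideal_subspace)
  have Z1: "Z i \<in> order_ideal m 1" for i
    unfolding Z_def using l1 mps_var_order
    by (auto intro!: mps.vs.subspace_scale order_ideal_subspace)
  have split: "(\<Sum>i<m. h i) = (\<Sum>i<n. h i) + (\<Sum>i = n..<m. h i)" for h :: "nat \<Rightarrow> 'k mps"
    using n(2) by (simp add: lessThan_atLeast0 sum.atLeastLessThan_concat)
  have span: "mps.spans_mod (N.A.Q 2) m Z (N.A.Q 1)"
    unfolding mps.spans_mod_def Q1 Q2
  proof
    fix f :: "'k mps" assume f: "f \<in> order_ideal m 1"
    define p where "p = (\<lambda>k. coeff_mps f (expo_var k))"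
    \<comment> \<open>Coordinates of the linear part of \<open>f\<close> in the new generators: the
      right inverse \<open>B\<close> undoes the change of the first \<open>n\<close> variables, and
      division by \<open>r\<close> undoes the scaling.\<close>
    define d where "d = (\<lambda>i. if i < n then \<Sum>k<n. B i k * p k else p i / r)"
    have "(\<Sum>i<n. mps_const (d i) * Z i) =
        (\<Sum>i<n. \<Sum>a<n. mps_const (d i * M $$ (a, i)) * mps_var a)"
      by (simp add: Z_def l_def sum_distrib_left)
    also have "\<dots> = (\<Sum>a<n. \<Sum>i<n. mps_const (d i * M $$ (a, i)) * mps_var a)" by (rule sum.swap)
    also have "\<dots> = (\<Sum>a<n. mps_const (p a) * mps_var a)"
    proof (rule sum.cong[OF refl])
      fix a assume "a \<in> {..<n}"
      then have a: "a < n" by simp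
      have "(\<Sum>i<n. M $$ (a, i) * d i) = (\<Sum>i<n. \<Sum>k<n. M $$ (a, i) * B i k * p k)"
        by (simp add: d_def sum_distrib_left mult.assoc)
      also have "\<dots> = (\<Sum>k<n. \<Sum>i<n. M $$ (a, i) * B i k * p k)" by (rule sum.swap)
      also have "\<dots> = (\<Sum>k<n. (\<Sum>i<n. M $$ (a, i) * B i k) * p k)" by (simp only: sum_distrib_right)
      also have "\<dots> = (\<Sum>k<n. if k = a then p a else 0)"
        using B[OF a] by (intro sum.cong) auto
      finally have "(\<Sum>i<n. M $$ (a, i) * d i) = p a" using a by simp
      then have "(\<Sum>i<n. d i * M $$ (a, i)) = p a" by (simp only: mult.commute[of "d _"])
      then show "(\<Sum>i<n. mps_const (d i * M $$ (a, i)) * mps_var a) = mps_const (p a) * mps_var a"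
        by (simp only: sum_distrib_right[symmetric] Q.s_sum[symmetric])
    qed
    finally have 1: "(\<Sum>i<n. mps_const (d i) * Z i) = (\<Sum>i<n. mps_const (p i) * mps_var i)" .
    have 2: "(\<Sum>i = n..<m. mps_const (d i) * Z i) = (\<Sum>i = n..<m. mps_const (p i) * mps_var i)"
      using r0 by (intro sum.cong) (auto simp: d_def Z_def)
    have "(\<Sum>i<m. mps_const (d i) * Z i) = (\<Sum>i<m. mps_const (p i) * mps_var i)"
      unfolding split 1 2 ..
    with order_ideal_linear_part[OF f] show "\<exists>d. f - (\<Sum>i<m. mps_const (d i) * Z i) \<in> order_ideal m 2"
      by (intro exI[of _ d]) (simp add: p_def)
  qed
  have evZ: "N.ev (Z i * f) = 0" if "n \<le> i" "f \<in> order_ideal m 2" for i f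
    using that N.ev_var_order_2[of f i] by (simp add: Z_def mult.assoc N.ev_simps)
  have lx: "N.ev (l i * mps_var j) = 0" if "n \<le> j" for i j
  proof -
    have "l i * mps_var j = (\<Sum>a<n. mps_const (M $$ (a, i)) * (mps_var a * mps_var j))"
      by (simp add: l_def sum_distrib_right mult.assoc)
    then have "N.ev (l i * mps_var j) = (\<Sum>a<n. M $$ (a, i) * N.ev (mps_var a * mps_var j))"
      by (simp only: N.ev_simps)
    also have "\<dots> = 0" using that by (intro sum.neutral) (auto simp: N.ev_quadratic)
    finally show ?thesis .
  qed
  have ll: "N.ev (l i * l j) = 0" for i j
  proof -
    have "l i * l j = (\<Sum>a<n. mps_const (M $$ (a, j)) * (l i * mps_var a))"
      by (simp add: l_def[of ] sum_distrib_left ac_simps)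
    then have "N.ev (l i * l j) = (\<Sum>a<n. M $$ (a, j) * N.ev (l i * mps_var a))"
      by (simp only: N.ev_simps)
    also have "\<dots> = (\<Sum>a<n. M $$ (a, j) * (\<Sum>b<n. M $$ (b, i) * N.ev (mps_var b * mps_var a)))"
      by (simp add: l_def sum_distrib_right mult.assoc N.ev_simps)
    also have "\<dots> = 0" by (auto simp: N.ev_quadratic intro!: sum.neutral)
    finally show ?thesis .
  qed
  have g2: "g (Z i * Z j) = (if i = j \<and> n \<le> i then 2 else 0)" if ij: "i < m" "j < m" for i j
  proof -
    consider "i < n" "j < n" | "i < n" "n \<le> j" | "n \<le> i" "j < n" | "n \<le> i" "n \<le> j" by linarith
    then show ?thesis
    proof cases
      case 1
      then show ?thesis by (simp add: g_def Z_def ll)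
    next
      case 2
      have "l i * (mps_const r * mps_var j) = mps_const r * (l i * mps_var j)" by (simp add: ac_simps)
      then have "N.ev (l i * (mps_const r * mps_var j)) = r * N.ev (l i * mps_var j)"
        by (simp only: N.ev_simps)
      then have "N.ev (Z i * Z j) = 0" using 2 lx[of j i] by (simp add: Z_def)
      with 2 show ?thesis by (simp add: g_def)
    next
      case 3
      have "mps_const r * mps_var i * l j = mps_const r * (l j * mps_var i)" by (simp add: ac_simps)
      then have "N.ev (mps_const r * mps_var i * l j) = r * N.ev (l j * mps_var i)"
        by (simp only: N.ev_simps)
      then have "N.ev (Z i * Z j) = 0" using 3 lx[of i j] by (simp add: Z_def)
      with 3 show ?thesis by (simp add: g_def)
    next
      case 4
      have "mps_const r * mps_var i * (mps_const r * mps_var j) =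
          mps_const r * (mps_const r * (mps_var i * mps_var j))" by (simp only: ac_simps)
      then have "N.ev (Z i * Z j) = r * (r * N.ev (mps_var i * mps_var j))"
        using 4 by (simp only: Z_def N.ev_simps if_False not_less[symmetric])
      then show ?thesis using 4 ij rc by (simp add: g_def N.ev_quadratic mult.assoc[symmetric])
    qed
  qed
  have F3: "lin_subst n M F \<in> forms n 3" by (rule forms_lin_subst[OF N.F_forms])
  interpret N': nondeg_cubic m n F' using F' n by unfold_locales
  have g3: "g (Z i * (Z j * Z k)) = polar F' i j k" if "i < m" "j < m" "k < m" for i j k
  proof (cases "i < n \<and> j < n \<and> k < n")
    case True
    then have "g (Z i * (Z j * Z k)) = c * N.ev (l i * (l j * l k))" by (simp add: g_def Z_def)
    also have "\<dots> = c * polar (lin_subst n M F) i j k"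
      using True by (simp only: l_def N.ev_triple_sum[OF order_refl] polar_lin_subst[OF N.F_forms])
    finally show ?thesis by (simp add: c(2) polar_pscale)
  next
    case False
    have z2: "Z i * Z j \<in> order_ideal m 2" for i j by (rule order_ideal_mult[OF Z1 Z1]) simp
    have "Z i * (Z j * Z k) = Z j * (Z i * Z k)" "Z i * (Z j * Z k) = Z k * (Z i * Z j)"
      by (simp_all add: ac_simps)
    then have "N.ev (Z i * (Z j * Z k)) = 0"
      using False evZ[of i "Z j * Z k"] evZ[of j "Z i * Z k"] evZ[of k "Z i * Z j"] z2 by (metis not_le)
    with False show ?thesis by (simp add: g_def N'.polar_outside)
  qed
  show ?thesis
  proof (rule Q.cubic_iso[OF F' n N.A.presentation_axioms])
    show "N.A.ker = N.A.Q 4" by (simp add: N.ker_eq Q4)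
    show "Z i \<in> N.A.Q 1" for i unfolding Q1 by (rule Z1)
    show "g x = 0" if "x \<in> N.A.Q 4" for x using that N.annih_ev' by (simp add: Q4 g_def)
    show "x \<in> N.A.Q 4" if "\<And>y. g (x * y) = 0" for x
      using that c by (simp add: Q4 g_def annih_def mult.commute)
    show "g 1 = 0" by (simp add: g_def N.ev_1)
    show "g (Z i) = 0" for i
      by (simp add: g_def Z_def l_def N.ev_simps N.ev_linear)
  qed (use span lin_g g2 g3 in auto)
qed

text \<open>The isomorphism multiplies the functional on the socle by a constant \<open>c\<close>,
  and products of three elements of the maximal ideal depend only on linear parts. The linear part
  of the isomorphism thus carries one trilinear form to the other, up to \<open>c\<close>.\<close>

lemma alg_iso_proj_equiv:
  fixes F F' :: "'k::field_char_0 mpoly"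
  assumes n: "1 \<le> n" "n \<le> m" and F: "F \<in> nondeg_cubics n" "F' \<in> nondeg_cubics n"
    and iso: "alg_iso (cubic_alg m n F) (cubic_alg m n F')"
  shows "(F', F) \<in> proj_equiv n"
proof -
  interpret N: nondeg_cubic m n F using F n by unfold_locales
  interpret N': nondeg_cubic m n F' using F n by unfold_locales
  obtain \<theta> where \<theta>: "\<theta> \<in> ring_iso (cubic_alg m n F) (cubic_alg m n F')"
    "\<And>c a. a \<in> carrier (cubic_alg m n F) \<Longrightarrow>
      \<theta> (c \<odot>\<^bsub>cubic_alg m n F\<^esub> a) = c \<odot>\<^bsub>cubic_alg m n F'\<^esub> \<theta> a"
    using iso unfolding alg_iso_def by blast
  have hom: "\<theta> \<in> Ring.ring_hom (cubic_alg m n F) (cubic_alg m n F')"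
    and bij: "bij_betw \<theta> (carrier (cubic_alg m n F)) (carrier (cubic_alg m n F'))"
    using \<theta>(1) by (auto simp: ring_iso_def)
  \<comment> \<open>\<open>\<theta>\<close> acts on cosets. The relation \<open>R\<close> between
    representatives is compatible with all operations and avoids a choice of a lift.\<close>
  define R where "R = (\<lambda>f f'. N'.e f' = \<theta> (N.e f))"
  have R_ex: "\<exists>f'. R f f'" for f
  proof -
    have "\<theta> (N.e f) \<in> carrier (cubic_alg m n F')" using bij N.A.e_carrier by (auto simp: bij_betw_def)
    then show ?thesis by (auto simp: R_def N'.A.e_surj)
  qed
  have R_mult: "R (f * g) (f' * g')" if "R f f'" "R g g'" for f g f' g'
    using that ring_hom_mult[OF hom N.A.e_carrier N.A.e_carrier]
    by (simp add: R_def N.A.e_mult N'.A.e_mult)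
  have R_add: "R (f + g) (f' + g')" if "R f f'" "R g g'" for f g f' g'
    using that ring_hom_add[OF hom N.A.e_carrier N.A.e_carrier]
    by (simp add: R_def N.A.e_add N'.A.e_add)
  have R_scale: "R (mps_const c * f) (mps_const c * f')" if "R f f'" for c f f'
    using that by (simp add: R_def N.A.e_scale N'.A.e_scale \<theta>(2))
  have R_diff: "R (f - g) (f' - g')" if "R f f'" "R g g'" for f g f' g'
    using R_add[OF that(1) R_scale[OF that(2), of "- 1"]] by (simp add: mps.s_minus)
  have R_0: "R 0 0" using R_scale[of 0 _ 0] R_ex[of 0] by fastforce
  have R_ann: "f' \<in> annih N'.G \<longleftrightarrow> f \<in> annih N.G" if "R f f'" for f f'
  proof -
    have "f' \<in> annih N'.G \<longleftrightarrow> N'.e f' = N'.e 0" by (simp add: N'.A.e_eq_iff N'.ker_eq)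
    also have "\<dots> \<longleftrightarrow> \<theta> (N.e f) = \<theta> (N.e 0)" using that R_0 by (simp add: R_def)
    also have "\<dots> \<longleftrightarrow> N.e f = N.e 0"
      using bij inj_on_eq_iff[of \<theta> "carrier (cubic_alg m n F)"] by (simp add: bij_betw_def)
    also have "\<dots> \<longleftrightarrow> f \<in> annih N.G" by (simp add: N.A.e_eq_iff N.ker_eq)
    finally show ?thesis .
  qed
  have "\<forall>i. \<exists>h. R (mps_var i) h" using R_ex by blast
  then obtain h where h: "\<And>i. R (mps_var i) (h i)" by metis
  have mult_0: "coeff_mps (f * g) 0 = coeff_mps f 0 * coeff_mps g 0" for f g :: "'k mps"
  proof -
    have "{(b :: expo, c). b + c = 0} = {(0, 0)}"
      using total_degree_add by (auto simp flip: total_degree_eq_0)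
    then show ?thesis by (simp add: coeff_mps_mult)
  qed
  \<comment> \<open>The fourth power of a variable is zero in the algebra of \<open>F\<close>, hence
    so is that of its image; its representative then has constant term zero, and so does
    \<open>h i\<close>.\<close>
  have h1: "h i \<in> order_ideal m 1" for i
  proof -
    have "mps_var i * mps_var i * (mps_var i * mps_var i) \<in> (order_ideal m 4 :: 'k mps set)"
      using mps_var_order by (intro order_ideal_mult[of _ m 2 _ 2] order_ideal_mult[of _ m 1 _ 1]) auto
    then have "h i * h i * (h i * h i) \<in> annih N'.G"
      using R_ann[OF R_mult[OF R_mult[OF h[of i] h[of i]] R_mult[OF h[of i] h[of i]]]] N.order_4_annih by blast
    then have "coeff_mps (h i * h i * (h i * h i)) 0 = 0"
      using N'.annih_order_2 by (force simp: order_ideal_def expos_def)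
    then show ?thesis by (simp add: mult_0 order_ideal_1[simplified] mps_max_def)
  qed
  define H where "H = (\<lambda>i j k. h i * (h j * h k))"
  define T where "T = (\<lambda>i j k. mps_var i * (mps_var j * mps_var k) :: 'k mps)"
  have RT: "R (T i j k) (H i j k)" for i j k
    unfolding T_def H_def by (intro R_mult h)
  have T3: "T i j k \<in> order_ideal m 3" for i j k
    unfolding T_def using mps_var_order
    by (intro order_ideal_mult[of _ m 1 _ 2] order_ideal_mult[of _ m 1 _ 1]) auto
  have H3: "H i j k \<in> order_ideal m 3" for i j k
    unfolding H_def using h1
    by (intro order_ideal_mult[of _ m 1 _ 2] order_ideal_mult[of _ m 1 _ 1]) auto
  have "\<exists>i j k. polar F k i j \<noteq> 0"
  proof (rule ccontr)
    assume "\<not> ?thesis"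
    then have "(1 :: 'k) = 0" using N.F_nondeg[of "\<lambda>_. 1" 0] n by simp
    then show False by simp
  qed
  then obtain i0 j0 k0 where p0: "polar F k0 i0 j0 \<noteq> 0" by blast
  let ?p0 = "polar F k0 i0 j0"
  define c where "c = N'.ev (H k0 i0 j0) / ?p0"
  \<comment> \<open>Elements of order 3 are determined modulo the annihilator by \<open>ev\<close>,
    so \<open>T i j k\<close> is a multiple of one fixed nonzero product. The isomorphism carries
    this relation to the \<open>H i j k\<close>, and \<open>c\<close> is the ratio of the two
    functionals on the socle.\<close>
  have evH: "N'.ev (H i j k) = c * polar F i j k" for i j k
  proof -
    define d where "d = polar F i j k / ?p0"
    have "T i j k - mps_const d * T k0 i0 j0 \<in> annih N.G"
    proof (rule N.ev_separates_order_3)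
      show "T i j k - mps_const d * T k0 i0 j0 \<in> order_ideal m 3"
        using T3 by (auto intro!: mps.vs.subspace_diff mps.vs.subspace_scale order_ideal_subspace)
      show "N.ev (T i j k - mps_const d * T k0 i0 j0) = 0"
        using p0 by (simp add: N.ev_simps) (simp add: T_def N.ev_cubic d_def)
    qed
    then have "H i j k - mps_const d * H k0 i0 j0 \<in> annih N'.G"
      using R_ann[OF R_diff[OF RT R_scale[OF RT]]] by blast
    from N'.annih_ev'[OF this] show ?thesis by (simp add: N'.ev_simps c_def d_def)
  qed
  have c: "c \<noteq> 0"
  proof
    assume "c = 0"
    then have "H k0 i0 j0 \<in> annih N'.G" using evH by (intro N'.ev_separates_order_3 H3) simp
    then have "T k0 i0 j0 \<in> annih N.G" using R_ann[OF RT] by blast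
    from N.annih_ev'[OF this] p0 show False by (simp add: T_def N.ev_cubic)
  qed
  \<comment> \<open>Only the coefficients at the first \<open>n\<close> variables are kept, because
    the trilinear form of \<open>F'\<close> vanishes on the other variables.\<close>
  define M where "M = mat n n (\<lambda>(a, i). coeff_mps (h i) (expo_var a))"
  have M: "M \<in> carrier_mat n n" by (simp add: M_def)
  define l where "l = (\<lambda>i. \<Sum>a<m. mps_const (coeff_mps (h i) (expo_var a)) * mps_var a)"
  have hl: "h i - l i \<in> order_ideal m 2" for i
    unfolding l_def by (rule order_ideal_linear_part[OF h1])
  have l1: "l i \<in> order_ideal m 1" for i
    unfolding l_def using mps_var_order
    by (auto intro!: mps.vs.subspace_sum mps.vs.subspace_scale order_ideal_subspace)
  have prod3: "f * (g * k) \<in> order_ideal m 4"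
    if "f \<in> order_ideal m p" "g \<in> order_ideal m q" "k \<in> order_ideal m r" "4 \<le> p + q + r"
    for f g k :: "'k mps" and p q r
    using order_ideal_mult[OF that(1) order_ideal_mult[OF that(2,3) order_refl], of 4] that(4) by simp
  have polar_F': "polar (lin_subst n M F') i j k = c * polar F i j k" if ijk: "i < n" "j < n" "k < n" for i j k
  proof -
    have "H i j k = l i * (l j * l k) + ((h i - l i) * (h j * h k) + (l i * ((h j - l j) * h k) +
        l i * (l j * (h k - l k))))"
      by (simp add: H_def algebra_simps)
    moreover have "N'.ev ((h i - l i) * (h j * h k)) = 0" "N'.ev (l i * ((h j - l j) * h k)) = 0"
      "N'.ev (l i * (l j * (h k - l k))) = 0"
      using hl l1 h1 by (auto intro!: N'.ev_order_4 intro: prod3[of _ 2 _ 1 _ 1] prod3[of _ 1 _ 2 _ 1] prod3[of _ 1 _ 1 _ 2])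
    ultimately have "c * polar F i j k = N'.ev (l i * (l j * l k))"
      using evH[of i j k] by (simp add: N'.ev_simps)
    also have "\<dots> = polar (lin_subst n M F') i j k"
      using ijk n(2) by (simp only: l_def N'.ev_triple_sum polar_lin_subst[OF N'.F_forms])
        (simp add: M_def)
    finally show ?thesis by simp
  qed
  \<comment> \<open>The form of \<open>F\<close> is, up to the nonzero factor \<open>c\<close>, the
    pullback along \<open>M\<close> of the form of \<open>F'\<close>. A vector in the kernel of
    \<open>M\<close> thus lies in the radical of the form of \<open>F\<close>, which is
    zero.\<close>
  have "invertible_mat M"
  proof (rule invertible_matI_kernel[OF M])
    fix v assume v: "\<And>a. a < n \<Longrightarrow> (\<Sum>i<n. M $$ (a, i) * v i) = 0"
    show "\<forall>i<n. v i = 0"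
    proof (intro allI impI)
      fix i0 assume "i0 < n"
      show "v i0 = 0"
      proof (rule N.F_nondeg[OF _ \<open>i0 < n\<close>])
        fix i j assume ij: "i < n" "j < n"
        have "c * (\<Sum>k<n. v k * polar F k i j) = (\<Sum>k<n. v k * polar (lin_subst n M F') k i j)"
          using ij by (simp add: polar_F' sum_distrib_left mult.left_commute)
        also have "\<dots> = (\<Sum>k<n. \<Sum>e<n. \<Sum>b<n. \<Sum>a<n. M $$ (e, j) * M $$ (b, i) * polar F' a b e * (M $$ (a, k) * v k))"
          using ij by (simp add: polar_lin_subst[OF N'.F_forms] sum_distrib_left ac_simps)
        also have "\<dots> = (\<Sum>e<n. \<Sum>k<n. \<Sum>b<n. \<Sum>a<n. M $$ (e, j) * M $$ (b, i) * polar F' a b e * (M $$ (a, k) * v k))"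
          by (rule sum.swap)
        also have "\<dots> = (\<Sum>e<n. \<Sum>b<n. \<Sum>k<n. \<Sum>a<n. M $$ (e, j) * M $$ (b, i) * polar F' a b e * (M $$ (a, k) * v k))"
          by (intro sum.cong refl sum.swap)
        also have "\<dots> = (\<Sum>e<n. \<Sum>b<n. \<Sum>a<n. \<Sum>k<n. M $$ (e, j) * M $$ (b, i) * polar F' a b e * (M $$ (a, k) * v k))"
          by (intro sum.cong refl sum.swap)
        also have "\<dots> = 0"
          using v by (simp only: sum_distrib_left[symmetric]) simp
        finally show "(\<Sum>k<n. v k * polar F k i j) = 0" using c by simp
      qed
    qed
  qed
  moreover have "F = pscale (inverse c) (lin_subst n M F')"
  proof (rule cubic_eqI[OF N.F_forms])
    show "pscale (inverse c) (lin_subst n M F') \<in> forms n 3"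
      by (intro forms_pscale forms_lin_subst N'.F_forms)
    show "polar F i j k = polar (pscale (inverse c) (lin_subst n M F')) i j k"
      if "i < n" "j < n" "k < n" for i j k
      using c that by (simp add: polar_pscale polar_F')
  qed
  ultimately show ?thesis using F M c unfolding proj_equiv_def
    by (intro CollectI case_prodI conjI exI[of _ M] exI[of _ "inverse c"]) auto
qed

lemma proj_equiv_iff:
  fixes F F' :: "'k::{alg_closed_field, field_char_0} mpoly"
  assumes "1 \<le> n" "n \<le> m"
  shows "(F, F') \<in> proj_equiv n \<longleftrightarrow> F \<in> nondeg_cubics n \<and> F' \<in> nondeg_cubics n \<and>
    (cubic_alg m n F, cubic_alg m n F') \<in> gor_iso m n"
proof -
  have gor: "cubic_alg m n H \<in> gor_algs m n" if "H \<in> nondeg_cubics n" for H :: "'k mpoly"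
    by (rule nondeg_cubic.cubic_alg_gor) (use that assms in unfold_locales)
  have sym: "(B, A) \<in> gor_iso m n" if "(A, B) \<in> gor_iso m n" for A B :: "('k, 'k mpser set) module"
    using equiv_gor_iso[of m n] that unfolding equiv_def sym_def by blast
  show ?thesis
  proof
    assume *: "(F, F') \<in> proj_equiv n"
    then have FF: "F \<in> nondeg_cubics n" "F' \<in> nondeg_cubics n" by (auto simp: proj_equiv_def)
    then have "(cubic_alg m n F', cubic_alg m n F) \<in> gor_iso m n"
      using proj_equiv_alg_iso[OF assms *] gor by (simp add: gor_iso_def)
    with FF sym show "F \<in> nondeg_cubics n \<and> F' \<in> nondeg_cubics n \<and>
        (cubic_alg m n F, cubic_alg m n F') \<in> gor_iso m n" by blast
  next
    assume *: "F \<in> nondeg_cubics n \<and> F' \<in> nondeg_cubics n \<and>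
        (cubic_alg m n F, cubic_alg m n F') \<in> gor_iso m n"
    then have "(cubic_alg m n F', cubic_alg m n F) \<in> gor_iso m n" using sym by blast
    then show "(F, F') \<in> proj_equiv n"
      using alg_iso_proj_equiv[OF assms, of F' F] * by (simp add: gor_iso_def)
  qed
qed

text \<open>\<open>r\<close> is the pullback of the equivalence \<open>s\<close> along
  \<open>f\<close>. It is therefore an equivalence itself, so that for projective equivalence no
  composition or inversion of substitutions has to be computed; reflection of \<open>s\<close> gives
  injectivity on classes.\<close>

lemma bij_betw_quotients:
  assumes B: "equiv B s" and f: "f \<in> A \<rightarrow> B"
    and r: "\<And>x y. (x, y) \<in> r \<longleftrightarrow> x \<in> A \<and> y \<in> A \<and> (f x, f y) \<in> s"
    and surj: "\<And>y. y \<in> B \<Longrightarrow> \<exists>x\<in>A. (f x, y) \<in> s"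
  shows "equiv A r" "bij_betw (\<lambda>C. \<Union>x\<in>C. s `` {f x}) (A // r) (B // s)"
proof -
  have refl: "(y, y) \<in> s" if "y \<in> B" for y using B that by (auto simp: equiv_def refl_on_def)
  have sym: "(y, x) \<in> s" if "(x, y) \<in> s" for x y using B that by (auto simp: equiv_def sym_def)
  have trans: "(x, z) \<in> s" if "(x, y) \<in> s" "(y, z) \<in> s" for x y z
    using B that unfolding equiv_def trans_def by blast
  have fY: "f x \<in> B" if "x \<in> A" for x using f that by auto
  show A: "equiv A r"
  proof (rule equivI)
    show "r \<subseteq> A \<times> A" using r by auto
    show "refl_on A r" using r refl fY by (auto simp: refl_on_def)
    show "sym r" using r sym by (auto simp: sym_def)
    show "trans r" using r trans unfolding trans_def by blast
  qed
  have cls: "(\<Union>y\<in>r `` {x}. s `` {f y}) = s `` {f x}" if "x \<in> A" for x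
  proof -
    have "s `` {f y} = s `` {f x}" if "y \<in> r `` {x}" for y
    proof -
      have "(f x, f y) \<in> s" using that r by auto
      then show ?thesis using equiv_class_eq[OF B] by auto
    qed
    moreover have "x \<in> r `` {x}" using A that by (auto simp: equiv_def refl_on_def)
    ultimately show ?thesis by blast
  qed
  show "bij_betw (\<lambda>C. \<Union>x\<in>C. s `` {f x}) (A // r) (B // s)"
    unfolding bij_betw_def
  proof
    show "inj_on (\<lambda>C. \<Union>x\<in>C. s `` {f x}) (A // r)"
    proof (rule inj_onI)
      fix C D assume C: "C \<in> A // r" and D: "D \<in> A // r"
        and eq: "(\<Union>x\<in>C. s `` {f x}) = (\<Union>x\<in>D. s `` {f x})"
      obtain x where x: "x \<in> A" "C = r `` {x}" using C by (rule quotientE)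
      obtain y where y: "y \<in> A" "D = r `` {y}" using D by (rule quotientE)
      have "s `` {f x} = s `` {f y}" using eq unfolding x(2) y(2) cls[OF x(1)] cls[OF y(1)] .
      then have "(f x, f y) \<in> s" using eq_equiv_class[OF _ B fY[OF y(1)]] by blast
      then have "(x, y) \<in> r" using r x y by auto
      then show "C = D" unfolding x(2) y(2) by (rule equiv_class_eq[OF A])
    qed
    show "(\<lambda>C. \<Union>x\<in>C. s `` {f x}) ` (A // r) = B // s"
    proof (intro subset_antisym subsetI)
      fix E assume "E \<in> (\<lambda>C. \<Union>x\<in>C. s `` {f x}) ` (A // r)"
      then obtain C where C: "C \<in> A // r" "E = (\<Union>x\<in>C. s `` {f x})" by blast
      obtain x where x: "x \<in> A" "C = r `` {x}" using C(1) by (rule quotientE)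
      show "E \<in> B // s" unfolding C(2) x(2) cls[OF x(1)] by (rule quotientI[OF fY[OF x(1)]])
    next
      fix E assume "E \<in> B // s"
      then obtain y where y: "y \<in> B" "E = s `` {y}" by (rule quotientE)
      obtain x where x: "x \<in> A" "(f x, y) \<in> s" using surj[OF y(1)] by blast
      have "E = (\<Union>z\<in>r `` {x}. s `` {f z})"
        unfolding cls[OF x(1)] y(2) using equiv_class_eq[OF B x(2)] by simp
      then show "E \<in> (\<lambda>C. \<Union>x\<in>C. s `` {f x}) ` (A // r)" using quotientI[OF x(1), of r] by blast
    qed
  qed
qed

theorem corollary4p3:
  fixes m n :: nat
  assumes "1 \<le> n" and "n \<le> m"
  shows "equiv (nondeg_cubics n :: 'k::{alg_closed_field, field_char_0} mpoly set) (proj_equiv n) \<and>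
    equiv (gor_algs m n :: ('k, 'k mpser set) module set) (gor_iso m n) \<and>
    (\<forall>F \<in> nondeg_cubics n :: 'k mpoly set. cubic_alg m n F \<in> gor_algs m n) \<and>
    (\<forall>(F :: 'k mpoly, G) \<in> proj_equiv n. (cubic_alg m n F, cubic_alg m n G) \<in> gor_iso m n) \<and>
    bij_betw (\<lambda>C :: 'k mpoly set. \<Union>F\<in>C. gor_iso m n `` {cubic_alg m n F})
      (nondeg_cubics n // proj_equiv n) (gor_algs m n // gor_iso m n)"
proof -
  have gor: "cubic_alg m n F \<in> gor_algs m n" if "F \<in> nondeg_cubics n" for F :: "'k mpoly"
    by (rule nondeg_cubic.cubic_alg_gor) (use that assms in unfold_locales)
  then have cub: "cubic_alg m n \<in> (nondeg_cubics n :: 'k mpoly set) \<rightarrow> gor_algs m n" by blast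
  have surj: "\<exists>F\<in>nondeg_cubics n :: 'k mpoly set. (cubic_alg m n F, A) \<in> gor_iso m n"
    if "A \<in> gor_algs m n" for A :: "('k, 'k mpser set) module"
    using gor_algs_cubic[OF that assms(1)] that gor by (auto simp: gor_iso_def)
  have "(cubic_alg m n F, cubic_alg m n G) \<in> gor_iso m n" if "(F, G) \<in> proj_equiv n" for F G :: "'k mpoly"
    using that proj_equiv_iff[OF assms] by blast
  then have "\<forall>(F :: 'k mpoly, G) \<in> proj_equiv n. (cubic_alg m n F, cubic_alg m n G) \<in> gor_iso m n"
    by (intro ballI case_prodI2) blast
  then show ?thesis
  proof (intro conjI)
    show "equiv (nondeg_cubics n :: 'k mpoly set) (proj_equiv n)"
      by (rule bij_betw_quotients(1)[OF equiv_gor_iso cub proj_equiv_iff[OF assms]]) (rule surj)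
    show "bij_betw (\<lambda>C :: 'k mpoly set. \<Union>F\<in>C. gor_iso m n `` {cubic_alg m n F})
        (nondeg_cubics n // proj_equiv n) (gor_algs m n // gor_iso m n)"
      by (rule bij_betw_quotients(2)[OF equiv_gor_iso cub proj_equiv_iff[OF assms]]) (rule surj)
  qed (use gor equiv_gor_iso in auto)
qed

end
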